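(* In the setting described in the context, the kernel of the linear map $\partial_1:\mathrm{Sol}(A(\eta+\alpha))\to\mathrm{Sol}(\beta)$, $\varphi\mapsto\partial\varphi/\partial x_1$, equals $\mathrm{Span}\{x^u: u\in K\}$.
   Context: Let $A=(a_{ij})$ be a $d\times n$ integer matrix whose columns are distinct elements of $\{1\}\times\mathbb{Z}^{d-1}$ generating $\mathbb{Z}^d$; $m=n-d$. $I_A=\langle\partial^u-\partial^v:u,v\in\mathbb{N}^n,Au=Av\rangle$ is assumed generic (minimal generating set of binomials in which every variable occurs) and not Cohen–Macaulay; $\mathrm{in}_{-e_1}(I_A)$ is then monomial. $B$ is an $n\times m$ integer matrix whose columns form a $\mathbb{Z}$-basis of $\ker_{\mathbb{Z}}A$. Standard pairs of a monomial ideal $M$: pairs $(\partial^\eta,\sigma)$, $\eta\in\mathbb{N}^n$, with $\eta_i=0$ for $i\in\sigma$, $\partial^\eta\prod_{i\in\sigma}\partial_i^{\mu_i}\notin M$ for all $\mu_i\ge0$, and for each $l\notin\sigma$ some $\partial^\eta\partial_l^{\mu_l}\prod_{i\in\sigma}\partial_i^{\mu_i}\in M$; embedded if $\langle\partial_j:j\notin\sigma\rangle$ is not a minimal prime of $M$. Let $\tau=\{m+3,\dots,n\}$ and $(\partial^\eta,\{1\}\cup\tau)$ an embedded standard pair of $\mathrm{in}_{-e_1}(I_A)$ such that (i) either $\{y\in\mathbb{R}^m:(By)_j\le\eta_j, 2\le j\le m+2, (By)_1\ge0\}$ is bounded, or for some $r\in\{2,\dots,m+2\}$ the hyperplanes $\{(By)_r=0\}$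 and $\{(By)_1=0\}$ coincide; (ii) whenever $(\partial^\mu,\{1\}\cup\tau)$ is a standard pair of $\mathrm{in}_{-e_1}(I_A)$ and $y\in\mathbb{C}^m$ with $\mu_i=\eta_i-(By)_i$ ($2\le i\le m+2$) and $(By)_1\in\mathbb{Z}$, then $(By)_1\le0$. Let $\alpha=\sum_{i\in\tau}\alpha_ie_i$, $\alpha_i\in\mathbb{C}$ generic, and $\beta=A(\eta+\alpha-e_1)$. $H_A(\gamma)$ is the left ideal of the Weyl algebra generated by $I_A$ and $\sum_ja_{ij}x_j\partial_j-\gamma_i$; $\mathrm{Sol}(\gamma)$ denotes its (finite-dimensional) space of holomorphic, possibly multivalued, solutions on a fixed open set where the canonical series with respect to $-e_1$ converge; differentiation in $x_1$ maps $\mathrm{Sol}(A(\eta+\alpha))$ into $\mathrm{Sol}(\beta)$. A fake exponent of $H_A(\gamma)$ w.r.t. $-e_1$ is $v\in\mathbb{C}^n$ with $Av=\gamma$ and $v_i=\mu_i$ for $i\notin\sigma$ for some standard pair $(\partial^\mu,\sigma)$ of $\mathrm{in}_{-e_1}(I_A)$. $\mathrm{nsupp}(v)=\{i:v_i\in\mathbb{Z}_{<0}\}$; $v$ has minimal negative support if for all $u\in\ker_{\mathbb{Z}}A$, $\mathrm{nsupp}(v-u)\subseteq\mathrm{nsupp}(v)$ implies equality. $F$ is the set of fake exponents of $H_A(A(\eta+\alpha))$ w.r.t. $-e_1$ with minimal negative support, and $K=\{u\in F:u_1=0\}$. *)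

theory Defs
  imports
    "HOL-Analysis.Analysis"
    "HOL-Library.Poly_Mapping"
    "HOL-Library.Extended_Nat"
    "HOL-Algebra.QuotRing"
begin

section \<open>Indices and vectors\<close>

text \<open>
  Coordinates are indexed by finite linearly ordered types; \<open>ix j\<close> is the \<open>j\<close>-th index,
  counted from 1, so that \<open>ix ` {1..CARD('n)}\<close> is the whole index type.
\<close>

definition ix :: "nat \<Rightarrow> 'n::{finite,linorder}" where
  "ix j = sorted_list_of_set UNIV ! (j - 1)"

definition nat_cvec :: "nat^'n \<Rightarrow> complex^'n::finite" where
  "nat_cvec u = (\<chi> i. of_nat (u $ i))"

definition int_cvec :: "int^'n \<Rightarrow> complex^'n::finite" where
  "int_cvec u = (\<chi> i. of_int (u $ i))"

definition nat_ivec :: "nat^'n \<Rightarrow> int^'n::finite" where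
  "nat_ivec u = (\<chi> i. int (u $ i))"

section \<open>The polynomial ring in the derivations\<close>

text \<open>The monomial with exponent vector \<open>u\<close> is \<open>Poly_Mapping.single u 1\<close>.\<close>

type_synonym 'n dpoly = "(nat^'n) \<Rightarrow>\<^sub>0 complex"

definition dring :: "'n::finite dpoly ring" where
  "dring = \<lparr>carrier = UNIV, monoid.mult = (*), one = 1, zero = 0, add = (+)\<rparr>"

abbreviation dmonom :: "nat^'n \<Rightarrow> 'n::finite dpoly" where
  "dmonom u \<equiv> Poly_Mapping.single u 1"

definition dpoly_eval :: "'n::finite dpoly \<Rightarrow> complex^'n \<Rightarrow> complex" where
  "dpoly_eval p a = (\<Sum>u\<in>Poly_Mapping.keys p. Poly_Mapping.lookup p u * (\<Prod>i\<in>UNIV. (a $ i) ^ (u $ i)))"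

definition dvars :: "'n::finite dpoly \<Rightarrow> 'n set" where
  "dvars p = {i. \<exists>u\<in>Poly_Mapping.keys p. u $ i \<noteq> 0}"

text \<open>
  A property holds for generic vectors supported on \<open>T\<close> if it holds on a nonempty
  Zariski open subset of the coordinate subspace, equivalently on the complement of the zero
  set of some nonzero polynomial.
\<close>

definition holds_generically :: "'n::finite set \<Rightarrow> (complex^'n \<Rightarrow> bool) \<Rightarrow> bool" where
  "holds_generically T P \<longleftrightarrow>
     (\<exists>p. p \<noteq> 0 \<and> dvars p \<subseteq> T \<and>
       (\<forall>a. (\<forall>i. i \<notin> T \<longrightarrow> a $ i = 0) \<and> dpoly_eval p a \<noteq> 0 \<longrightarrow> P a))"

section \<open>Toric ideals\<close>

definition toric_binomials :: "int^'n^'d \<Rightarrow> 'n::finite dpoly set" where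
  "toric_binomials A =
     {dmonom u - dmonom v | u v. A *v nat_ivec u = A *v nat_ivec v}"

definition toric_ideal :: "int^'n^'d \<Rightarrow> 'n::finite dpoly set" where
  "toric_ideal A = genideal dring (toric_binomials A)"

definition generic_toric_ideal :: "int^'n^'d \<Rightarrow> bool" where
  "generic_toric_ideal A \<longleftrightarrow>
     (\<exists>G \<subseteq> toric_binomials A.
        genideal dring G = toric_ideal A \<and>
        (\<forall>G'. G' \<subset> G \<longrightarrow> genideal dring G' \<noteq> toric_ideal A) \<and>
        (\<forall>g\<in>G. dvars g = UNIV))"

section \<open>Cohen--Macaulay rings\<close>

text \<open>
  For noetherian rings, following Eisenbud: a ring is Cohen--Macaulay if depth and codimension
  agree for every maximal ideal.
\<close>

definition regular_seq :: "('a, 'b) ring_scheme \<Rightarrow> 'a list \<Rightarrow> bool" where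
  "regular_seq R fs \<longleftrightarrow>
     set fs \<subseteq> carrier R \<and>
     (\<forall>k<length fs. \<forall>r\<in>carrier R.
        fs ! k \<otimes>\<^bsub>R\<^esub> r \<in> genideal R (set (take k fs)) \<longrightarrow> r \<in> genideal R (set (take k fs))) \<and>
     genideal R (set fs) \<noteq> carrier R"

definition ideal_depth :: "('a, 'b) ring_scheme \<Rightarrow> 'a set \<Rightarrow> enat" where
  "ideal_depth R P = Sup {enat (length fs) | fs. regular_seq R fs \<and> set fs \<subseteq> P}"

definition prime_codim :: "('a, 'b) ring_scheme \<Rightarrow> 'a set \<Rightarrow> enat" where
  "prime_codim R P =
     Sup {enat k | k Q. (\<forall>i\<le>k. primeideal (Q i) R) \<and> (\<forall>i<k. Q i \<subset> Q (Suc i)) \<and> Q k = P}"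

definition cohen_macaulay :: "('a, 'b) ring_scheme \<Rightarrow> bool" where
  "cohen_macaulay R \<longleftrightarrow> (\<forall>P. maximalideal P R \<longrightarrow> ideal_depth R P = prime_codim R P)"

section \<open>Initial ideals and standard pairs\<close>

definition weight :: "real^'n \<Rightarrow> nat^'n::finite \<Rightarrow> real" where
  "weight w u = (\<Sum>i\<in>UNIV. w $ i * real (u $ i))"

definition init_form :: "real^'n \<Rightarrow> 'n dpoly \<Rightarrow> 'n::finite dpoly" where
  "init_form w f =
     (\<Sum>u | u \<in> Poly_Mapping.keys f \<and> (\<forall>v\<in>Poly_Mapping.keys f. weight w v \<le> weight w u). Poly_Mapping.single u (Poly_Mapping.lookup f u))"

definition init_ideal :: "real^'n \<Rightarrow> 'n dpoly set \<Rightarrow> 'n::finite dpoly set" where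
  "init_ideal w I = genideal dring (init_form w ` I)"

definition minimal_prime :: "('a, 'b) ring_scheme \<Rightarrow> 'a set \<Rightarrow> 'a set \<Rightarrow> bool" where
  "minimal_prime R M P \<longleftrightarrow>
     primeideal P R \<and> M \<subseteq> P \<and> (\<forall>Q. primeideal Q R \<and> M \<subseteq> Q \<and> Q \<subseteq> P \<longrightarrow> Q = P)"

definition standard_pair :: "'n::finite dpoly set \<Rightarrow> nat^'n \<Rightarrow> 'n set \<Rightarrow> bool" where
  "standard_pair M \<eta> \<sigma> \<longleftrightarrow>
     (\<forall>i\<in>\<sigma>. \<eta> $ i = 0) \<and>
     (\<forall>\<mu>. (\<forall>i. i \<notin> \<sigma> \<longrightarrow> \<mu> $ i = 0) \<longrightarrow> dmonom (\<eta> + \<mu>) \<notin> M) \<and>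
     (\<forall>l. l \<notin> \<sigma> \<longrightarrow>
        (\<exists>\<mu>. (\<forall>i. i \<notin> insert l \<sigma> \<longrightarrow> \<mu> $ i = 0) \<and> dmonom (\<eta> + \<mu>) \<in> M))"

definition embedded_standard_pair :: "'n::finite dpoly set \<Rightarrow> nat^'n \<Rightarrow> 'n set \<Rightarrow> bool" where
  "embedded_standard_pair M \<eta> \<sigma> \<longleftrightarrow>
     standard_pair M \<eta> \<sigma> \<and>
     \<not> minimal_prime dring M (genideal dring {dmonom (axis j 1) | j. j \<notin> \<sigma>})"

section \<open>Exponents\<close>

definition fake_exponents :: "int^'n^'d \<Rightarrow> complex^'d \<Rightarrow> real^'n \<Rightarrow> (complex^'n::finite) set" where
  "fake_exponents A \<gamma> w =
     {v. map_matrix of_int A *v v = \<gamma> \<and>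
         (\<exists>\<mu> \<sigma>. standard_pair (init_ideal w (toric_ideal A)) \<mu> \<sigma> \<and>
                (\<forall>i. i \<notin> \<sigma> \<longrightarrow> v $ i = of_nat (\<mu> $ i)))}"

definition nsupp :: "complex^'n::finite \<Rightarrow> 'n set" where
  "nsupp v = {i. \<exists>k::int. k < 0 \<and> v $ i = of_int k}"

definition minimal_nsupp :: "int^'n^'d \<Rightarrow> complex^'n::finite \<Rightarrow> bool" where
  "minimal_nsupp A v \<longleftrightarrow>
     (\<forall>u. A *v u = 0 \<longrightarrow> nsupp (v - int_cvec u) \<subseteq> nsupp v \<longrightarrow> nsupp (v - int_cvec u) = nsupp v)"

section \<open>The Weyl algebra\<close>

text \<open>
  An element of the Weyl algebra is written in its normal form, a finite sum of
  \<open>c x\<^sup>a \<partial>\<^sup>b\<close>, and is represented by the coefficient function \<open>(a, b) \<mapsto> c\<close>.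
  Left multiplication by \<open>\<partial>\<^sub>j\<close> uses
  \<open>\<partial>\<^sub>j x\<^sup>a \<partial>\<^sup>b = x\<^sup>a \<partial>\<^sup>b \<partial>\<^sub>j + a\<^sub>j x\<^sup>a x\<^sub>j\<^sup>-\<^sup>1 \<partial>\<^sup>b\<close>.  As the algebra is generated over the complex
  numbers by the \<open>x\<^sub>j\<close> and \<open>\<partial>\<^sub>j\<close>, a left ideal is a linear subspace that is stable under left
  multiplication by these.
\<close>

type_synonym 'n weyl = "((nat^'n) \<times> (nat^'n)) \<Rightarrow>\<^sub>0 complex"

definition weyl_x_mult :: "'n \<Rightarrow> 'n weyl \<Rightarrow> 'n::finite weyl" where
  "weyl_x_mult j P =
     (\<Sum>(a, b)\<in>Poly_Mapping.keys P. Poly_Mapping.single (a + axis j 1, b) (Poly_Mapping.lookup P (a, b)))"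

definition weyl_d_mult :: "'n \<Rightarrow> 'n weyl \<Rightarrow> 'n::finite weyl" where
  "weyl_d_mult j P =
     (\<Sum>(a, b)\<in>Poly_Mapping.keys P.
        Poly_Mapping.single (a, b + axis j 1) (Poly_Mapping.lookup P (a, b)) +
        Poly_Mapping.single (a - axis j 1, b) (of_nat (a $ j) * Poly_Mapping.lookup P (a, b)))"

inductive_set weyl_left_ideal :: "'n::finite weyl set \<Rightarrow> 'n weyl set"
  for G :: "'n weyl set" where
  gen: "P \<in> G \<Longrightarrow> P \<in> weyl_left_ideal G"
| zero: "0 \<in> weyl_left_ideal G"
| add: "P \<in> weyl_left_ideal G \<Longrightarrow> Q \<in> weyl_left_ideal G \<Longrightarrow> P + Q \<in> weyl_left_ideal G"
| scale: "P \<in> weyl_left_ideal G \<Longrightarrow> Poly_Mapping.map ((*) c) P \<in> weyl_left_ideal G"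
| x_mult: "P \<in> weyl_left_ideal G \<Longrightarrow> weyl_x_mult j P \<in> weyl_left_ideal G"
| d_mult: "P \<in> weyl_left_ideal G \<Longrightarrow> weyl_d_mult j P \<in> weyl_left_ideal G"

definition weyl_of_dpoly :: "'n::finite dpoly \<Rightarrow> 'n weyl" where
  "weyl_of_dpoly f = (\<Sum>u\<in>Poly_Mapping.keys f. Poly_Mapping.single (0, u) (Poly_Mapping.lookup f u))"

definition euler_op :: "int^'n^'d \<Rightarrow> complex^'d \<Rightarrow> 'd \<Rightarrow> 'n::finite weyl" where
  "euler_op A \<gamma> i =
     (\<Sum>j\<in>UNIV. Poly_Mapping.single (axis j 1, axis j 1) (of_int (A $ i $ j)))
     - Poly_Mapping.single (0, 0) (\<gamma> $ i)"

definition hypergeometric_ideal :: "int^'n^'d \<Rightarrow> complex^'d \<Rightarrow> 'n::finite weyl set" where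
  "hypergeometric_ideal A \<gamma> =
     weyl_left_ideal (weyl_of_dpoly ` toric_ideal A \<union> range (euler_op A \<gamma>))"

text \<open>
  The action on a function space on which \<open>x\<^sub>j\<close> and \<open>\<partial>\<^sub>j\<close> act as \<open>X j\<close> and \<open>D j\<close>.  The order of
  composition in \<open>multi_pow\<close> is immaterial when these commute for different indices.
\<close>

definition multi_pow :: "('n \<Rightarrow> 'v \<Rightarrow> 'v) \<Rightarrow> nat^'n::{finite,linorder} \<Rightarrow> 'v \<Rightarrow> 'v" where
  "multi_pow T a = fold (\<lambda>j. T j ^^ (a $ j)) (sorted_list_of_set UNIV)"

definition weyl_act ::
  "('n \<Rightarrow> ('b \<Rightarrow> complex) \<Rightarrow> 'b \<Rightarrow> complex) \<Rightarrow> ('n \<Rightarrow> ('b \<Rightarrow> complex) \<Rightarrow> 'b \<Rightarrow> complex) \<Rightarrow>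
   'n::{finite,linorder} weyl \<Rightarrow> ('b \<Rightarrow> complex) \<Rightarrow> 'b \<Rightarrow> complex" where
  "weyl_act X D P f =
     (\<lambda>z. \<Sum>(a, b)\<in>Poly_Mapping.keys P. Poly_Mapping.lookup P (a, b) * multi_pow X a (multi_pow D b f) z)"

section \<open>Holomorphic solutions\<close>

text \<open>
  Functions on \<open>U\<close> are extended by 0 outside \<open>U\<close>, so that equality of functions is equality
  on \<open>U\<close>.
\<close>

definition holomorphic_fns :: "(complex^'n::finite) set \<Rightarrow> (complex^'n \<Rightarrow> complex) set" where
  "holomorphic_fns U =
     {f. (\<forall>z\<in>U. \<exists>f'. (f has_derivative f') (at z) \<and> (\<forall>c v. f' (c *s v) = c * f' v)) \<and>
         (\<forall>z. z \<notin> U \<longrightarrow> f z = 0)}"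

definition x_fn :: "'n::finite \<Rightarrow> (complex^'n \<Rightarrow> complex) \<Rightarrow> complex^'n \<Rightarrow> complex" where
  "x_fn j f = (\<lambda>z. z $ j * f z)"

definition d_fn :: "(complex^'n::finite) set \<Rightarrow> 'n \<Rightarrow>
    (complex^'n \<Rightarrow> complex) \<Rightarrow> complex^'n \<Rightarrow> complex" where
  "d_fn U j f = (\<lambda>z. if z \<in> U then deriv (\<lambda>t. f (z + axis j t)) 0 else 0)"

definition Sol :: "int^'n::{finite,linorder}^'d \<Rightarrow> (complex^'n::{finite,linorder}) set \<Rightarrow> complex^'d \<Rightarrow>
    (complex^'n::{finite,linorder} \<Rightarrow> complex) set" where
  "Sol A U \<gamma> =
     {f \<in> holomorphic_fns U. \<forall>P\<in>hypergeometric_ideal A \<gamma>. weyl_act x_fn (d_fn U) P f = (\<lambda>z. 0)}"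

text \<open>In the following, \<open>\<L>\<close> is a branch of \<open>(log x\<^sub>1, \<dots>, log x\<^sub>n)\<close> on \<open>U\<close>.\<close>

definition xpow :: "(complex^'n \<Rightarrow> complex^'n) \<Rightarrow> complex^'n \<Rightarrow> complex^'n::finite \<Rightarrow> complex" where
  "xpow \<L> u z = exp (\<Sum>j\<in>UNIV. u $ j * \<L> z $ j)"

definition xpow_on :: "(complex^'n) set \<Rightarrow> (complex^'n \<Rightarrow> complex^'n) \<Rightarrow> complex^'n \<Rightarrow>
    complex^'n::finite \<Rightarrow> complex" where
  "xpow_on U \<L> u = (\<lambda>z. if z \<in> U then xpow \<L> u z else 0)"

definition cspan :: "('b \<Rightarrow> complex) set \<Rightarrow> ('b \<Rightarrow> complex) set" where
  "cspan S = {\<lambda>z. \<Sum>f\<in>T. c f * f z | T c. finite T \<and> T \<subseteq> S}"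

section \<open>Series solutions and their domain of convergence\<close>

text \<open>
  A formal logarithmic series is given by its coefficients \<open>c (p, b)\<close> at \<open>x\<^sup>p (log x)\<^sup>b\<close>.
  It lies in the Nilsson ring in direction \<open>w\<close> if its exponents \<open>p\<close> lie in finitely many
  translates of the integer points of the dual of an open neighbourhood of \<open>w\<close>, and the
  degree in the logarithms is bounded.
\<close>

type_synonym 'n log_series = "(complex^'n) \<times> (nat^'n) \<Rightarrow> complex"

definition nilsson_series :: "real^'n \<Rightarrow> 'n::finite log_series \<Rightarrow> bool" where
  "nilsson_series w c \<longleftrightarrow>
     (\<exists>N V K. open N \<and> w \<in> N \<and> finite V \<and>
       (\<forall>p b. c (p, b) \<noteq> 0 \<longrightarrow>
          (\<exists>v\<in>V. \<exists>u::int^'n. p = v + int_cvec u \<and>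
             (\<forall>w'\<in>N. 0 \<le> (\<Sum>i\<in>UNIV. w' $ i * real_of_int (u $ i)))) \<and>
          (\<Sum>i\<in>UNIV. b $ i) \<le> (K::nat)))"

definition x_series :: "'n::finite \<Rightarrow> 'n log_series \<Rightarrow> 'n log_series" where
  "x_series j c = (\<lambda>(p, b). c (p - axis j 1, b))"

text \<open>
  From \<open>\<partial>\<^sub>j x\<^sup>p (log x)\<^sup>b = x\<^sup>p x\<^sub>j\<^sup>-\<^sup>1 (p\<^sub>j (log x)\<^sup>b + b\<^sub>j (log x)\<^sup>b (log x\<^sub>j)\<^sup>-\<^sup>1)\<close>.
\<close>

definition d_series :: "'n::finite \<Rightarrow> 'n log_series \<Rightarrow> 'n log_series" where
  "d_series j c =
     (\<lambda>(p, b). (p $ j + 1) * c (p + axis j 1, b)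
             + of_nat (b $ j + 1) * c (p + axis j 1, b + axis j 1))"

definition nilsson_solution ::
  "int^'n::{finite,linorder}^'d \<Rightarrow> complex^'d \<Rightarrow> real^'n::{finite,linorder} \<Rightarrow> 'n::{finite,linorder} log_series \<Rightarrow> bool" where
  "nilsson_solution A \<gamma> w c \<longleftrightarrow>
     nilsson_series w c \<and>
     (\<forall>P\<in>hypergeometric_ideal A \<gamma>. weyl_act x_series d_series P c = (\<lambda>_. 0))"

text \<open>
  The canonical series with respect to \<open>w\<close> form a basis of the solutions in the Nilsson ring.
  Hence all of them converge at a point if and only if all Nilsson solutions do.
\<close>

definition canonical_series_converge ::
  "int^'n::{finite,linorder}^'d \<Rightarrow> complex^'d \<Rightarrow> real^'n::{finite,linorder} \<Rightarrow> (complex^'n::{finite,linorder}) set \<Rightarrow>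
   (complex^'n::{finite,linorder} \<Rightarrow> complex^'n::{finite,linorder}) \<Rightarrow> bool" where
  "canonical_series_converge A \<gamma> w U \<L> \<longleftrightarrow>
     (\<forall>c. nilsson_solution A \<gamma> w c \<longrightarrow>
        (\<forall>z\<in>U. (\<lambda>(p, b). c (p, b) * xpow \<L> p z * (\<Prod>j\<in>UNIV. (\<L> z $ j) ^ (b $ j)))
                  summable_on UNIV))"

text \<open>
  Multivalued functions become single valued on simply connected sets; on such a set in the
  complex torus a branch of the logarithms is fixed.
\<close>

definition log_branch_domain ::
  "(complex^'n) set \<Rightarrow> (complex^'n \<Rightarrow> complex^'n::finite) \<Rightarrow> bool" where
  "log_branch_domain U \<L> \<longleftrightarrow>
     open U \<and> U \<noteq> {} \<and> simply_connected U \<and> continuous_on U \<L> \<and>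
     (\<forall>z\<in>U. \<forall>j. exp (\<L> z $ j) = z $ j)"

end

theory Submission
  imports Defs "HOL-Complex_Analysis.Cauchy_Integral_Formula"
begin

text \<open>
  A function killed by \<open>I\<^sub>A\<close> and by \<open>\<partial>\<^sub>1\<close> is killed by the initial ideal \<open>M\<close> of \<open>I\<^sub>A\<close> with
  respect to \<open>-e\<^sub>1\<close>: either the initial form of an operator involves \<open>\<partial>\<^sub>1\<close>, or all of its other
  terms do.  Writing \<open>x\<^sup>b \<partial>\<^sup>b\<close> as a product of factors \<open>\<theta>\<^sub>j - k\<close> with \<open>\<theta>\<^sub>j = x\<^sub>j \<partial>\<^sub>j\<close>, the kernel
  is annihilated by an ideal \<open>J\<close> of \<open>\<complex>[\<theta>]\<close> whose zeros are the fake exponents \<open>v\<close> with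
  \<open>v\<^sub>1 = 0\<close>.  As every minimal generator of \<open>I\<^sub>A\<close> involves \<open>\<partial>\<^sub>1\<close>, a monomial \<open>\<partial>\<^sup>u\<close> with
  \<open>u\<^sub>1 = 0\<close> lies in \<open>M\<close> as soon as \<open>A u = A u'\<close> for some \<open>u' \<noteq> u\<close>.  Hence the columns belonging to
  a standard pair are independent, for generic \<open>\<alpha>\<close> every standard pair through a zero \<open>v\<close> contains
  \<open>\<tau>\<close>, and besides \<open>\<tau>\<close> at most two further columns occur there, because \<open>\<tau>\<close> has
  codimension two.  These columns are again independent, so the Euler operators make \<open>J\<close> reduced
  at \<open>v\<close>.  Therefore 1 is, modulo \<open>J\<close>, a sum of Lagrange idempotents, and these split a kernel
  element into joint eigenfunctions of the \<open>\<theta>\<^sub>j\<close>, which are multiples of the \<open>x\<^sup>v\<close>.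
  Conversely each such \<open>x\<^sup>v\<close> is killed by both terms of every generator, and the minimality of its
  negative support is automatic.
\<close>

section \<open>Products of point ideals\<close>

text \<open>\<open>J\<close> is the annihilator of one kernel element, so only some of its members
  are known, and it may even be the whole ring. The location of its zeros and multiplicity one are
  therefore expressed by memberships: products with one linear form \<open>X j - c (v $ j)\<close>
  per point of a list lie in \<open>J\<close>. They are proved by splitting \<open>J\<close> along a
  linear factor f into J + (f) and J : f. Both contain \<open>J\<close>, which is why the lemmas
  speak of every ideal above the known relations. Multiplicity one at v has two sources. A
  coordinate is settled at once if, at v, some falling factorial vanishes only through it. The
  others form \<tau> and a set L such that \<tau> with any one element of L is a face. A relation
  between \<tau> and three elements of L has a side with at most one element of L; this side would
  be a monomial of M supported on a face, which cannot be. As \<tau> has at least d - 2 elements,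
  three elements of L would give more than d independent columns. So L has at most two elements, and
  the Euler operators settle \<tau> and L together.\<close>

definition ideal_set :: "'r::comm_ring_1 set \<Rightarrow> bool" where
  "ideal_set J \<longleftrightarrow> 0 \<in> J \<and> (\<forall>a\<in>J. \<forall>b\<in>J. a + b \<in> J) \<and> (\<forall>a\<in>J. \<forall>r. r * a \<in> J)"

lemma ideal_setD:
  assumes "ideal_set J"
  shows "0 \<in> J" "a \<in> J \<Longrightarrow> b \<in> J \<Longrightarrow> a + b \<in> J" "a \<in> J \<Longrightarrow> r * a \<in> J"
    "a \<in> J \<Longrightarrow> a * r \<in> J" "a \<in> J \<Longrightarrow> - a \<in> J" "a \<in> J \<Longrightarrow> b \<in> J \<Longrightarrow> a - b \<in> J"
proof -
  show m: "r * a \<in> J" if "a \<in> J" for r a using assms that by (auto simp: ideal_set_def)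
  show p: "a + b \<in> J" if "a \<in> J" "b \<in> J" for a b using assms that by (auto simp: ideal_set_def)
  show "0 \<in> J" using assms by (auto simp: ideal_set_def)
  show "a \<in> J \<Longrightarrow> a * r \<in> J" using m[of a r] by (simp add: mult.commute)
  show n: "- a \<in> J" if "a \<in> J" for a using m[OF that, of "-1"] by simp
  show "a \<in> J \<Longrightarrow> b \<in> J \<Longrightarrow> a - b \<in> J" using p[OF _ n, of a b] by simp
qed

lemma ideal_set_sum:
  assumes "ideal_set J" "\<And>i. i \<in> I \<Longrightarrow> f i \<in> J"
  shows "sum f I \<in> J"
  using assms(2) by (induction I rule: infinite_finite_induct) (auto simp: ideal_setD[OF assms(1)])

definition ideal_colon :: "'r::comm_ring_1 set \<Rightarrow> 'r \<Rightarrow> 'r set" where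
  "ideal_colon J q = {p. p * q \<in> J}"

lemma ideal_set_colon: "ideal_set J \<Longrightarrow> ideal_set (ideal_colon J q)"
  unfolding ideal_colon_def
  by (auto simp: ideal_set_def distrib_right mult.assoc)

lemma subset_colon: "ideal_set J \<Longrightarrow> J \<subseteq> ideal_colon J q"
  unfolding ideal_colon_def by (auto simp: ideal_setD)

definition ideal_adjoin :: "'r::comm_ring_1 set \<Rightarrow> 'r \<Rightarrow> 'r set" where
  "ideal_adjoin J f = {a + f * r | a r. a \<in> J}"

lemma ideal_set_adjoin:
  assumes "ideal_set J" shows "ideal_set (ideal_adjoin J f)"
  unfolding ideal_set_def
proof (intro conjI ballI allI)
  show "0 \<in> ideal_adjoin J f"
    unfolding ideal_adjoin_def using ideal_setD(1)[OF assms] by (force intro: exI[of _ 0])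
next
  fix a b assume "a \<in> ideal_adjoin J f" "b \<in> ideal_adjoin J f"
  then obtain x r y s where *: "a = x + f * r" "b = y + f * s" "x \<in> J" "y \<in> J"
    unfolding ideal_adjoin_def by auto
  have "a + b = (x + y) + f * (r + s)" using * by (simp add: algebra_simps)
  then show "a + b \<in> ideal_adjoin J f"
    unfolding ideal_adjoin_def using ideal_setD(2)[OF assms *(3,4)] by blast
next
  fix a r assume "a \<in> ideal_adjoin J f"
  then obtain x s where *: "a = x + f * s" "x \<in> J" unfolding ideal_adjoin_def by auto
  have "r * a = r * x + f * (r * s)" using * by (simp add: algebra_simps)
  then show "r * a \<in> ideal_adjoin J f"
    unfolding ideal_adjoin_def using ideal_setD(3)[OF assms *(2)] by blast
qed

lemma subset_adjoin: "J \<subseteq> ideal_adjoin J f"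
  unfolding ideal_adjoin_def by (force intro: exI[of _ 0])

lemma mem_adjoin: "ideal_set J \<Longrightarrow> f \<in> ideal_adjoin J f"
  unfolding ideal_adjoin_def
  using ideal_setD(1)[of J] by (intro CollectI exI[of _ 0] exI[of _ 1]) auto

text \<open>\<open>c\<close> is the structure map of a complex algebra, and nothing is assumed about
  the elements \<open>X j\<close>. A point \<open>v\<close> enters through the linear forms
  \<open>X j - c (v $ j)\<close>, the generators of its ideal.\<close>

locale coordinate_ring =
  fixes X :: "'n::finite \<Rightarrow> 'r::comm_ring_1" and c :: "complex \<Rightarrow> 'r"
  assumes c_add: "c (a + b) = c a + c b"
    and c_mult: "c (a * b) = c a * c b"
    and c_1: "c 1 = 1"
begin

lemma c_0: "c 0 = 0" using c_add[of 0 0] by simp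

lemma c_minus: "c (- a) = - c a"
  using c_add[of a "-a"] by (simp add: c_0 eq_neg_iff_add_eq_0 add.commute)

lemma c_diff: "c (a - b) = c a - c b"
  using c_add[of a "-b"] by (simp add: c_minus)

lemma c_sum: "c (sum f I) = (\<Sum>i\<in>I. c (f i))"
  by (induction I rule: infinite_finite_induct) (auto simp: c_0 c_add)

lemma c_inverse: "a \<noteq> 0 \<Longrightarrow> c (inverse a) * c a = 1"
  by (simp flip: c_mult add: c_1)

lemma cancel_c:
  assumes "ideal_set J" "a \<noteq> 0" "c a * p \<in> J" shows "p \<in> J"
proof -
  have "c (inverse a) * (c a * p) \<in> J" by (rule ideal_setD(3)[OF assms(1,3)])
  then show ?thesis using c_inverse[OF assms(2)] by (simp flip: mult.assoc)
qed

text \<open>The coordinate is chosen separately in each factor. That all these products lie in an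
  ideal \<open>J\<close> means that the product of the ideals of the listed points lies in
  \<open>J\<close>.\<close>

fun point_products :: "(complex^'n) list \<Rightarrow> 'r set" where
  "point_products [] = {1}"
| "point_products (v # vs) = {(X j - c (v $ j)) * q | j q. q \<in> point_products vs}"

lemma point_products_append:
  "point_products (vs @ ws) = {p * q | p q. p \<in> point_products vs \<and> q \<in> point_products ws}"
proof (induction vs)
  case Nil show ?case by auto
next
  case (Cons v vs)
  show ?case
  proof (intro Set.set_eqI iffI)
    fix x assume "x \<in> point_products ((v # vs) @ ws)"
    then obtain j p q where "x = (X j - c (v $ j)) * (p * q)"
      "p \<in> point_products vs" "q \<in> point_products ws"
      using Cons.IH by auto
    then show "x \<in> {p * q | p q. p \<in> point_products (v # vs) \<and> q \<in> point_products ws}"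
      by (intro CollectI exI[of _ "(X j - c (v $ j)) * p"] exI[of _ q]) (auto simp: mult.assoc)
  next
    fix x assume "x \<in> {p * q | p q. p \<in> point_products (v # vs) \<and> q \<in> point_products ws}"
    then obtain j p q where "x = (X j - c (v $ j)) * p * q"
      "p \<in> point_products vs" "q \<in> point_products ws"
      by auto
    then show "x \<in> point_products ((v # vs) @ ws)"
      using Cons.IH by (auto simp: mult.assoc intro!: exI[of _ j])
  qed
qed

text \<open>The algebraic form of a finite zero set inside \<open>E\<close>. Repetitions in the list
  allow for multiplicities, and the empty list covers the unit ideal.\<close>

definition has_point_product :: "(complex^'n) set \<Rightarrow> 'r set \<Rightarrow> bool" where
  "has_point_product E J \<longleftrightarrow> (\<exists>vs. set vs \<subseteq> E \<and> point_products vs \<subseteq> J)"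

text \<open>If \<open>p = a + f * r\<close> with \<open>a\<close> in \<open>J\<close>, and
  \<open>q * f\<close> is in \<open>J\<close>, then \<open>p * q = a * q + r * (q * f)\<close> is in
  \<open>J\<close>; so the two lists are concatenated.\<close>

lemma has_point_product_adjoin_colon:
  assumes J: "ideal_set J"
    and adj: "has_point_product E (ideal_adjoin J f)" and col: "has_point_product E (ideal_colon J f)"
  shows "has_point_product E J"
proof -
  obtain vs ws where *: "set vs \<subseteq> E" "set ws \<subseteq> E" "point_products vs \<subseteq> ideal_adjoin J f"
    "point_products ws \<subseteq> ideal_colon J f"
    using adj col unfolding has_point_product_def by auto
  have "p * q \<in> J" if p: "p \<in> point_products vs" and q: "q \<in> point_products ws" for p q
  proof -
    obtain a r where a: "p = a + f * r" "a \<in> J"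
      using p *(3) unfolding ideal_adjoin_def by blast
    have "q * f \<in> J" using q *(4) unfolding ideal_colon_def by blast
    then have "a * q + r * (q * f) \<in> J" 
      using a(2) ideal_setD(2-4)[OF J] by blast
    then show ?thesis using a by (simp add: algebra_simps)
  qed
  then show ?thesis
    unfolding has_point_product_def using *(1,2)
    by (intro exI[of _ "vs @ ws"]) (auto simp: point_products_append)
qed

text \<open>The first factor is either adjoined, and \<open>step\<close> applies, or divided out by
  passing to a colon ideal, which contains the product of the remaining factors. As the ideal grows
  on the way, \<open>step\<close> has to speak of all ideals above \<open>J\<close>.\<close>

lemma has_point_product_linear_factors:
  assumes "ideal_set J" "prod_list (map (\<lambda>(i, a). X i - c a) fs) \<in> J"
    and step: "\<And>J' i a. ideal_set J' \<Longrightarrow> J \<subseteq> J' \<Longrightarrow> (i, a) \<in> set fs \<Longrightarrow> X i - c a \<in> J' \<Longrightarrow>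
      has_point_product E J'"
  shows "has_point_product E J"
  using assms
proof (induction fs arbitrary: J)
  case Nil
  then show ?case unfolding has_point_product_def by (intro exI[of _ "[]"]) auto
next
  case (Cons f fs)
  obtain i a where f: "f = (i, a)" by (cases f)
  note J = Cons.prems(1)
  show ?case
  proof (rule has_point_product_adjoin_colon[OF J])
    show "has_point_product E (ideal_adjoin J (X i - c a))"
      by (rule Cons.prems(3)[OF ideal_set_adjoin[OF J] subset_adjoin _ mem_adjoin[OF J]])
        (simp add: f)
    show "has_point_product E (ideal_colon J (X i - c a))"
    proof (rule Cons.IH)
      show "ideal_set (ideal_colon J (X i - c a))" by (rule ideal_set_colon[OF J])
      show "(\<Prod>(i, a)\<leftarrow>fs. X i - c a) \<in> ideal_colon J (X i - c a)"
        using Cons.prems(2) by (simp add: f ideal_colon_def mult.commute)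
      show "has_point_product E J'" if "ideal_set J'" "ideal_colon J (X i - c a) \<subseteq> J'"
        "(i', a') \<in> set fs" "X i' - c a' \<in> J'" for J' i' a'
        using Cons.prems(3)[OF that(1) _ _ that(4)] that(2,3) subset_colon[OF J] by auto
    qed
  qed
qed

lemma distinct_point_product:
  assumes J: "ideal_set J" and "has_point_product E J"
    and loc: "\<And>v J'. v \<in> E \<Longrightarrow> ideal_set J' \<Longrightarrow> J \<subseteq> J' \<Longrightarrow>
      (\<And>j k. (X j - c (v $ j)) * (X k - c (v $ k)) \<in> J') \<Longrightarrow> (\<And>j. X j - c (v $ j) \<in> J')"
  shows "\<exists>vs. set vs \<subseteq> E \<and> distinct vs \<and> point_products vs \<subseteq> J"
proof -
  obtain vs where "set vs \<subseteq> E" "point_products vs \<subseteq> J"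
    using assms(2) unfolding has_point_product_def by auto
  then show ?thesis
  proof (induction vs rule: length_induct)
    case (1 vs)
    show ?case
    proof (cases "distinct vs")
      case True then show ?thesis using 1 by auto
    next
      case False
      then obtain xs ys zs v where vs: "vs = xs @ [v] @ ys @ [v] @ zs"
        using not_distinct_decomp by blast
      let ?s = "\<lambda>j. X j - c (v $ j)"
      have "?s j * (p * (q * r)) \<in> J"
        if p: "p \<in> point_products xs" and q: "q \<in> point_products ys" and r: "r \<in> point_products zs"
        for p q r j
      proof -
        let ?J = "ideal_colon J (p * (q * r))"
        have "?s j * ?s k \<in> ?J" for j k
        proof -
          have "p * (?s j * (q * (?s k * r))) \<in> point_products vs"
            unfolding vs using p q r by (auto simp: point_products_append)
              (metis mult.assoc)
          then have "p * (?s j * (q * (?s k * r))) \<in> J" using 1 by auto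
          then show ?thesis unfolding ideal_colon_def by (simp add: algebra_simps)
        qed
        then have "?s j \<in> ?J"
          using 1(2) vs by (intro loc ideal_set_colon subset_colon J) auto
        then show ?thesis by (simp add: ideal_colon_def)
      qed
      then have "p * (?s j * (q * r)) \<in> J"
        if "p \<in> point_products xs" "q \<in> point_products ys" "r \<in> point_products zs" for p q r j
        using that by (metis mult.left_commute)
      then have "point_products (xs @ [v] @ ys @ zs) \<subseteq> J"
        by (auto simp: point_products_append)
      moreover have "length (xs @ [v] @ ys @ zs) < length vs" "set (xs @ [v] @ ys @ zs) \<subseteq> E"
        using 1(2) by (auto simp: vs)
      ultimately show ?thesis using 1(1) by blast
    qed
  qed
qed

text \<open>The Chinese remainder theorem with explicit elements. A Lagrange polynomial
  \<open>l\<close> serves the first point; the others are treated in \<open>J : (1 - l)\<close>, and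
  the elements found there are multiplied by \<open>1 - l\<close>.\<close>

lemma partition_of_unity:
  assumes "ideal_set J" "distinct vs" "point_products vs \<subseteq> J"
  shows "\<exists>e. (\<Sum>v\<in>set vs. e v) - 1 \<in> J \<and> (\<forall>v\<in>set vs. \<forall>j. (X j - c (v $ j)) * e v \<in> J)"
  using assms
proof (induction vs arbitrary: J)
  case Nil
  then have "- 1 \<in> J" using ideal_setD(5)[OF Nil(1), of 1] by auto
  then show ?case by auto
next
  case (Cons v vs)
  note J = Cons.prems(1)
  let ?s = "\<lambda>j. X j - c (v $ j)"
  have sq: "?s j * q \<in> J" if "q \<in> point_products vs" for j q
    using Cons.prems(3) that by auto
  \<comment> \<open>A coordinate separating \<open>u\<close> from \<open>v\<close> is chosen in each
    factor, so the value \<open>a\<close> at \<open>v\<close> is a product of nonzero differences.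
    The value is stated modulo every ideal \<open>I\<close> above that of \<open>v\<close> because
    it is used in colon ideals.\<close>
  have lagr: "\<exists>q\<in>point_products us. \<exists>a. a \<noteq> 0 \<and> (\<forall>I. ideal_set I \<longrightarrow> (\<forall>j. ?s j \<in> I) \<longrightarrow> q - c a \<in> I)"
    if "v \<notin> set us" for us
    using that
  proof (induction us)
    case Nil
    show ?case by (intro bexI[of _ 1] exI[of _ 1]) (auto simp: c_1 ideal_setD)
  next
    case (Cons u us)
    then obtain q a where q: "q \<in> point_products us" "a \<noteq> 0"
      "\<And>I. ideal_set I \<Longrightarrow> (\<And>j. ?s j \<in> I) \<Longrightarrow> q - c a \<in> I" by auto
    from Cons.prems have "u \<noteq> v" by auto
    then obtain j where j: "u $ j \<noteq> v $ j" by (auto simp: vec_eq_iff)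
    show ?case
    proof (intro bexI exI conjI allI impI)
      show "(X j - c (u $ j)) * q \<in> point_products (u # us)" using q(1) by auto
      show "(v $ j - u $ j) * a \<noteq> 0" using j q(2) by simp
      fix I assume I: "ideal_set I" "\<forall>j. ?s j \<in> I"
      have "(X j - c (u $ j)) * q - c ((v $ j - u $ j) * a)
        = ?s j * q + c (v $ j - u $ j) * (q - c a)"
        by (simp add: c_mult c_diff algebra_simps)
      also have "\<dots> \<in> I" using I q(3)[OF I(1)] ideal_setD(2-4)[OF I(1)] by blast
      finally show "(X j - c (u $ j)) * q - c ((v $ j - u $ j) * a) \<in> I" .
    qed
  qed
  obtain q a where q: "q \<in> point_products vs" "a \<noteq> 0"
    "\<And>I. ideal_set I \<Longrightarrow> (\<And>j. ?s j \<in> I) \<Longrightarrow> q - c a \<in> I"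
    using lagr[of vs] Cons.prems(2) by auto
  define l where "l = c (inverse a) * q"
  have l1: "l - 1 \<in> I" if "ideal_set I" "\<And>j. ?s j \<in> I" for I
  proof -
    have "l - 1 = c (inverse a) * (q - c a)"
      using c_inverse[OF q(2)] by (simp add: l_def algebra_simps)
    also have "\<dots> \<in> I" using that by (intro ideal_setD(3)[OF that(1)] q(3))
    finally show ?thesis .
  qed
  let ?J = "ideal_colon J (1 - l)"
  \<comment> \<open>For \<open>p\<close> in this set, \<open>J : p\<close> contains the ideal of
    \<open>v\<close>, hence also \<open>l - 1\<close>.\<close>
  have "point_products vs \<subseteq> ?J"
  proof
    fix p assume p: "p \<in> point_products vs"
    have "l - 1 \<in> ideal_colon J p"
      using sq[OF p] by (intro l1 ideal_set_colon[OF J]) (auto simp: ideal_colon_def)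
    then have "- ((l - 1) * p) \<in> J" by (intro ideal_setD(5)[OF J]) (auto simp: ideal_colon_def)
    then show "p \<in> ?J" by (simp add: ideal_colon_def algebra_simps)
  qed
  then obtain e where e: "(\<Sum>u\<in>set vs. e u) - 1 \<in> ?J"
    "\<And>u j. u \<in> set vs \<Longrightarrow> (X j - c (u $ j)) * e u \<in> ?J"
    using Cons.IH[OF ideal_set_colon[OF J, of "1 - l"]] Cons.prems(2) by auto
  let ?e = "\<lambda>u. if u = v then l else e u * (1 - l)"
  have v: "v \<notin> set vs" using Cons.prems(2) by simp
  have eq: "(\<Sum>u\<in>set vs. ?e u) = (\<Sum>u\<in>set vs. e u) * (1 - l)"
    using v by (auto simp: sum_distrib_right intro!: sum.cong)
  have "(\<Sum>u\<in>set (v # vs). ?e u) - 1 = ((\<Sum>u\<in>set vs. e u) - 1) * (1 - l)"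
    using v by (simp add: eq, simp add: algebra_simps)
  also have "\<dots> \<in> J" using e(1) by (simp add: ideal_colon_def)
  finally have 1: "(\<Sum>u\<in>set (v # vs). ?e u) - 1 \<in> J" .
  have 2: "(X j - c (u $ j)) * ?e u \<in> J" if "u \<in> set (v # vs)" for u j
  proof (cases "u = v")
    case True
    have "c (inverse a) * (?s j * q) \<in> J" by (intro ideal_setD[OF J] sq q)
    then show ?thesis using True by (simp add: l_def mult.left_commute)
  next
    case False
    then show ?thesis using e(2)[of u j] that by (auto simp: ideal_colon_def mult.assoc)
  qed
  show ?case using 1 2 by (intro exI[of _ ?e]) auto
qed

end

section \<open>Initial ideals and standard pairs\<close>

lemma carrier_dring: "carrier dring = UNIV"
  by (simp add: dring_def)

lemma ring_dring: "ring (dring :: 'n::finite dpoly ring)"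
proof (rule ringI)
  show "abelian_group (dring :: 'n dpoly ring)"
    by (rule abelian_groupI) (auto simp: dring_def algebra_simps intro: exI[of _ "- x" for x])
  show "monoid (dring :: 'n dpoly ring)"
    by (rule monoidI) (auto simp: dring_def algebra_simps)
qed (auto simp: dring_def algebra_simps)

text \<open>Connects the record-based ideals of the definitions with \<open>ideal_set\<close>, which
  lives in the type class and so admits ordinary ring arithmetic.\<close>

lemma ideal_dring_iff: "ideal J dring \<longleftrightarrow> ideal_set (J :: 'n::finite dpoly set)"
proof
  assume J: "ideal J dring"
  have "additive_subgroup J dring" using J by (rule ideal.axioms(1))
  then show "ideal_set J"
    unfolding ideal_set_def
    using additive_subgroup.zero_closed[of J dring] additive_subgroup.a_closed[of J dring]
      ideal.I_l_closed[OF J] by (auto simp: dring_def)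
next
  assume J: "ideal_set J"
  have grp: "Group.group (add_monoid (dring :: 'n dpoly ring))"
    using ring_dring abelian_group.a_group ring_def by blast
  show "ideal J dring"
  proof (rule idealI[OF ring_dring])
    show "subgroup J (add_monoid dring)"
    proof (rule group.subgroupI[OF grp])
      show "J \<noteq> {}" using ideal_setD(1)[OF J] by auto
      fix a assume a: "a \<in> J"
      have "inv\<^bsub>add_monoid dring\<^esub> a = - a"
        by (rule group.inv_equality[OF grp]) (auto simp: dring_def)
      then show "inv\<^bsub>add_monoid dring\<^esub> a \<in> J" using ideal_setD(5)[OF J a] by simp
    qed (auto simp: dring_def ideal_setD[OF J])
  qed (auto simp: dring_def ideal_setD[OF J])
qed

lemma ideal_set_genideal: "ideal_set (genideal dring (S :: 'n::finite dpoly set))"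
  using ring.genideal_ideal[OF ring_dring, of S] by (simp add: ideal_dring_iff carrier_dring)

lemma genideal_dring_superset: "S \<subseteq> genideal dring (S :: 'n::finite dpoly set)"
  using ring.genideal_self[OF ring_dring, of S] by (simp add: carrier_dring)

lemma genideal_dring_least:
  "ideal_set J \<Longrightarrow> S \<subseteq> J \<Longrightarrow> genideal dring (S :: 'n::finite dpoly set) \<subseteq> J"
  using ring.genideal_minimal[OF ring_dring, of J S] by (simp add: ideal_dring_iff)

text \<open>The polynomials all of whose terms are divisible by a term of some element of
  \<open>G\<close> form an ideal, since cancellation can only remove terms.\<close>

lemma keys_genideal:
  fixes G :: "'n::finite dpoly set"
  assumes "f \<in> genideal dring G" "u \<in> Poly_Mapping.keys f"
  shows "\<exists>g\<in>G. \<exists>k\<in>Poly_Mapping.keys g. \<forall>i. k $ i \<le> u $ i"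
proof -
  let ?J = "{f :: 'n dpoly. \<forall>u\<in>Poly_Mapping.keys f. \<exists>g\<in>G. \<exists>k\<in>Poly_Mapping.keys g. \<forall>i. k $ i \<le> u $ i}"
  have "ideal_set ?J"
    unfolding ideal_set_def
  proof (intro conjI ballI allI)
    show "0 \<in> ?J" by simp
    show "a + b \<in> ?J" if "a \<in> ?J" "b \<in> ?J" for a b
      using that Poly_Mapping.keys_add[of a b] by blast
    show "r * a \<in> ?J" if a: "a \<in> ?J" for r a
    proof (intro CollectI ballI)
      fix u assume "u \<in> Poly_Mapping.keys (r * a)"
      then obtain x y where u: "u = x + y" "y \<in> Poly_Mapping.keys a"
        using keys_mult[of r a] by blast
      then obtain g k where "g \<in> G" "k \<in> Poly_Mapping.keys g" "\<forall>i. k $ i \<le> y $ i" using a by blast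
      then show "\<exists>g\<in>G. \<exists>k\<in>Poly_Mapping.keys g. \<forall>i. k $ i \<le> u $ i"
        by (auto simp: u(1) intro!: bexI[of _ g] bexI[of _ k] trans_le_add2)
    qed
  qed
  moreover have "G \<subseteq> ?J" by auto
  ultimately show ?thesis using genideal_dring_least[of ?J G] assms by blast
qed

definition monomial_exps :: "'n::finite dpoly set \<Rightarrow> (nat^'n) set" where
  "monomial_exps M = {b. dmonom b \<in> M}"

lemma monomial_exps_mono:
  assumes "ideal_set M" "b \<in> monomial_exps M" "\<And>i. b $ i \<le> b' $ i"
  shows "b' \<in> monomial_exps M"
proof -
  have "b' = (b' - b) + b" using assms(3) by (simp add: vec_eq_iff)
  then have "dmonom b' = dmonom (b' - b) * dmonom b" by (simp add: mult_single)
  then show ?thesis using assms(1,2) by (simp add: monomial_exps_def ideal_setD)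
qed

text \<open>The weight is negative, so the leading terms are those of least degree in the variable
  \<open>i\<close>.\<close>

lemma init_form_binomial:
  fixes a b :: "nat^'n::finite"
  assumes "a $ i = 0" "b $ i \<noteq> 0"
  shows "init_form (- axis i 1) (dmonom a - dmonom b) = dmonom a"
proof -
  have ab: "a \<noteq> b" using assms by auto
  have w: "weight (- axis i 1) u = - real (u $ i)" for u :: "nat^'n"
    by (simp add: weight_def axis_def if_distrib[of "\<lambda>x. x * _"] if_distrib[of uminus] cong: if_cong)
  have k: "Poly_Mapping.keys (dmonom a - dmonom b) = {a, b}"
    using ab by (auto simp: in_keys_iff lookup_minus lookup_single when_def split: if_splits)
  have "{u. u \<in> Poly_Mapping.keys (dmonom a - dmonom b) \<and>
     (\<forall>v\<in>Poly_Mapping.keys (dmonom a - dmonom b). weight (- axis i 1) v \<le> weight (- axis i 1) u)} = {a}"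
    using assms unfolding k by (auto simp: w)
  then show ?thesis
    unfolding init_form_def using ab by (simp add: lookup_minus lookup_single)
qed

definition pos_part :: "int^'n \<Rightarrow> nat^'n" where "pos_part k = (\<chi> i. nat (k $ i))"

lemma pos_part_nth: "pos_part k $ i = nat (k $ i)"
  by (simp add: pos_part_def)

text \<open>A relation \<open>k\<close> between columns becomes the binomial with exponents
  \<open>k_+\<close> and \<open>k_-\<close>; in this form linear dependence reaches the toric
  ideal.\<close>

lemma kernel_pos_part:
  fixes A :: "int^'n::finite^'d"
  assumes "A *v k = 0" "k \<noteq> 0"
  shows "A *v nat_ivec (pos_part k) = A *v nat_ivec (pos_part (- k))" "pos_part k \<noteq> pos_part (- k)"
proof -
  have "nat_ivec (pos_part k) = k + nat_ivec (pos_part (- k))"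
    by (simp add: vec_eq_iff nat_ivec_def pos_part_def)
  then have "A *v nat_ivec (pos_part k) = A *v k + A *v nat_ivec (pos_part (- k))"
    by (simp add: matrix_vector_right_distrib)
  then show "A *v nat_ivec (pos_part k) = A *v nat_ivec (pos_part (- k))" using assms by simp
  obtain i where "k $ i \<noteq> 0" using assms(2) by (auto simp: vec_eq_iff)
  then have "pos_part k $ i \<noteq> pos_part (- k) $ i" by (simp add: pos_part_nth)
  then show "pos_part k \<noteq> pos_part (- k)" by auto
qed

text \<open>By hypothesis the falling factorial of each monomial of \<open>M\<close> vanishes at
  \<open>v\<close> through a coordinate outside \<open>C0\<close>. A maximal \<open>C\<close> that
  keeps this property, and leaves only natural coordinates outside, gives the standard pair.\<close>

lemma standard_pair_extend:
  fixes v :: "complex^'n::finite"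
  assumes M: "ideal_set M"
    and falls: "\<And>b. b \<in> monomial_exps M \<Longrightarrow> \<exists>i n. i \<notin> C0 \<and> v $ i = of_nat n \<and> n < b $ i"
  obtains \<mu> C where "C0 \<subseteq> C" "standard_pair M \<mu> C" "\<And>i. i \<notin> C \<Longrightarrow> v $ i = of_nat (\<mu> $ i)"
proof -
  let ?P = "\<lambda>C. C0 \<subseteq> C \<and> (\<forall>i. i \<notin> C \<longrightarrow> v $ i \<in> \<nat>) \<and>
    (\<forall>b\<in>monomial_exps M. \<exists>i n. i \<notin> C \<and> v $ i = of_nat n \<and> n < b $ i)"
  \<comment> \<open>A coordinate that is not a natural number never makes a falling factorial
    vanish, so it can join \<open>C0\<close> from the start.\<close>
  have "?P (C0 \<union> {i. v $ i \<notin> \<nat>})"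
  proof (intro conjI ballI)
    fix b assume "b \<in> monomial_exps M"
    then obtain i n where "i \<notin> C0" "v $ i = of_nat n" "n < b $ i" using falls by blast
    then show "\<exists>i n. i \<notin> C0 \<union> {i. v $ i \<notin> \<nat>} \<and> v $ i = of_nat n \<and> n < b $ i"
      by (intro exI[of _ i] exI[of _ n]) auto
  qed auto
  then have "{C. ?P C} \<noteq> {}" by blast
  then obtain C where C: "C \<in> {C. ?P C}" "\<And>C'. C' \<in> {C. ?P C} \<Longrightarrow> C \<subseteq> C' \<Longrightarrow> C = C'"
    using finite_has_maximal[of "{C. ?P C}"] by auto
  then have "\<forall>i. \<exists>n. i \<notin> C \<longrightarrow> v $ i = of_nat n" by (auto simp: Nats_def)
  then obtain f where f: "\<And>i. i \<notin> C \<Longrightarrow> v $ i = of_nat (f i)" by metis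
  define \<mu> :: "nat^'n" where "\<mu> = (\<chi> i. if i \<in> C then 0 else f i)"
  have \<mu>: "v $ i = of_nat (\<mu> $ i)" if "i \<notin> C" for i using f that by (simp add: \<mu>_def)
  have "standard_pair M \<mu> C"
    unfolding standard_pair_def
  proof (intro conjI allI impI ballI)
    show "\<mu> $ i = 0" if "i \<in> C" for i using that by (simp add: \<mu>_def)
    show "dmonom (\<mu> + \<nu>) \<notin> M" if \<nu>: "\<forall>i. i \<notin> C \<longrightarrow> \<nu> $ i = 0" for \<nu>
    proof
      assume "dmonom (\<mu> + \<nu>) \<in> M"
      then obtain i n where "i \<notin> C" "v $ i = of_nat n" "n < (\<mu> + \<nu>) $ i"
        using C(1) unfolding monomial_exps_def by blast
      then show False using \<nu> \<mu>[of i] by auto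
    qed
    fix l assume l: "l \<notin> C"
    \<comment> \<open>Maximality supplies a \<open>b\<close> that vanishes outside \<open>C\<close>
      only through \<open>l\<close>. Outside \<open>insert l C\<close> it is therefore bounded by
      \<mu>, which gives the last clause of a standard pair.\<close>
    have "\<not> ?P (insert l C)" using C(2)[of "insert l C"] l by blast
    moreover have "C0 \<subseteq> insert l C" "\<forall>i. i \<notin> insert l C \<longrightarrow> v $ i \<in> \<nat>" using C(1) by auto
    ultimately obtain b where b: "b \<in> monomial_exps M"
      "\<And>i n. i \<notin> insert l C \<Longrightarrow> v $ i = of_nat n \<Longrightarrow> \<not> n < b $ i" by blast
    define \<nu> :: "nat^'n" where "\<nu> = (\<chi> i. if i \<in> insert l C then b $ i else 0)"
    have "b $ i \<le> (\<mu> + \<nu>) $ i" for i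
      using b(2)[OF _ \<mu>, of i] by (cases "i \<in> insert l C") (auto simp: \<nu>_def)
    then have "dmonom (\<mu> + \<nu>) \<in> M"
      using monomial_exps_mono[OF M b(1)] by (simp add: monomial_exps_def)
    then show "\<exists>\<nu>. (\<forall>i. i \<notin> insert l C \<longrightarrow> \<nu> $ i = 0) \<and> dmonom (\<mu> + \<nu>) \<in> M"
      by (intro exI[of _ \<nu>]) (auto simp: \<nu>_def)
  qed
  then show thesis using that C(1) \<mu> by blast
qed

text \<open>Otherwise \<open>b\<close> would be bounded by \<mu> outside \<open>C\<close>, and
  adding the part of \<open>b\<close> inside \<open>C\<close> to \<mu> would give a forbidden
  monomial of \<open>M\<close>.\<close>

lemma standard_pair_falls:
  fixes v :: "complex^'n::finite"
  assumes M: "ideal_set M" and sp: "standard_pair M \<mu> C"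
    and v: "\<And>i. i \<notin> C \<Longrightarrow> v $ i = of_nat (\<mu> $ i)" and b: "b \<in> monomial_exps M"
  shows "\<exists>i n. v $ i = of_nat n \<and> n < b $ i"
proof (rule ccontr)
  assume *: "\<not> ?thesis"
  define \<nu> :: "nat^'n" where "\<nu> = (\<chi> i. if i \<in> C then b $ i else 0)"
  have "b $ i \<le> (\<mu> + \<nu>) $ i" for i
    using * v[of i] by (cases "i \<in> C") (auto simp: \<nu>_def not_less)
  then have "dmonom (\<mu> + \<nu>) \<in> M"
    using monomial_exps_mono[OF M b] by (simp add: monomial_exps_def)
  moreover have "\<forall>i. i \<notin> C \<longrightarrow> \<nu> $ i = 0" by (simp add: \<nu>_def)
  ultimately show False using sp unfolding standard_pair_def by blast
qed

lemma standard_pair_face: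
  assumes M: "ideal_set M" and sp: "standard_pair M \<mu> C" and b: "b \<in> monomial_exps M"
  shows "\<exists>i. i \<notin> C \<and> b $ i \<noteq> 0"
proof (rule ccontr)
  assume "\<not> ?thesis"
  then have "dmonom (\<mu> + b) \<notin> M" using sp unfolding standard_pair_def by blast
  then show False using monomial_exps_mono[OF M b, of "\<mu> + b"] by (auto simp: monomial_exps_def)
qed

section \<open>Dickson's lemma and the finiteness of the set of standard pairs\<close>

lemma nat_seq_incseq_subseq:
  fixes g :: "nat \<Rightarrow> nat"
  shows "\<exists>r. strict_mono r \<and> incseq (g \<circ> r)"
proof -
  obtain r :: "nat \<Rightarrow> nat" where r: "strict_mono r" "monoseq (g \<circ> r)"
    using seq_monosub[of g] by (auto simp: o_def)
  show ?thesis
  proof (cases "incseq (g \<circ> r)")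
    case False
    then have d: "decseq (g \<circ> r)" using r(2) by (auto simp: monoseq_iff)
    \<comment> \<open>From a place of its minimum on, a decreasing sequence of naturals is constant
      and hence increasing.\<close>
    obtain n0 where n0: "\<And>n. (g \<circ> r) n0 \<le> (g \<circ> r) n"
      using ex_has_least_nat[of "\<lambda>_. True" 0 "g \<circ> r"] by auto
    have "(g \<circ> r) (n0 + n) = (g \<circ> r) n0" for n
      using n0[of "n0 + n"] d[THEN decseqD, of n0 "n0 + n"] by simp
    then have "incseq (g \<circ> (\<lambda>n. r (n0 + n)))" by (simp add: incseq_def)
    moreover have "strict_mono (\<lambda>n. r (n0 + n))" using r(1) by (simp add: strict_mono_def)
    ultimately show ?thesis by blast
  qed (use r in blast)
qed

lemma vec_seq_incseq_subseq:
  fixes f :: "nat \<Rightarrow> nat^'n::finite"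
  shows "\<exists>r. strict_mono r \<and> (\<forall>i. incseq (\<lambda>k. f (r k) $ i))"
proof -
  have "\<exists>r. strict_mono r \<and> (\<forall>i\<in>I. incseq (\<lambda>k. f (r k) $ i))" if "finite I" for I
    using that
  proof induction
    case empty show ?case by (intro exI[of _ id]) (auto simp: strict_mono_def)
  next
    case (insert i I)
    then obtain r where r: "strict_mono r" "\<forall>i\<in>I. incseq (\<lambda>k. f (r k) $ i)" by auto
    obtain q where q: "strict_mono q" "incseq ((\<lambda>k. f (r k) $ i) \<circ> q)"
      using nat_seq_incseq_subseq by blast
    have "incseq (\<lambda>k. f (r (q k)) $ j)" if "j \<in> I" for j
      using r(2) that q(1) by (auto simp: incseq_def strict_mono_less_eq)
    moreover have "strict_mono (r \<circ> q)" using r(1) q(1) by (rule strict_mono_o)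
    ultimately show ?case using q(2) by (intro exI[of _ "r \<circ> q"]) (auto simp: o_def)
  qed
  from this[of UNIV] show ?thesis by simp
qed

text \<open>An infinite family contains a coordinatewise increasing sequence, unbounded in some
  coordinate \<open>l\<close> outside \<open>C\<close>. The monomial of \<open>M\<close> reached
  from the first exponent by raising \<open>l\<close> then divides a monomial that belongs to a
  later pair.\<close>

lemma finite_standard_pairs_at:
  fixes M :: "'n::finite dpoly set"
  assumes M: "ideal_set M"
  shows "finite {\<mu>. standard_pair M \<mu> C}"
proof (rule ccontr)
  assume "infinite {\<mu>. standard_pair M \<mu> C}"
  then obtain f0 :: "nat \<Rightarrow> nat^'n" where f0: "inj f0" "range f0 \<subseteq> {\<mu>. standard_pair M \<mu> C}"
    using infinite_countable_subset by blast
  obtain r where r: "strict_mono r" "\<And>i. incseq (\<lambda>k. f0 (r k) $ i)"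
    using vec_seq_incseq_subseq[of f0] by auto
  define f where "f = f0 \<circ> r"
  have inj: "inj f" unfolding f_def
    by (rule inj_compose[OF f0(1) strict_mono_imp_inj_on[OF r(1)]])
  have sp: "standard_pair M (f k) C" for k using f0(2) by (auto simp: f_def)
  have mono: "f 0 $ i \<le> f k $ i" for i k using r(2)[of i] by (auto simp: f_def incseq_def)
  have "\<exists>l. \<forall>B. \<exists>k. B \<le> f k $ l"
  proof (rule ccontr)
    assume "\<not> ?thesis"
    then obtain B where B: "\<And>l k. f k $ l < B l" by (metis not_le)
    have "range f \<subseteq> vec_lambda ` (PiE UNIV (\<lambda>l. {..<B l}))"
    proof
      fix x assume "x \<in> range f"
      then have "vec_nth x \<in> PiE UNIV (\<lambda>l. {..<B l})" using B by auto
      moreover have "x = vec_lambda (vec_nth x)" by simp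
      ultimately show "x \<in> vec_lambda ` (PiE UNIV (\<lambda>l. {..<B l}))" by blast
    qed
    then have "finite (range f)" by (rule finite_subset) (auto intro!: finite_imageI finite_PiE)
    then show False using inj finite_imageD by blast
  qed
  then obtain l where l: "\<And>B. \<exists>k. B \<le> f k $ l" by blast
  have lC: "l \<notin> C"
  proof
    assume "l \<in> C"
    then have "f k $ l = 0" for k using sp[of k] by (simp add: standard_pair_def)
    then show False using l[of 1] by simp
  qed
  then obtain \<nu> where \<nu>: "\<And>i. i \<notin> insert l C \<Longrightarrow> \<nu> $ i = 0" "dmonom (f 0 + \<nu>) \<in> M"
    using sp[of 0] unfolding standard_pair_def by blast
  obtain k where k: "f 0 $ l + \<nu> $ l \<le> f k $ l" using l by blast
  define \<nu>' :: "nat^'n" where "\<nu>' = (\<chi> i. if i \<in> C then \<nu> $ i else 0)"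
  have "(f 0 + \<nu>) $ i \<le> (f k + \<nu>') $ i" for i
  proof (cases "i \<in> C")
    case True then show ?thesis using mono[of i k] by (simp add: \<nu>'_def)
  next
    case False
    then show ?thesis using mono[of i k] k \<nu>(1)[of i] by (cases "i = l") (auto simp: \<nu>'_def)
  qed
  then have "dmonom (f k + \<nu>') \<in> M"
    using monomial_exps_mono[OF M, of "f 0 + \<nu>" "f k + \<nu>'"] \<nu>(2) by (simp add: monomial_exps_def)
  moreover have "\<forall>i. i \<notin> C \<longrightarrow> \<nu>' $ i = 0" by (simp add: \<nu>'_def)
  ultimately show False using sp[of k] unfolding standard_pair_def by blast
qed

lemma finite_standard_pairs:
  fixes M :: "'n::finite dpoly set"
  assumes M: "ideal_set M"
  shows "finite {(\<mu>, C). standard_pair M \<mu> C}"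
proof -
  have "{(\<mu>, C). standard_pair M \<mu> C} = (\<Union>C. (\<lambda>\<mu>. (\<mu>, C)) ` {\<mu>. standard_pair M \<mu> C})" by auto
  then show ?thesis using finite_standard_pairs_at[OF M] by simp
qed

section \<open>Relations between the columns\<close>

text \<open>The value at column \<open>j\<close> of the functional with coefficients
  \<open>h\<close>; also the coefficient of \<open>\<theta>\<^sub>j\<close> when the Euler operators
  are combined with coefficients \<open>h\<close>.\<close>

definition col_pair :: "int^'n^'d::finite \<Rightarrow> complex^'d \<Rightarrow> 'n \<Rightarrow> complex" where
  "col_pair A h j = (\<Sum>r\<in>UNIV. h $ r * of_int (A $ r $ j))"

lemma common_denominator:
  assumes "finite C"
  shows "\<exists>D::int. D > 0 \<and> (\<forall>i\<in>C. of_int D * (u i :: rat) \<in> \<int>)"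
  using assms
proof induction
  case empty show ?case by (intro exI[of _ 1]) auto
next
  case (insert j C)
  then obtain D :: int where D: "D > 0" "\<And>i. i \<in> C \<Longrightarrow> of_int D * u i \<in> \<int>" by auto
  obtain a b where ab: "u j = Fract a b" "b > 0" by (cases "u j") auto
  have "of_int (D * b) * u i \<in> \<int>" if "i \<in> insert j C" for i
  proof (cases "i = j")
    case True
    have "of_int (D * b) * u i = of_int (D * a)" using ab True by (simp add: Fract_of_int_quotient)
    then show ?thesis by (metis Ints_of_int)
  next
    case False
    have "of_int (D * b) * u i = of_int b * (of_int D * u i)" by simp
    then show ?thesis using D(2)[of i] that False by (metis Ints_mult Ints_of_int insertE)
  qed
  then show ?case using D(1) ab(2) by (intro exI[of _ "D * b"]) auto
qed

text \<open>Column \<open>j\<close> lies in the span of those in \<open>C\<close> or is separated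
  from it by a functional. This is decided over the rationals, so that clearing denominators yields
  an integral relation; its coefficient at \<open>j\<close> is the common denominator.\<close>

lemma functional_or_relation:
  fixes A :: "int^'n::finite^'d::finite"
  assumes j: "j \<notin> C"
  obtains (functional) h where "\<And>i. i \<in> C \<Longrightarrow> col_pair A h i = 0" "col_pair A h j \<noteq> 0"
  | (relation) k where "A *v k = 0" "k $ j > 0" "\<And>i. i \<notin> insert j C \<Longrightarrow> k $ i = 0"
proof -
  define a :: "'n \<Rightarrow> rat^'d" where "a i = (\<chi> r. of_int (A $ r $ i))" for i
  show thesis
  proof (cases "a j \<in> vec.span (a ` C)")
    case True
    \<comment> \<open>Combinations are indexed by \<open>C\<close> and not by the set of columns,
      because different indices may carry the same column.\<close>
    have sub: "vec.subspace {x. \<exists>u. x = (\<Sum>i\<in>C. u i *s a i)}"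
      unfolding vec.subspace_def
    proof (intro conjI ballI allI)
      show "0 \<in> {x. \<exists>u. x = (\<Sum>i\<in>C. u i *s a i)}" by (auto intro: exI[of _ "\<lambda>_. 0"])
      show "x + y \<in> {x. \<exists>u. x = (\<Sum>i\<in>C. u i *s a i)}"
        if xy: "x \<in> {x. \<exists>u. x = (\<Sum>i\<in>C. u i *s a i)}" "y \<in> {x. \<exists>u. x = (\<Sum>i\<in>C. u i *s a i)}" for x y
      proof -
        obtain u v where "x = (\<Sum>i\<in>C. u i *s a i)" "y = (\<Sum>i\<in>C. v i *s a i)" using xy by blast
        then have "x + y = (\<Sum>i\<in>C. (u i + v i) *s a i)" by (simp add: sum.distrib vec.scale_left_distrib)
        then show ?thesis by (intro CollectI exI[of _ "\<lambda>i. u i + v i"])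
      qed
      show "c *s x \<in> {x. \<exists>u. x = (\<Sum>i\<in>C. u i *s a i)}" if x: "x \<in> {x. \<exists>u. x = (\<Sum>i\<in>C. u i *s a i)}" for c x
      proof -
        obtain u where "x = (\<Sum>i\<in>C. u i *s a i)" using x by blast
        then have "c *s x = (\<Sum>i\<in>C. (c * u i) *s a i)" by (simp add: vec.scale_sum_right)
        then show ?thesis by (intro CollectI exI[of _ "\<lambda>i. c * u i"])
      qed
    qed
    have "a ` C \<subseteq> {x. \<exists>u. x = (\<Sum>i\<in>C. u i *s a i)}"
    proof
      fix x assume "x \<in> a ` C"
      then obtain i0 where i0: "i0 \<in> C" "x = a i0" by auto
      have "x = (\<Sum>i\<in>C. (if i = i0 then 1 else 0) *s a i)"
        using i0 by (subst sum.remove[of C i0]) (auto intro!: sum.neutral simp: vec_eq_iff)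
      then show "x \<in> {x. \<exists>u. x = (\<Sum>i\<in>C. u i *s a i)}"
        by (intro CollectI exI[of _ "\<lambda>i. if i = i0 then 1 else 0"])
    qed
    from vec.span_minimal[OF this sub] True obtain u where u: "a j = (\<Sum>i\<in>C. u i *s a i)" by auto
    obtain D :: int where D: "D > 0" "\<And>i. i \<in> C \<Longrightarrow> of_int D * u i \<in> \<int>"
      using common_denominator[of C u] by auto
    then have "\<forall>i. \<exists>z. i \<in> C \<longrightarrow> of_int D * u i = of_int z" by (auto elim: Ints_cases)
    then obtain f where f: "\<And>i. i \<in> C \<Longrightarrow> of_int D * u i = of_int (f i)" by metis
    define k :: "int^'n" where "k = (\<chi> i. if i = j then D else if i \<in> C then - f i else 0)"
    have "(A *v k) $ r = 0" for r
    proof -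
      have "(A *v k) $ r = (\<Sum>i\<in>insert j C. A $ r $ i * k $ i)"
        unfolding matrix_vector_mult_def by (auto simp: k_def intro!: sum.mono_neutral_right split: if_splits)
      also have "\<dots> = A $ r $ j * D - (\<Sum>i\<in>C. A $ r $ i * f i)"
        using j by (auto simp: k_def sum_negf[symmetric] intro!: sum.cong)
      finally have "of_int ((A *v k) $ r) = of_int D * a j $ r - (\<Sum>i\<in>C. a i $ r * of_int (f i))"
        by (simp add: a_def mult.commute)
      also have "(\<Sum>i\<in>C. a i $ r * of_int (f i)) = of_int D * (\<Sum>i\<in>C. u i *s a i) $ r"
        by (auto simp: sum_distrib_left f[symmetric] algebra_simps intro!: sum.cong)
      finally show ?thesis using u by simp
    qed
    then have "A *v k = 0" by (simp add: vec_eq_iff)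
    then show thesis using D(1) by (intro relation[of k]) (auto simp: k_def)
  next
    case False
    obtain B where B: "B \<subseteq> a ` C" "vec.independent B" "a ` C \<subseteq> vec.span B"
      using vec.maximal_independent_subset[of "a ` C"] by blast
    have aj: "a j \<notin> vec.span B" using False vec.span_mono[OF B(1)] by auto
    then have "vec.independent (insert (a j) B)" using B(2) by (rule vec.independent_insertI)
    then obtain g :: "rat^'d \<Rightarrow> rat^'d" where g: "Vector_Spaces.linear (*s) (*s) g"
      "\<And>x. x \<in> insert (a j) B \<Longrightarrow> g x = (if x = a j then 1 else 0)"
      using vec.linear_independent_extend[of "insert (a j) B" "\<lambda>x. if x = a j then 1 else 0"] by blast
    have gC: "g (a i) = 0" if "i \<in> C" for i
    proof -
      have "g x = 0" if "x \<in> vec.span B" for x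
      proof (rule vec.linear_eq_0_on_span[OF g(1) _ that])
        fix y assume "y \<in> B"
        moreover from this have "y \<noteq> a j" using aj vec.span_base by blast
        ultimately show "g y = 0" using g(2) by simp
      qed
      then show ?thesis using that B(3) by blast
    qed
    \<comment> \<open>\<open>g\<close> has vectors as values, the one at \<open>a j\<close> being
      the vector of ones; any coordinate \<open>r0\<close> turns it into a functional.\<close>
    obtain r0 :: 'd where True by simp
    define h :: "complex^'d" where "h = (\<chi> r. of_rat (g (axis r 1) $ r0))"
    have pair: "col_pair A h i = of_rat (g (a i) $ r0)" for i
    proof -
      have ai: "a i = (\<Sum>r\<in>UNIV. a i $ r *s axis r 1)" by (rule basis_expansion[symmetric])
      have "g (a i) = (\<Sum>r\<in>UNIV. a i $ r *s g (axis r 1))"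
        by (subst ai) (simp only: vec.linear_sum[OF g(1)] vec.linear_scale[OF g(1)])
      then show ?thesis
        by (simp add: col_pair_def h_def a_def of_rat_sum of_rat_mult mult.commute)
    qed
    show thesis
      using gC g(2)[of "a j"] by (intro functional[of h]) (auto simp: pair)
  qed
qed

text \<open>The functionals isolate the coefficients of a linear relation and also separate the
  columns, so \<open>D\<close> indexes distinct independent vectors.\<close>

lemma dual_columns_card_le:
  fixes A :: "int^'n::finite^'d::finite"
  assumes "\<And>j. j \<in> D \<Longrightarrow> \<exists>h. (\<forall>i\<in>D - {j}. col_pair A h i = 0) \<and> col_pair A h j \<noteq> 0"
  shows "card D \<le> CARD('d)"
proof -
  define a :: "'n \<Rightarrow> complex^'d" where "a i = (\<chi> r. of_int (A $ r $ i))" for i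
  have pair: "col_pair A h i = (\<Sum>r\<in>UNIV. h $ r * a i $ r)" for h i
    by (simp add: col_pair_def a_def)
  have inj: "inj_on a D"
  proof (rule inj_onI, rule ccontr)
    fix i j assume *: "i \<in> D" "j \<in> D" "a i = a j" "i \<noteq> j"
    obtain h where "\<forall>i\<in>D - {j}. col_pair A h i = 0" "col_pair A h j \<noteq> 0" using assms[OF *(2)] by auto
    moreover have "col_pair A h i = col_pair A h j" using *(3) by (simp add: pair)
    ultimately show False using *(1,4) by auto
  qed
  have "vec.independent (a ` D)"
  proof (rule vec.independent_if_scalars_zero)
    fix f x assume f: "(\<Sum>x\<in>a ` D. f x *s x) = 0" and "x \<in> a ` D"
    then obtain j where j: "j \<in> D" "x = a j" by auto
    obtain h where h: "\<And>i. i \<in> D \<Longrightarrow> i \<noteq> j \<Longrightarrow> col_pair A h i = 0" "col_pair A h j \<noteq> 0"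
      using assms[OF j(1)] by auto
    have "(\<Sum>i\<in>D. f (a i) *s a i) = 0" using f by (simp add: sum.reindex[OF inj])
    then have "0 = (\<Sum>r\<in>UNIV. h $ r * (\<Sum>i\<in>D. f (a i) *s a i) $ r)" by simp
    also have "\<dots> = (\<Sum>r\<in>UNIV. \<Sum>i\<in>D. f (a i) * (h $ r * a i $ r))"
      by (simp add: sum_distrib_left mult_ac)
    also have "\<dots> = (\<Sum>i\<in>D. f (a i) * col_pair A h i)"
      by (subst sum.swap) (simp add: pair sum_distrib_left)
    also have "\<dots> = f (a j) * col_pair A h j"
      using j h(1) by (subst sum.remove[of D j]) (auto intro!: sum.neutral)
    finally show "f x = 0" using h(2) j(2) by auto
  qed auto
  then have "card (a ` D) \<le> vec.dim (UNIV :: (complex^'d) set)"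
    by (intro vec.independent_card_le_dim) auto
  then show ?thesis by (simp only: card_image[OF inj] vec_dim_card)
qed

section \<open>Faces and independent columns of a generic toric ideal\<close>

locale generic_toric =
  fixes A :: "int^'n::finite^'d::finite" and p1 :: 'n
  assumes generic: "generic_toric_ideal A"
begin

definition M :: "'n dpoly set" where "M = init_ideal (- axis p1 1) (toric_ideal A)"

abbreviation N :: "(nat^'n) set" where "N \<equiv> monomial_exps M"

text \<open>Faces of the simplicial complex attached to the monomials of \<open>M\<close>: no such
  monomial lives on \<open>C\<close> alone.\<close>

definition face :: "'n set \<Rightarrow> bool" where "face C \<longleftrightarrow> (\<forall>b\<in>N. \<exists>i. i \<notin> C \<and> b $ i \<noteq> 0)"

lemma ideal_M: "ideal_set M"
  unfolding M_def init_ideal_def by (rule ideal_set_genideal)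

lemma face_mono: "face C \<Longrightarrow> C' \<subseteq> C \<Longrightarrow> face C'"
  unfolding face_def by blast

text \<open>
  Each term of \<open>\<partial>\<^sup>u - \<partial>\<^sup>v\<close> is divisible by a term of a generator; the one dividing \<open>\<partial>\<^sup>u\<close> does not
  involve \<open>\<partial>\<^sub>1\<close>, so the other term of that generator does, which makes it an initial form.
\<close>

lemma nontrivial_fiber:
  assumes u: "u $ p1 = 0" and "u \<noteq> v" "A *v nat_ivec u = A *v nat_ivec v"
  shows "u \<in> N"
proof -
  obtain G where G: "G \<subseteq> toric_binomials A" "genideal dring G = toric_ideal A" "\<And>g. g \<in> G \<Longrightarrow> dvars g = UNIV"
    using generic unfolding generic_toric_ideal_def by auto
  have "dmonom u - dmonom v \<in> toric_binomials A" using assms(3) by (auto simp: toric_binomials_def)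
  then have f: "dmonom u - dmonom v \<in> genideal dring G"
    unfolding G(2) toric_ideal_def using genideal_dring_superset by blast
  moreover have "u \<in> Poly_Mapping.keys (dmonom u - dmonom v)"
    using \<open>u \<noteq> v\<close> by (simp add: in_keys_iff lookup_minus lookup_single)
  ultimately obtain g k where g: "g \<in> G" "k \<in> Poly_Mapping.keys g" "\<And>i. k $ i \<le> u $ i"
    using keys_genideal by blast
  obtain a b where ab: "g = dmonom a - dmonom b" using g(1) G(1) by (auto simp: toric_binomials_def)
  have gM: "init_form (- axis p1 1) g \<in> M" "init_form (- axis p1 1) (- g) \<in> M"
  proof -
    have "g \<in> toric_ideal A" using G(2) g(1) genideal_dring_superset by blast
    moreover from this have "- g \<in> toric_ideal A"
      unfolding toric_ideal_def by (intro ideal_setD ideal_set_genideal)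
    ultimately show "init_form (- axis p1 1) g \<in> M" "init_form (- axis p1 1) (- g) \<in> M"
      unfolding M_def init_ideal_def using genideal_dring_superset by blast+
  qed
  have "p1 \<in> dvars g" using G(3)[OF g(1)] by simp
  then obtain k' where k': "k' \<in> Poly_Mapping.keys g" "k' $ p1 \<noteq> 0" by (auto simp: dvars_def)
  have k0: "k $ p1 = 0" using g(3)[of p1] u by simp
  have "Poly_Mapping.keys g \<subseteq> {a, b}"
    unfolding ab by (auto simp: in_keys_iff lookup_minus lookup_single when_def split: if_splits)
  then have "k \<in> {a, b}" "k' \<in> {a, b}" using g(2) k'(1) by auto
  moreover have "k \<noteq> k'" using k0 k'(2) by auto
  ultimately consider "k = a" "k' = b" | "k = b" "k' = a" by auto
  then have "k \<in> N"
  proof cases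
    case 1
    then show ?thesis using gM(1) init_form_binomial[of a p1 b] k0 k'(2) by (simp add: ab monomial_exps_def)
  next
    case 2
    then show ?thesis using gM(2) init_form_binomial[of b p1 a] k0 k'(2) by (simp add: ab monomial_exps_def)
  qed
  then show ?thesis using monomial_exps_mono[OF ideal_M] g(3) by blast
qed

text \<open>A standard pair passes through \<open>v\<close> exactly when the falling factorials of
  all \<open>b\<close> in \<open>N\<close> vanish at \<open>v\<close>. Fake exponents thus become
  zeros of explicit polynomials.\<close>

lemma fake_exponents_iff:
  "v \<in> fake_exponents A \<gamma> (- axis p1 1) \<longleftrightarrow>
     map_matrix of_int A *v v = \<gamma> \<and> (\<forall>b\<in>N. \<exists>i n. v $ i = of_nat n \<and> n < b $ i)"
proof
  assume "v \<in> fake_exponents A \<gamma> (- axis p1 1)"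
  then obtain \<mu> C where "map_matrix of_int A *v v = \<gamma>" "standard_pair M \<mu> C" "\<And>i. i \<notin> C \<Longrightarrow> v $ i = of_nat (\<mu> $ i)"
    unfolding fake_exponents_def M_def by blast
  then show "map_matrix of_int A *v v = \<gamma> \<and> (\<forall>b\<in>N. \<exists>i n. v $ i = of_nat n \<and> n < b $ i)"
    using standard_pair_falls[OF ideal_M] by blast
next
  assume *: "map_matrix of_int A *v v = \<gamma> \<and> (\<forall>b\<in>N. \<exists>i n. v $ i = of_nat n \<and> n < b $ i)"
  then obtain \<mu> C where "standard_pair M \<mu> C" "\<And>i. i \<notin> C \<Longrightarrow> v $ i = of_nat (\<mu> $ i)"
    using standard_pair_extend[OF ideal_M, of "{}" v] by auto
  then show "v \<in> fake_exponents A \<gamma> (- axis p1 1)"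
    using * unfolding fake_exponents_def M_def by blast
qed

text \<open>Subtracting a nonzero kernel vector \<open>k\<close> always creates a new negative
  coordinate. If \<open>k\<close> is positive at \<open>p1\<close>, this happens at
  \<open>p1\<close>, where \<open>v\<close> is 0. Otherwise \<open>k_+\<close> lies in
  \<open>N\<close> by \<open>nontrivial_fiber\<close>, and it happens where the falling factorial of
  \<open>k_+\<close> vanishes at \<open>v\<close>.\<close>

lemma fake_minimal_nsupp:
  assumes v: "v $ p1 = 0" "\<forall>b\<in>N. \<exists>i n. v $ i = of_nat n \<and> n < b $ i"
  shows "minimal_nsupp A v"
  unfolding minimal_nsupp_def
proof (intro allI impI)
  fix k assume k: "A *v k = 0" "nsupp (v - int_cvec k) \<subseteq> nsupp v"
  have "k = 0"
  proof (rule ccontr)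
    assume "k \<noteq> 0"
    show False
    proof (cases "k $ p1 > 0")
      case True
      then have "p1 \<in> nsupp (v - int_cvec k)"
        using v(1) by (auto simp: nsupp_def int_cvec_def intro!: exI[of _ "- k $ p1"])
      then have "p1 \<in> nsupp v" using k(2) by blast
      then show False using v(1) by (auto simp: nsupp_def)
    next
      case False
      then have "pos_part k $ p1 = 0" by (simp add: pos_part_nth)
      then have "pos_part k \<in> N"
        using kernel_pos_part[OF k(1) \<open>k \<noteq> 0\<close>] by (intro nontrivial_fiber)
      then obtain i n where i: "v $ i = of_nat n" "n < pos_part k $ i" using v(2) by blast
      then have "i \<in> nsupp (v - int_cvec k)"
        by (auto simp: nsupp_def int_cvec_def pos_part_nth intro!: exI[of _ "int n - k $ i"])
      then have "i \<in> nsupp v" using k(2) by blast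
      then obtain z :: int where "z < 0" "v $ i = of_int z" by (auto simp: nsupp_def)
      then have "of_int (int n) = (of_int z :: complex)" using i(1) by simp
      then show False using \<open>z < 0\<close> by (simp only: of_int_eq_iff)
    qed
  qed
  then show "nsupp (v - int_cvec k) = nsupp v" by (simp add: int_cvec_def zero_vec_def[symmetric])
qed

text \<open>In a relation on \<open>insert j C\<close> with positive coefficient at
  \<open>j\<close>, the negative part lives on \<open>C\<close> and avoids \<open>p1\<close>. By
  \<open>nontrivial_fiber\<close> it lies in \<open>N\<close>, which a face excludes. The case
  \<open>j = p1\<close> is included.\<close>

lemma face_functional:
  assumes "face C" "p1 \<notin> C" "j \<notin> C"
  obtains h where "\<And>i. i \<in> C \<Longrightarrow> col_pair A h i = 0" "col_pair A h j \<noteq> 0"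
  using assms(3)
proof (cases rule: functional_or_relation[of j C A])
  case (relation k)
  have "k \<noteq> 0" using relation(2) by auto
  have "k $ p1 \<ge> 0" using relation(2) relation(3)[of p1] assms(2) by (cases "p1 = j") auto
  then have "pos_part (- k) \<in> N"
    using kernel_pos_part[OF relation(1) \<open>k \<noteq> 0\<close>]
    by (intro nontrivial_fiber[of _ "pos_part k"]) (auto simp: pos_part_nth)
  then obtain i where "i \<notin> C" "pos_part (- k) $ i \<noteq> 0" using assms(1) unfolding face_def by blast
  then show ?thesis using relation(2) relation(3)[of i] by (cases "i = j") (auto simp: pos_part_nth)
qed (use that in blast)

text \<open>
  Modulo the span of the columns in \<open>T\<close> a relation between three further columns has at most one
  of them on one of its two sides, and that side lies in a face.
\<close>

lemma no_relation_near_face: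
  assumes T: "face T" "\<And>l. l \<in> L \<Longrightarrow> face (insert l T)" and p1: "p1 \<notin> T \<union> L" and L: "card L \<le> 3"
    and k: "A *v k = 0" "k \<noteq> 0" "\<And>i. i \<notin> T \<union> L \<Longrightarrow> k $ i = 0"
  shows False
proof -
  have main: "\<not> card {l\<in>L. k $ l > 0} \<le> 1" if k: "A *v k = 0" "k \<noteq> 0" "\<And>i. i \<notin> T \<union> L \<Longrightarrow> k $ i = 0" for k
  proof
    assume "card {l\<in>L. k $ l > 0} \<le> 1"
    then have "\<exists>C. face C \<and> T \<subseteq> C \<and> {l\<in>L. k $ l > 0} \<subseteq> C"
    proof (cases "{l\<in>L. k $ l > 0} = {}")
      case False
      then obtain l where l: "l \<in> L" "k $ l > 0" by auto
      have "x = l" if "x \<in> {l\<in>L. k $ l > 0}" for x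
        using \<open>card _ \<le> 1\<close> that l card_le_Suc0_iff_eq[of "{l\<in>L. k $ l > 0}"] by auto
      then show ?thesis using T(2)[OF l(1)] by (intro exI[of _ "insert l T"]) auto
    qed (use T(1) in auto)
    then obtain C where C: "face C" "T \<subseteq> C" "{l\<in>L. k $ l > 0} \<subseteq> C" by auto
    have "k $ p1 = 0" using k(3) p1 by blast
    then have "pos_part k \<in> N"
      using kernel_pos_part[OF k(1,2)] by (intro nontrivial_fiber) (auto simp: pos_part_nth)
    then obtain i where i: "i \<notin> C" "pos_part k $ i \<noteq> 0" using C(1) unfolding face_def by blast
    then have "k $ i > 0" by (simp add: pos_part_nth)
    then show False using i(1) C k(3)[of i] by force
  qed
  have "card {l\<in>L. k $ l > 0} + card {l\<in>L. (- k) $ l > 0} = card ({l\<in>L. k $ l > 0} \<union> {l\<in>L. (- k) $ l > 0})"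
    by (rule card_Un_disjoint[symmetric]) auto
  also have "\<dots> \<le> card L" by (rule card_mono) auto
  finally have "card {l\<in>L. k $ l > 0} \<le> 1 \<or> card {l\<in>L. (- k) $ l > 0} \<le> 1" using L by linarith
  moreover have "A *v (- k) = 0" using k(1) by (simp add: matrix_vector_mult_def vec_eq_iff sum_negf)
  ultimately show False using main[OF k] main[of "- k"] k by auto
qed

text \<open>By \<open>no_relation_near_face\<close>, \<open>T\<close> stays independent together
  with up to three elements of \<open>L\<close>. Three would give more than d columns, so
  \<open>L\<close> has at most two elements and the same argument covers all of
  \<open>T \<union> L\<close>.\<close>

lemma link_functional:
  assumes T: "face T" "\<And>l. l \<in> L \<Longrightarrow> face (insert l T)" and p1: "p1 \<notin> T \<union> L" and TL: "T \<inter> L = {}"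
    and card: "CARD('d) < card T + 3" and j: "j \<in> T \<union> L"
  obtains h where "\<And>i. i \<in> T \<union> L - {j} \<Longrightarrow> col_pair A h i = 0" "col_pair A h j \<noteq> 0"
proof -
  have main: "\<exists>h. (\<forall>i\<in>T \<union> L' - {j}. col_pair A h i = 0) \<and> col_pair A h j \<noteq> 0"
    if L': "L' \<subseteq> L" "card L' \<le> 3" and j: "j \<in> T \<union> L'" for L' j
  proof -
    have "j \<notin> T \<union> L' - {j}" by simp
    then show ?thesis
    proof (cases rule: functional_or_relation[of j "T \<union> L' - {j}" A])
      case (relation k)
      have "k \<noteq> 0" using relation(2) by auto
      moreover have "k $ i = 0" if "i \<notin> T \<union> L'" for i using relation(3)[of i] that j by auto
      ultimately show ?thesis
        using no_relation_near_face[OF T(1) T(2) _ L'(2) relation(1)] L'(1) p1 by blast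
    qed auto
  qed
  have "card L \<le> 2"
  proof (rule ccontr)
    assume "\<not> card L \<le> 2"
    then obtain L' where L': "L' \<subseteq> L" "card L' = 3" using obtain_subset_with_card_n[of 3 L] by auto
    have "card (T \<union> L') \<le> CARD('d)" using L' main by (intro dual_columns_card_le[of _ A]) auto
    moreover have "card (T \<union> L') = card T + 3" using L' TL by (subst card_Un_disjoint) auto
    ultimately show False using card by simp
  qed
  then show thesis using main[of L j] j that by auto
qed

end

section \<open>The indicial ideal of the kernel\<close>

context coordinate_ring begin

text \<open>The falling factorial, equal to \<open>x^b \<partial>^b\<close> when \<open>X j\<close>
  is \<open>x_j \<partial>_j\<close>. As one product over pairs \<open>(i, k)\<close> it lets a
  single linear factor be extracted.\<close>

definition ffact :: "nat^'n \<Rightarrow> 'r" where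
  "ffact b = (\<Prod>(i, k)\<in>Sigma UNIV (\<lambda>i. {..<b $ i}). X i - c (of_nat k))"

lemma prod_linear_factors_mod:
  assumes J: "ideal_set J" and X: "\<And>j. X j - c (v $ j) \<in> J" and "finite F"
  shows "(\<Prod>(i, k)\<in>F. X i - c (of_nat k)) - c (\<Prod>(i, k)\<in>F. v $ i - of_nat k) \<in> J"
  using \<open>finite F\<close>
proof induction
  case empty show ?case by (simp add: c_1 ideal_setD(1)[OF J])
next
  case (insert f F)
  obtain i k where f: "f = (i, k)" by (cases f)
  let ?P = "\<Prod>(i, k)\<in>F. X i - c (of_nat k)" and ?Q = "\<Prod>(i, k)\<in>F. v $ i - of_nat k"
  have "(X i - c (of_nat k)) * ?P - c ((v $ i - of_nat k) * ?Q)
    = (X i - c (v $ i)) * ?P + c (v $ i - of_nat k) * (?P - c ?Q)"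
    by (simp add: c_mult c_diff algebra_simps)
  also have "\<dots> \<in> J" using X[of i] insert.IH ideal_setD(2-4)[OF J] by blast
  finally show ?case using insert.hyps by (simp add: f)
qed

text \<open>The ideal of \<open>v\<close> lies in \<open>J : s\<close>, so modulo
  \<open>J : s\<close> the product equals its value at \<open>v\<close>, a nonzero number that can
  be inverted.\<close>

lemma cancel_linear_factors:
  assumes J: "ideal_set J" and s: "\<And>i. s * (X i - c (v $ i)) \<in> J" and "finite F"
    and ne: "\<And>i k. (i, k) \<in> F \<Longrightarrow> v $ i \<noteq> of_nat k"
    and "s * (\<Prod>(i, k)\<in>F. X i - c (of_nat k)) \<in> J"
  shows "s \<in> J"
proof -
  let ?P = "\<Prod>(i, k)\<in>F. X i - c (of_nat k)" and ?Q = "\<Prod>(i, k)\<in>F. v $ i - of_nat k"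
  have "?P - c ?Q \<in> ideal_colon J s"
    using s by (intro prod_linear_factors_mod ideal_set_colon[OF J] \<open>finite F\<close>)
      (auto simp: ideal_colon_def mult.commute)
  then have "s * ?P - (?P - c ?Q) * s \<in> J"
    using assms(5) by (intro ideal_setD(6)[OF J]) (auto simp: ideal_colon_def)
  then have "c ?Q * s \<in> J" by (simp add: algebra_simps)
  moreover have "?Q \<noteq> 0"
  proof
    assume "?Q = 0"
    then obtain x where "x \<in> F" "(case x of (i, k) \<Rightarrow> v $ i - of_nat k) = 0"
      using prod_zero_iff[OF \<open>finite F\<close>] by blast
    then show False using ne by (cases x) force
  qed
  ultimately show ?thesis by (rule cancel_c[OF J, rotated])
qed

end

locale toric_coordinate_ring = generic_toric A p1 + coordinate_ring X c
  for A :: "int^'n::finite^'d::finite" and p1 :: 'n and X :: "'n \<Rightarrow> 'r::comm_ring_1" and c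
begin

text \<open>The generators are those of the fake indicial ideal together with \<open>X p1\<close>,
  which reflects that \<partial>_1 kills the functions considered. As a property of \<open>J\<close>
  it applies to annihilators and persists in larger ideals.\<close>

definition restricted_indicial :: "complex^'d \<Rightarrow> 'r set \<Rightarrow> bool" where
  "restricted_indicial \<gamma> J \<longleftrightarrow> ideal_set J \<and> X p1 \<in> J \<and>
     (\<forall>r. (\<Sum>j\<in>UNIV. c (of_int (A $ r $ j)) * X j) - c (\<gamma> $ r) \<in> J) \<and> (\<forall>b\<in>N. ffact b \<in> J)"

definition exponents :: "complex^'d \<Rightarrow> (complex^'n) set" where
  "exponents \<gamma> = {v. map_matrix of_int A *v v = \<gamma> \<and> v $ p1 = 0 \<and>
     (\<forall>b\<in>N. \<exists>i n. v $ i = of_nat n \<and> n < b $ i)}"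

lemma restricted_indicial_mono:
  "restricted_indicial \<gamma> J \<Longrightarrow> ideal_set J' \<Longrightarrow> J \<subseteq> J' \<Longrightarrow> restricted_indicial \<gamma> J'"
  unfolding restricted_indicial_def by blast

lemma col_pair_indicial:
  assumes "restricted_indicial \<gamma> J"
  shows "(\<Sum>j\<in>UNIV. c (col_pair A h j) * X j) - c (\<Sum>r\<in>UNIV. h $ r * \<gamma> $ r) \<in> J"
proof -
  have J: "ideal_set J" and e: "\<And>r. (\<Sum>j\<in>UNIV. c (of_int (A $ r $ j)) * X j) - c (\<gamma> $ r) \<in> J"
    using assms by (auto simp: restricted_indicial_def)
  have "(\<Sum>r\<in>UNIV. c (h $ r) * ((\<Sum>j\<in>UNIV. c (of_int (A $ r $ j)) * X j) - c (\<gamma> $ r))) \<in> J"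
    by (intro ideal_set_sum[OF J] ideal_setD(3)[OF J] e)
  also have "(\<Sum>r\<in>UNIV. c (h $ r) * ((\<Sum>j\<in>UNIV. c (of_int (A $ r $ j)) * X j) - c (\<gamma> $ r)))
    = (\<Sum>r\<in>UNIV. \<Sum>j\<in>UNIV. c (h $ r * of_int (A $ r $ j)) * X j) - c (\<Sum>r\<in>UNIV. h $ r * \<gamma> $ r)"
    by (simp add: right_diff_distrib sum_subtractf c_sum c_mult sum_distrib_left mult.assoc)
  also have "(\<Sum>r\<in>UNIV. \<Sum>j\<in>UNIV. c (h $ r * of_int (A $ r $ j)) * X j)
    = (\<Sum>j\<in>UNIV. c (col_pair A h j) * X j)"
    by (subst sum.swap) (simp add: col_pair_def c_sum sum_distrib_right)
  finally show ?thesis .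
qed

lemma col_pair_exponent:
  assumes "map_matrix of_int A *v v = \<gamma>"
  shows "(\<Sum>j\<in>UNIV. col_pair A h j * v $ j) = (\<Sum>r\<in>UNIV. h $ r * \<gamma> $ r)"
proof -
  have "(\<Sum>j\<in>UNIV. col_pair A h j * v $ j) = (\<Sum>j\<in>UNIV. \<Sum>r\<in>UNIV. h $ r * (of_int (A $ r $ j) * v $ j))"
    by (simp add: col_pair_def sum_distrib_right mult.assoc)
  also have "\<dots> = (\<Sum>r\<in>UNIV. h $ r * (map_matrix of_int A *v v) $ r)"
    by (subst sum.swap) (simp add: matrix_vector_mult_def map_matrix_def sum_distrib_left)
  finally show ?thesis using assms by simp
qed

text \<open>Each generator reduces to its value at \<open>v\<close> modulo the ideal of
  \<open>v\<close>. In a proper ideal these constants must be 0, so \<open>v\<close> is a common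
  zero.\<close>

lemma indicial_point:
  assumes r: "restricted_indicial \<gamma> J" and v: "\<And>j. X j - c (v $ j) \<in> J"
  shows "has_point_product (exponents \<gamma>) J"
proof (cases "1 \<in> J")
  case True then show ?thesis unfolding has_point_product_def by (intro exI[of _ "[]"]) auto
next
  case False
  have J: "ideal_set J" using r by (simp add: restricted_indicial_def)
  have unit: "a = 0" if "c a \<in> J" for a
    using cancel_c[OF J, of a 1] that False by auto
  have "X p1 - (X p1 - c (v $ p1)) \<in> J"
    using r v by (intro ideal_setD(6)[OF J] v) (auto simp: restricted_indicial_def)
  then have 1: "v $ p1 = 0" using unit by simp
  have "(map_matrix of_int A *v v) $ r = \<gamma> $ r" for r
  proof -
    have "(\<Sum>j\<in>UNIV. c (of_int (A $ r $ j)) * X j) - c (\<gamma> $ r) \<in> J"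
      using assms(1) by (simp add: restricted_indicial_def)
    moreover have "(\<Sum>j\<in>UNIV. c (of_int (A $ r $ j)) * (X j - c (v $ j))) \<in> J"
      by (intro ideal_set_sum[OF J] ideal_setD(3)[OF J] v)
    ultimately have "((\<Sum>j\<in>UNIV. c (of_int (A $ r $ j)) * X j) - c (\<gamma> $ r))
      - (\<Sum>j\<in>UNIV. c (of_int (A $ r $ j)) * (X j - c (v $ j))) \<in> J"
      by (rule ideal_setD(6)[OF J])
    also have "((\<Sum>j\<in>UNIV. c (of_int (A $ r $ j)) * X j) - c (\<gamma> $ r))
      - (\<Sum>j\<in>UNIV. c (of_int (A $ r $ j)) * (X j - c (v $ j)))
      = c ((map_matrix of_int A *v v) $ r - \<gamma> $ r)"
      by (simp add: matrix_vector_mult_def map_matrix_def c_diff c_sum c_mult sum_subtractf algebra_simps)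
    finally show ?thesis using unit by fastforce
  qed
  then have 2: "map_matrix of_int A *v v = \<gamma>" by (simp add: vec_eq_iff)
  have 3: "\<exists>i n. v $ i = of_nat n \<and> n < b $ i" if "b \<in> N" for b
  proof -
    let ?F = "Sigma UNIV (\<lambda>i. {..<b $ i})"
    have fin: "finite ?F" by auto
    have "ffact b \<in> J" using r that by (simp add: restricted_indicial_def)
    then have "ffact b - (ffact b - c (\<Prod>(i, k)\<in>?F. v $ i - of_nat k)) \<in> J"
      unfolding ffact_def by (intro ideal_setD(6)[OF J] prod_linear_factors_mod J v fin)
    then have "(\<Prod>(i, k)\<in>?F. v $ i - of_nat k) = 0" using unit by simp
    then show ?thesis using fin by (auto simp: prod_zero_iff)
  qed
  show ?thesis
    unfolding has_point_product_def using 1 2 3 v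
    by (intro exI[of _ "[v]"]) (auto simp: exponents_def)
qed

text \<open>\<open>S\<close> collects the coordinates with a fixed value. If its complement is not a
  face, some \<open>b\<close> in \<open>N\<close> is supported there, and splitting along the
  factors of \<open>ffact b\<close> fixes one more coordinate. If it is a face, its columns are
  independent and the Euler operators fix all the rest.\<close>

lemma indicial_point_product:
  assumes "restricted_indicial \<gamma> J" "p1 \<in> S" "\<And>i. i \<in> S \<Longrightarrow> X i - c (a i) \<in> J"
  shows "has_point_product (exponents \<gamma>) J"
  using assms
proof (induction "card (- S)" arbitrary: S a J rule: less_induct)
  case less
  note r = less.prems(1)
  have J: "ideal_set J" using r by (simp add: restricted_indicial_def)
  show ?case
  proof (cases "face (- S)")
    case False
    then obtain b where b: "b \<in> N" "\<And>i. i \<in> S \<Longrightarrow> b $ i = 0" unfolding face_def by blast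
    obtain ps where ps: "set ps = Sigma UNIV (\<lambda>i. {..<b $ i})" "distinct ps"
      using finite_distinct_list[of "Sigma UNIV (\<lambda>i. {..<b $ i})"] by auto
    let ?fs = "map (\<lambda>(i, k). (i, of_nat k)) ps :: ('n \<times> complex) list"
    have "prod_list (map (\<lambda>(i, a). X i - c a) ?fs) = ffact b"
      unfolding ffact_def ps(1)[symmetric] prod.distinct_set_conv_list[OF ps(2)]
      by (simp add: comp_def case_prod_unfold)
    then have "prod_list (map (\<lambda>(i, a). X i - c a) ?fs) \<in> J"
      using r b(1) by (simp add: restricted_indicial_def)
    then show ?thesis
    proof (rule has_point_product_linear_factors[OF J])
      fix J' i a' assume J': "ideal_set J'" "J \<subseteq> J'" "(i, a') \<in> set ?fs" "X i - c a' \<in> J'"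
      obtain k where "(i, k) \<in> set ps" using J'(3) by auto
      then have "k < b $ i" unfolding ps(1) by simp
      then have i: "i \<notin> S" using b(2) by auto
      have "card (- insert i S) < card (- S)" using i by (intro psubset_card_mono) auto
      then show "has_point_product (exponents \<gamma>) J'"
      proof (rule less.hyps)
        show "restricted_indicial \<gamma> J'" by (rule restricted_indicial_mono[OF r J'(1,2)])
        show "X l - c ((a(i := a')) l) \<in> J'" if "l \<in> insert i S" for l
          using that J'(2,4) less.prems(3) i by auto
      qed (use less.prems(2) in auto)
    qed
  next
    case True
    have "\<exists>a'. X j - c a' \<in> J" for j
    proof (cases "j \<in> S")
      case False
      obtain h where h: "\<And>i. i \<in> - S - {j} \<Longrightarrow> col_pair A h i = 0" "col_pair A h j \<noteq> 0"
        using face_functional[OF face_mono[OF True, of "- S - {j}"], of j] less.prems(2) by auto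
      let ?p = "col_pair A h" and ?g = "\<Sum>r\<in>UNIV. h $ r * \<gamma> $ r"
      \<comment> \<open>As \<open>h\<close> vanishes on the other free columns, subtracting the
        fixed values leaves a multiple of \<open>X j\<close> and a constant.\<close>
      have "(\<Sum>i\<in>UNIV. c (?p i) * X i) - c ?g - (\<Sum>i\<in>S. c (?p i) * (X i - c (a i))) \<in> J"
        by (intro ideal_setD(6)[OF J] col_pair_indicial[OF r] ideal_set_sum[OF J] ideal_setD(3)[OF J] less.prems(3))
      also have "(\<Sum>i\<in>UNIV. c (?p i) * X i) = (\<Sum>i\<in>insert j S. c (?p i) * X i)"
        using h(1) by (intro sum.mono_neutral_right) (auto simp: c_0)
      also have "(\<Sum>i\<in>insert j S. c (?p i) * X i) - c ?g - (\<Sum>i\<in>S. c (?p i) * (X i - c (a i)))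
        = c (?p j) * X j - c (?g - (\<Sum>i\<in>S. ?p i * a i))"
        using False by (simp add: right_diff_distrib sum_subtractf c_diff c_sum c_mult)
      also have "\<dots> = c (?p j) * (X j - c ((?g - (\<Sum>i\<in>S. ?p i * a i)) / ?p j))"
        using h(2) by (subst right_diff_distrib) (simp flip: c_mult)
      finally have "X j - c ((?g - (\<Sum>i\<in>S. ?p i * a i)) / ?p j) \<in> J" by (rule cancel_c[OF J h(2)])
      then show ?thesis by (rule exI)
    next
      case True
      then show ?thesis by (intro exI[of _ "a j"] less.prems(3))
    qed
    then have "\<exists>f. \<forall>j. X j - c (f j) \<in> J" by (intro choice allI)
    then obtain f where f: "\<And>j. X j - c (f j) \<in> J" by blast
    show ?thesis by (rule indicial_point[OF r, of "\<chi> j. f j"]) (simp add: f)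
  qed
qed

text \<open>Outside \<open>T \<union> L\<close> one falling factorial settles each coordinate, apart
  from \<open>p1\<close>, which is covered by \<open>X p1\<close>. The columns in
  \<open>T \<union> L\<close> are independent by \<open>link_functional\<close>, so the Euler
  operators settle the others.\<close>

lemma indicial_reduced:
  assumes r: "restricted_indicial \<gamma> J" and v: "v \<in> exponents \<gamma>"
    and T: "p1 \<notin> T" "CARD('d) < card T + 3"
    and above: "\<And>\<mu> C. standard_pair M \<mu> C \<Longrightarrow> (\<And>i. i \<notin> C \<Longrightarrow> v $ i = of_nat (\<mu> $ i)) \<Longrightarrow> T \<subseteq> C"
    and sq: "\<And>j k. (X j - c (v $ j)) * (X k - c (v $ k)) \<in> J"
  shows "X j - c (v $ j) \<in> J"
proof -
  have J: "ideal_set J" and X1: "X p1 \<in> J" and bN: "\<And>b. b \<in> N \<Longrightarrow> ffact b \<in> J"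
    using r by (auto simp: restricted_indicial_def)
  have vA: "map_matrix of_int A *v v = \<gamma>" and v1: "v $ p1 = 0"
    and vN: "\<And>b. b \<in> N \<Longrightarrow> \<exists>i n. v $ i = of_nat n \<and> n < b $ i"
    using v by (auto simp: exponents_def)
  let ?s = "\<lambda>j. X j - c (v $ j)"
  \<comment> \<open>For \<open>l\<close> in \<open>L\<close> every falling factorial still vanishes
    at \<open>v\<close> through another coordinate, so by \<open>standard_pair_extend\<close> some
    standard pair through \<open>v\<close> contains \<open>l\<close>.\<close>
  define L where "L = {l. l \<noteq> p1 \<and> l \<notin> T \<and> (\<forall>b\<in>N. \<exists>i n. i \<noteq> l \<and> v $ i = of_nat n \<and> n < b $ i)}"
  have faceI: "face (C0 \<union> T)" if C0: "\<And>b. b \<in> N \<Longrightarrow> \<exists>i n. i \<notin> C0 \<and> v $ i = of_nat n \<and> n < b $ i" for C0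
  proof -
    obtain \<mu> C where C: "C0 \<subseteq> C" "standard_pair M \<mu> C" "\<And>i. i \<notin> C \<Longrightarrow> v $ i = of_nat (\<mu> $ i)"
      by (rule standard_pair_extend[OF ideal_M, of C0 v]) (use C0 in auto)
    have "face C" unfolding face_def using standard_pair_face[OF ideal_M C(2)] by blast
    then show ?thesis using above[OF C(2,3)] C(1) by (auto intro: face_mono)
  qed
  have faceT: "face T" using faceI[of "{}"] vN by simp
  have faceL: "face (insert l T)" if "l \<in> L" for l
    using faceI[of "{l}"] that by (simp add: L_def)
  have outside: "?s j \<in> J" if j: "j \<notin> T \<union> L" for j
  proof (cases "j = p1")
    case True then show ?thesis using X1 v1 by (simp add: c_0)
  next
    case False
    \<comment> \<open>As \<open>j\<close> is not in \<open>L\<close>, some \<open>b\<close> vanishes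
      at \<open>v\<close> only through \<open>j\<close>, and there only by the factor with
      \<open>k = n\<close>. The remaining factors are nonzero at \<open>v\<close> and can be
      cancelled.\<close>
    then obtain b where b: "b \<in> N" "\<And>i n. v $ i = of_nat n \<Longrightarrow> n < b $ i \<Longrightarrow> i = j"
      using j unfolding L_def by blast
    then obtain n where n: "v $ j = of_nat n" "n < b $ j" using vN by blast
    let ?F = "Sigma UNIV (\<lambda>i. {..<b $ i})"
    have "ffact b = ?s j * (\<Prod>(i, k)\<in>?F - {(j, n)}. X i - c (of_nat k))"
      unfolding ffact_def using n by (subst prod.remove[of ?F "(j, n)"]) auto
    moreover have "v $ i \<noteq> of_nat k" if "(i, k) \<in> ?F - {(j, n)}" for i k
      using b(2)[of i k] that n(1) by auto
    ultimately show ?thesis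
      using bN[OF b(1)] by (intro cancel_linear_factors[OF J sq, where F = "?F - {(j, n)}"]) auto
  qed
  show ?thesis
  proof (cases "j \<in> T \<union> L")
    case True
    have p1: "p1 \<notin> T \<union> L" "T \<inter> L = {}" using T(1) by (auto simp: L_def)
    obtain h where h: "\<And>i. i \<in> T \<union> L - {j} \<Longrightarrow> col_pair A h i = 0" "col_pair A h j \<noteq> 0"
      using link_functional[OF faceT faceL p1 T(2) True] by metis
    let ?p = "col_pair A h"
    have "(\<Sum>i\<in>UNIV. c (?p i) * ?s i) = (\<Sum>i\<in>UNIV. c (?p i) * X i) - c (\<Sum>r\<in>UNIV. h $ r * \<gamma> $ r)"
      by (simp add: right_diff_distrib sum_subtractf c_sum c_mult flip: col_pair_exponent[OF vA])
    also have "\<dots> \<in> J" by (rule col_pair_indicial[OF r])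
    finally have "(\<Sum>i\<in>UNIV. c (?p i) * ?s i) \<in> J" .
    moreover have "(\<Sum>i\<in>- (T \<union> L). c (?p i) * ?s i) \<in> J"
      by (intro ideal_set_sum[OF J] ideal_setD(3)[OF J] outside) auto
    ultimately have "(\<Sum>i\<in>UNIV. c (?p i) * ?s i) - (\<Sum>i\<in>- (T \<union> L). c (?p i) * ?s i) \<in> J"
      by (rule ideal_setD(6)[OF J])
    also have "(\<Sum>i\<in>UNIV. c (?p i) * ?s i) - (\<Sum>i\<in>- (T \<union> L). c (?p i) * ?s i) = (\<Sum>i\<in>T \<union> L. c (?p i) * ?s i)"
      by (subst sum.subset_diff[of "T \<union> L" UNIV]) (auto simp: Compl_eq_Diff_UNIV)
    also have "\<dots> = c (?p j) * ?s j"
      using True h(1) by (subst sum.remove[of _ j]) (auto intro!: sum.neutral simp: c_0)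
    finally show ?thesis by (rule cancel_c[OF J h(2)])
  qed (use outside in blast)
qed

theorem indicial_partition_of_unity:
  assumes r: "restricted_indicial \<gamma> J"
    and T: "p1 \<notin> T" "CARD('d) < card T + 3"
    and above: "\<And>v \<mu> C. v \<in> exponents \<gamma> \<Longrightarrow> standard_pair M \<mu> C \<Longrightarrow>
      (\<And>i. i \<notin> C \<Longrightarrow> v $ i = of_nat (\<mu> $ i)) \<Longrightarrow> T \<subseteq> C"
  obtains V e where "finite V" "V \<subseteq> exponents \<gamma>" "(\<Sum>v\<in>V. e v) - 1 \<in> J"
    "\<And>v j. v \<in> V \<Longrightarrow> (X j - c (v $ j)) * e v \<in> J"
proof -
  have J: "ideal_set J" using r by (simp add: restricted_indicial_def)
  have "has_point_product (exponents \<gamma>) J"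
    using r by (intro indicial_point_product[OF r, of "{p1}" "\<lambda>_. 0"]) (auto simp: restricted_indicial_def c_0)
  then have "\<exists>vs. set vs \<subseteq> exponents \<gamma> \<and> distinct vs \<and> point_products vs \<subseteq> J"
  proof (rule distinct_point_product[OF J])
    fix v J' j
    assume v: "v \<in> exponents \<gamma>" and J': "ideal_set J'" "J \<subseteq> J'"
      and "\<And>j k. (X j - c (v $ j)) * (X k - c (v $ k)) \<in> J'"
    then show "X j - c (v $ j) \<in> J'"
      by (intro indicial_reduced[OF restricted_indicial_mono[OF r J'] v T above[OF v]])
  qed
  then obtain vs where vs: "set vs \<subseteq> exponents \<gamma>" "distinct vs" "point_products vs \<subseteq> J"
    by blast
  show thesis
    using partition_of_unity[OF J vs(2,3)] vs(1) that[of "set vs"] by blast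
qed

end

section \<open>Generic parameters\<close>

lemma poly_mapping_single_add_induct [case_names single add]:
  fixes p :: "'a \<Rightarrow>\<^sub>0 'b::comm_monoid_add"
  assumes single: "\<And>u a. P (Poly_Mapping.single u a)" and add: "\<And>p q. P p \<Longrightarrow> P q \<Longrightarrow> P (p + q)"
  shows "P p"
proof -
  have "P (\<Sum>u\<in>S. Poly_Mapping.single u (Poly_Mapping.lookup p u))" if "finite S" for S
    using that
  proof induction
    case empty show ?case using single[of undefined 0] by simp
  qed (simp add: assms)
  moreover have "(\<Sum>u\<in>Poly_Mapping.keys p. Poly_Mapping.single u (Poly_Mapping.lookup p u)) = p"
    by (rule poly_mapping_eqI) (auto simp: lookup_sum lookup_single when_def sum.delta in_keys_iff)
  ultimately show ?thesis by (metis finite_keys)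
qed

text \<open>The polynomial type of the derivations serves a second time: its variables will also
  stand for the \<open>\<theta>\<^sub>j\<close>.\<close>

interpretation dp: coordinate_ring "\<lambda>j::'n::finite. dmonom (axis j 1)" "Poly_Mapping.single 0"
  by standard (auto simp: single_add mult_single)

lemma dpoly_eval_single: "dpoly_eval (Poly_Mapping.single u a) v = a * (\<Prod>i\<in>UNIV. v $ i ^ u $ i)"
  by (cases "a = 0") (auto simp: dpoly_eval_def)

lemma dpoly_eval_zero: "dpoly_eval 0 v = 0"
  by (simp add: dpoly_eval_def)

lemma dpoly_eval_add: "dpoly_eval (p + q) v = dpoly_eval p v + dpoly_eval q v"
  unfolding dpoly_eval_def
  by (rule setsum_keys_plus_distrib[where f = "\<lambda>u a. a * (\<Prod>i\<in>UNIV. v $ i ^ u $ i)"])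
    (auto simp: algebra_simps)

lemma dpoly_eval_sum: "dpoly_eval (sum f I) v = (\<Sum>i\<in>I. dpoly_eval (f i) v)"
  by (induction I rule: infinite_finite_induct) (auto simp: dpoly_eval_add dpoly_eval_zero)

lemma dpoly_eval_mult: "dpoly_eval (p * q) v = dpoly_eval p v * dpoly_eval q v"
proof (induction p rule: poly_mapping_single_add_induct)
  case (single u a)
  show ?case
  proof (induction q rule: poly_mapping_single_add_induct)
    case (single w b)
    show ?case by (simp add: mult_single dpoly_eval_single power_add prod.distrib)
  qed (simp add: distrib_left dpoly_eval_add)
qed (simp add: distrib_right dpoly_eval_add)

lemma dpoly_eval_prod: "dpoly_eval (prod f I) v = (\<Prod>i\<in>I. dpoly_eval (f i) v)"
proof -
  have "dpoly_eval (Poly_Mapping.single 0 1) v = 1" by (simp only: dpoly_eval_single) simp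
  then have "dpoly_eval 1 v = 1" by simp
  then show ?thesis
    by (induction I rule: infinite_finite_induct) (auto simp: dpoly_eval_mult)
qed

lemma dpoly_eval_X: "dpoly_eval (dmonom (axis j 1)) v = v $ j"
proof -
  have "(\<Prod>i\<in>UNIV. v $ i ^ (axis j 1 :: nat^'a) $ i) = (\<Prod>i\<in>UNIV. if i = j then v $ j else 1)"
    by (rule prod.cong) (auto simp: axis_def)
  then show ?thesis by (simp add: dpoly_eval_single)
qed

lemma dvars_add: "dvars (p + q) \<subseteq> dvars p \<union> dvars q"
  using Poly_Mapping.keys_add[of p q] unfolding dvars_def by blast

lemma dvars_mult: "dvars (p * q) \<subseteq> dvars p \<union> dvars q"
proof
  fix i assume "i \<in> dvars (p * q)"
  then obtain u where u: "u \<in> Poly_Mapping.keys (p * q)" "u $ i \<noteq> 0" by (auto simp: dvars_def)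
  obtain a b where "u = a + b" "a \<in> Poly_Mapping.keys p" "b \<in> Poly_Mapping.keys q"
    using keys_mult[of p q] u(1) by blast
  then show "i \<in> dvars p \<union> dvars q" using u(2) by (auto simp: dvars_def)
qed

lemma dvars_sum_subset: "(\<And>i. i \<in> I \<Longrightarrow> dvars (f i) \<subseteq> T) \<Longrightarrow> dvars (sum f I) \<subseteq> T"
proof (induction I rule: infinite_finite_induct)
  case (insert x F)
  then show ?case using dvars_add[of "f x" "sum f F"] by auto
qed (auto simp: dvars_def)

lemma dvars_prod_subset: "(\<And>i. i \<in> I \<Longrightarrow> dvars (f i) \<subseteq> T) \<Longrightarrow> dvars (prod f I) \<subseteq> T"
proof (induction I rule: infinite_finite_induct)
  case (insert x F)
  then show ?case using dvars_mult[of "f x" "prod f F"] by auto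
qed (auto simp: dvars_def)

section \<open>Avoiding finitely many affine hyperplanes\<close>

definition affine_form :: "'n set \<Rightarrow> ('n \<Rightarrow> complex) \<times> complex \<Rightarrow> complex^'n::finite \<Rightarrow> complex" where
  "affine_form T q a = (\<Sum>t\<in>T. fst q t * a $ t) + snd q"

lemma affine_form_line:
  "affine_form T q (a + s *s (b - a)) = affine_form T q a + s * (affine_form T q b - affine_form T q a)"
  by (simp add: affine_form_def algebra_simps sum.distrib sum_subtractf sum_distrib_left)

text \<open>Given \<open>a\<close> off the earlier hyperplanes and \<open>b\<close> off the new one,
  no form vanishes identically on the line through them. Each has at most one zero there, so all but
  finitely many points of the line will do.\<close>

lemma exists_point_off_hyperplanes:
  fixes T :: "'n::finite set"
  assumes "finite Q" "\<And>q. q \<in> Q \<Longrightarrow> \<exists>t\<in>T. fst q t \<noteq> 0"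
  shows "\<exists>a. (\<forall>i. i \<notin> T \<longrightarrow> a $ i = 0) \<and> (\<forall>q\<in>Q. affine_form T q a \<noteq> 0)"
  using assms
proof induction
  case empty show ?case by (intro exI[of _ 0]) auto
next
  case (insert q Q)
  have "\<exists>a. (\<forall>i. i \<notin> T \<longrightarrow> a $ i = 0) \<and> (\<forall>q\<in>Q. affine_form T q a \<noteq> 0)"
    using insert.prems by (intro insert.IH) blast
  then obtain a where a: "\<And>i. i \<notin> T \<Longrightarrow> a $ i = 0" "\<And>q. q \<in> Q \<Longrightarrow> affine_form T q a \<noteq> 0" by blast
  obtain t where t: "t \<in> T" "fst q t \<noteq> 0" using insert.prems[of q] by blast
  have "affine_form T q (axis t 1) = fst q t + affine_form T q 0"
    using t(1) by (simp add: affine_form_def axis_def if_distrib[of "\<lambda>x. _ * x"] cong: if_cong)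
  then have "affine_form T q 0 \<noteq> 0 \<or> affine_form T q (axis t 1) \<noteq> 0" using t(2) by auto
  moreover have "\<forall>i. i \<notin> T \<longrightarrow> (0 :: complex^'n) $ i = 0" "\<forall>i. i \<notin> T \<longrightarrow> (axis t 1 :: complex^'n) $ i = 0"
    using t(1) by (auto simp: axis_def)
  ultimately obtain b where b: "\<And>i. i \<notin> T \<Longrightarrow> b $ i = 0" "affine_form T q b \<noteq> 0"
    by blast
  have "finite {s. affine_form T r a + s * (affine_form T r b - affine_form T r a) = 0}"
    if "r \<in> insert q Q" for r
  proof (rule finite_subset)
    let ?x = "affine_form T r a" and ?y = "affine_form T r b"
    have ne: "?x \<noteq> 0 \<or> ?y \<noteq> 0" using that a(2)[of r] b(2) by blast
    show "{s. ?x + s * (?y - ?x) = 0} \<subseteq> {?x / (?x - ?y)}"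
    proof
      fix s assume s: "s \<in> {s. ?x + s * (?y - ?x) = 0}"
      then have "?x \<noteq> ?y" using ne by auto
      then show "s \<in> {?x / (?x - ?y)}" using s by (simp add: field_simps)
    qed
  qed simp
  then have "finite (\<Union>r\<in>insert q Q. {s. affine_form T r a + s * (affine_form T r b - affine_form T r a) = 0})"
    using insert.hyps by blast
  then obtain s where s: "\<And>r. r \<in> insert q Q \<Longrightarrow> affine_form T r (a + s *s (b - a)) \<noteq> 0"
    using ex_new_if_finite[OF infinite_UNIV_char_0] unfolding affine_form_line by blast
  show ?case using s a(1) b(1) by (intro exI[of _ "a + s *s (b - a)"]) auto
qed

text \<open>The product of the affine forms is the required polynomial; it is nonzero because it has
  a nonzero value at the point just constructed.\<close>

lemma holds_generically_affine:
  fixes T :: "'n::finite set"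
  assumes "finite Q" "\<And>q. q \<in> Q \<Longrightarrow> \<exists>t\<in>T. fst q t \<noteq> 0"
  shows "holds_generically T (\<lambda>a. \<forall>q\<in>Q. affine_form T q a \<noteq> 0)"
proof -
  define f where "f q = (\<Sum>t\<in>T. Poly_Mapping.single 0 (fst q t) * dmonom (axis t 1)) + Poly_Mapping.single 0 (snd q)"
    for q :: "('n \<Rightarrow> complex) \<times> complex"
  have const: "dpoly_eval (Poly_Mapping.single 0 z) a = z" for z and a :: "complex^'n"
    by (simp add: dpoly_eval_single)
  have ev: "dpoly_eval (f q) a = affine_form T q a" for q a
    unfolding f_def affine_form_def dpoly_eval_add dpoly_eval_sum dpoly_eval_mult dpoly_eval_X const ..
  obtain a where a: "\<forall>i. i \<notin> T \<longrightarrow> a $ i = 0" "\<forall>q\<in>Q. affine_form T q a \<noteq> 0"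
    using exists_point_off_hyperplanes[OF assms] by auto
  have "dpoly_eval (prod f Q) a \<noteq> 0" using a(2) assms(1) by (simp add: dpoly_eval_prod ev)
  then have "prod f Q \<noteq> 0" by (auto simp: dpoly_eval_def)
  moreover have "dvars (prod f Q) \<subseteq> T"
  proof (rule dvars_prod_subset)
    fix q :: "('n \<Rightarrow> complex) \<times> complex"
    have "dvars (Poly_Mapping.single 0 (fst q t) * dmonom (axis t 1)) \<subseteq> T" if "t \<in> T" for t
      using that by (auto simp: dvars_def mult_single axis_def split: if_splits)
    then have "dvars (\<Sum>t\<in>T. Poly_Mapping.single 0 (fst q t) * dmonom (axis t 1)) \<subseteq> T"
      by (rule dvars_sum_subset)
    moreover have "dvars (Poly_Mapping.single (0 :: nat^'n) (snd q)) = {}" by (simp add: dvars_def)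
    ultimately show "dvars (f q) \<subseteq> T"
      unfolding f_def by (intro order_trans[OF dvars_add]) simp
  qed
  ultimately show ?thesis
    unfolding holds_generically_def using assms(1)
    by (intro exI[of _ "prod f Q"]) (auto simp: dpoly_eval_prod ev)
qed

lemma holds_generically_mono:
  assumes "holds_generically T P" "\<And>a. (\<And>i. i \<notin> T \<Longrightarrow> a $ i = 0) \<Longrightarrow> P a \<Longrightarrow> Q a"
  shows "holds_generically T Q"
  using assms unfolding holds_generically_def by blast

text \<open>If a standard pair with exponent \<mu> and face \<open>C\<close> misses some
  \<open>t\<close> in \<open>T\<close>, a functional vanishes on the columns in
  \<open>C - {p1}\<close> but not at \<open>t\<close>. Applied to \<open>A v\<close> it sees only
  \<mu>, so equality with \<open>A (\<eta> + \<alpha>)\<close> puts \<alpha> on a proper affine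
  hyperplane. Finitely many pairs give finitely many hyperplanes.\<close>

lemma (in generic_toric) generic_standard_pairs_above:
  assumes p1: "p1 \<notin> T"
  shows "holds_generically T (\<lambda>\<alpha>. \<forall>v \<mu> C.
    map_matrix of_int A *v v = map_matrix of_int A *v (nat_cvec \<eta> + \<alpha>) \<longrightarrow> v $ p1 = 0 \<longrightarrow>
    standard_pair M \<mu> C \<longrightarrow> (\<forall>i. i \<notin> C \<longrightarrow> v $ i = of_nat (\<mu> $ i)) \<longrightarrow> T \<subseteq> C)"
proof -
  let ?bad = "{(\<mu>, C). standard_pair M \<mu> C} \<inter> {(\<mu>, C). \<not> T \<subseteq> C}"
  have "\<exists>h. (\<forall>i\<in>C - {p1}. col_pair A h i = 0) \<and> (\<exists>t\<in>T. col_pair A h t \<noteq> 0)"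
    if "(\<mu>, C) \<in> ?bad" for \<mu> C
  proof -
    obtain t where t: "t \<in> T" "t \<notin> C" using \<open>(\<mu>, C) \<in> ?bad\<close> by blast
    have "face C" unfolding face_def using standard_pair_face[OF ideal_M] that by blast
    then have "face (C - {p1})" by (rule face_mono) auto
    then obtain h where "\<And>i. i \<in> C - {p1} \<Longrightarrow> col_pair A h i = 0" "col_pair A h t \<noteq> 0"
      using face_functional[of "C - {p1}" t] t by blast
    then show ?thesis using t(1) by blast
  qed
  then have "\<forall>x. \<exists>h. x \<in> ?bad \<longrightarrow> (\<forall>i\<in>snd x - {p1}. col_pair A h i = 0) \<and> (\<exists>t\<in>T. col_pair A h t \<noteq> 0)"
    by (metis prod.collapse)
  then obtain h where h: "\<And>x i. x \<in> ?bad \<Longrightarrow> i \<in> snd x - {p1} \<Longrightarrow> col_pair A (h x) i = 0"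
    "\<And>x. x \<in> ?bad \<Longrightarrow> \<exists>t\<in>T. col_pair A (h x) t \<noteq> 0" by metis
  define q where "q x = (col_pair A (h x),
    \<Sum>i\<in>UNIV. col_pair A (h x) i * (of_nat (\<eta> $ i) - of_nat (fst x $ i)))" for x
  have "finite ?bad" using finite_standard_pairs[OF ideal_M] by blast
  moreover have "\<exists>t\<in>T. fst r t \<noteq> 0" if r: "r \<in> q ` ?bad" for r
  proof -
    obtain x where "x \<in> ?bad" "r = q x" using r by blast
    then show ?thesis using h(2)[of x] by (simp add: q_def)
  qed
  ultimately have "holds_generically T (\<lambda>a. \<forall>r\<in>q ` ?bad. affine_form T r a \<noteq> 0)"
    by (intro holds_generically_affine finite_imageI)
  then show ?thesis
  proof (rule holds_generically_mono, intro allI impI)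
    fix \<alpha> v \<mu> C
    assume \<alpha>: "\<And>i. i \<notin> T \<Longrightarrow> \<alpha> $ i = 0" and ne: "\<forall>r\<in>q ` ?bad. affine_form T r \<alpha> \<noteq> 0"
      and v: "map_matrix of_int A *v v = map_matrix of_int A *v (nat_cvec \<eta> + \<alpha>)" "v $ p1 = 0"
      and sp: "standard_pair M \<mu> C" "\<forall>i. i \<notin> C \<longrightarrow> v $ i = of_nat (\<mu> $ i)"
    show "T \<subseteq> C"
    proof (rule ccontr)
      assume "\<not> T \<subseteq> C"
      then have bad: "(\<mu>, C) \<in> ?bad" using sp by blast
      let ?p = "col_pair A (h (\<mu>, C))"
      \<comment> \<open>On \<open>C\<close> the functional vanishes except perhaps at
        \<open>p1\<close>, where both \<open>v\<close> and \<mu> are 0.\<close>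
      have pv: "?p i * v $ i = ?p i * of_nat (\<mu> $ i)" for i
      proof (cases "i \<in> C")
        case True
        then show ?thesis
          using h(1)[OF bad, of i] sp(1) v(2) by (cases "i = p1") (auto simp: standard_pair_def)
      qed (use sp(2) in simp)
      have pair: "(\<Sum>i\<in>UNIV. ?p i * x $ i) = (\<Sum>r\<in>UNIV. h (\<mu>, C) $ r * (map_matrix of_int A *v x) $ r)" for x
      proof -
        have "(\<Sum>i\<in>UNIV. ?p i * x $ i) = (\<Sum>i\<in>UNIV. \<Sum>r\<in>UNIV. h (\<mu>, C) $ r * (of_int (A $ r $ i) * x $ i))"
          by (simp add: col_pair_def sum_distrib_right mult.assoc)
        also have "\<dots> = (\<Sum>r\<in>UNIV. h (\<mu>, C) $ r * (map_matrix of_int A *v x) $ r)"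
          by (subst sum.swap) (simp add: matrix_vector_mult_def map_matrix_def sum_distrib_left)
        finally show ?thesis .
      qed
      have "(\<Sum>i\<in>UNIV. ?p i * of_nat (\<mu> $ i)) = (\<Sum>i\<in>UNIV. ?p i * (nat_cvec \<eta> + \<alpha>) $ i)"
        unfolding pv[symmetric] pair v(1) ..
      also have "\<dots> = (\<Sum>i\<in>UNIV. ?p i * of_nat (\<eta> $ i)) + (\<Sum>i\<in>UNIV. ?p i * \<alpha> $ i)"
        by (simp add: nat_cvec_def algebra_simps sum.distrib)
      also have "(\<Sum>i\<in>UNIV. ?p i * \<alpha> $ i) = (\<Sum>i\<in>T. ?p i * \<alpha> $ i)"
        using \<alpha> by (intro sum.mono_neutral_right) auto
      finally have "affine_form T (q (\<mu>, C)) \<alpha> = 0"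
        by (simp add: affine_form_def q_def right_diff_distrib sum_subtractf)
      then show False using ne bad by blast
    qed
  qed
qed

section \<open>Commuting operators and the Weyl algebra\<close>

declare One_nat_def [simp del]

text \<open>Serves the multiplications by the \<open>x_j\<close>, the derivations and the
  \<open>\<theta>\<^sub>j\<close> alike. The laws are required on \<open>H\<close> only, since
  partial derivatives obey them only for sufficiently regular functions.\<close>

locale comm_ops =
  fixes H :: "('b \<Rightarrow> complex) set" and T :: "'n::{finite,linorder} \<Rightarrow> ('b \<Rightarrow> complex) \<Rightarrow> 'b \<Rightarrow> complex"
  assumes H_zero: "(\<lambda>z. 0) \<in> H"
    and H_add: "f \<in> H \<Longrightarrow> g \<in> H \<Longrightarrow> (\<lambda>z. f z + g z) \<in> H"
    and H_scale: "f \<in> H \<Longrightarrow> (\<lambda>z. a * f z) \<in> H"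
    and T_H: "f \<in> H \<Longrightarrow> T j f \<in> H"
    and T_add: "f \<in> H \<Longrightarrow> g \<in> H \<Longrightarrow> T j (\<lambda>z. f z + g z) = (\<lambda>z. T j f z + T j g z)"
    and T_scale: "f \<in> H \<Longrightarrow> T j (\<lambda>z. a * f z) = (\<lambda>z. a * T j f z)"
    and T_comm: "f \<in> H \<Longrightarrow> T j (T k f) = T k (T j f)"
begin

lemma H_sum: "(\<And>i. i \<in> I \<Longrightarrow> f i \<in> H) \<Longrightarrow> (\<lambda>z. \<Sum>i\<in>I. f i z) \<in> H"
  by (induction I rule: infinite_finite_induct) (auto simp: H_zero H_add)

lemma T_zero: "T j (\<lambda>z. 0) = (\<lambda>z. 0)"
  using T_scale[OF H_zero, of j 0] by simp

lemma T_sum: "(\<And>i. i \<in> I \<Longrightarrow> f i \<in> H) \<Longrightarrow> T j (\<lambda>z. \<Sum>i\<in>I. f i z) = (\<lambda>z. \<Sum>i\<in>I. T j (f i) z)"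
  by (induction I rule: infinite_finite_induct) (auto simp: T_zero T_add H_sum)

lemma funpow_H: "f \<in> H \<Longrightarrow> (T j ^^ n) f \<in> H"
  by (induction n) (auto simp: T_H)

lemma funpow_add: "f \<in> H \<Longrightarrow> g \<in> H \<Longrightarrow> (T j ^^ n) (\<lambda>z. f z + g z) = (\<lambda>z. (T j ^^ n) f z + (T j ^^ n) g z)"
  by (induction n) (auto simp: T_add funpow_H)

lemma funpow_scale: "f \<in> H \<Longrightarrow> (T j ^^ n) (\<lambda>z. a * f z) = (\<lambda>z. a * (T j ^^ n) f z)"
  by (induction n) (auto simp: T_scale funpow_H)

lemma T_funpow: "f \<in> H \<Longrightarrow> T k ((T j ^^ n) f) = (T j ^^ n) (T k f)"
  by (induction n) (auto simp: T_comm[of _ k j] funpow_H)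

lemma funpow_funpow: "f \<in> H \<Longrightarrow> (T k ^^ m) ((T j ^^ n) f) = (T j ^^ n) ((T k ^^ m) f)"
  by (induction m) (auto simp: T_funpow funpow_H)

text \<open>\<open>multi_pow\<close> folds over the sorted list of all indices; arbitrary lists make
  induction possible.\<close>

definition list_pow :: "'n list \<Rightarrow> (nat, 'n) vec \<Rightarrow> ('b \<Rightarrow> complex) \<Rightarrow> 'b \<Rightarrow> complex" where
  "list_pow xs a = fold (\<lambda>j. T j ^^ (a $ j)) xs"

lemma list_pow_simps:
  "list_pow [] a f = f" "list_pow (x # xs) a f = list_pow xs a ((T x ^^ (a $ x)) f)"
  by (simp_all add: list_pow_def)

lemma list_pow_H: "f \<in> H \<Longrightarrow> list_pow xs a f \<in> H"
  by (induction xs arbitrary: f) (auto simp: list_pow_simps funpow_H)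

lemma list_pow_linear:
  "f \<in> H \<Longrightarrow> g \<in> H \<Longrightarrow> list_pow xs a (\<lambda>z. f z + g z) = (\<lambda>z. list_pow xs a f z + list_pow xs a g z)"
  "f \<in> H \<Longrightarrow> list_pow xs a (\<lambda>z. s * f z) = (\<lambda>z. s * list_pow xs a f z)"
  by (induction xs arbitrary: f g) (auto simp: list_pow_simps funpow_H funpow_add funpow_scale)

lemma funpow_list_pow: "f \<in> H \<Longrightarrow> (T j ^^ n) (list_pow xs a f) = list_pow xs a ((T j ^^ n) f)"
  by (induction xs arbitrary: f) (auto simp: list_pow_simps funpow_H funpow_funpow)

lemma list_pow_plus: "f \<in> H \<Longrightarrow> list_pow xs (a + b) f = list_pow xs a (list_pow xs b f)"
  by (induction xs arbitrary: f)
    (auto simp: list_pow_simps funpow_H funpow_list_pow Nat.funpow_add list_pow_H)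

lemma list_pow_axis:
  "distinct xs \<Longrightarrow> list_pow xs (axis j 1) f = (if j \<in> set xs then T j f else f)"
  by (induction xs arbitrary: f) (auto simp: list_pow_simps axis_def One_nat_def)

lemma list_pow_zero: "list_pow xs 0 f = f"
  by (induction xs arbitrary: f) (auto simp: list_pow_simps)

lemma multi_pow_eq: "multi_pow T a f = list_pow (sorted_list_of_set UNIV) a f"
  by (simp add: multi_pow_def list_pow_def)

lemma multi_pow_H: "f \<in> H \<Longrightarrow> multi_pow T a f \<in> H"
  by (simp add: multi_pow_eq list_pow_H)

lemma multi_pow_linear:
  "f \<in> H \<Longrightarrow> g \<in> H \<Longrightarrow> multi_pow T a (\<lambda>z. f z + g z) = (\<lambda>z. multi_pow T a f z + multi_pow T a g z)"
  "f \<in> H \<Longrightarrow> multi_pow T a (\<lambda>z. s * f z) = (\<lambda>z. s * multi_pow T a f z)"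
  by (simp_all add: multi_pow_eq list_pow_linear)

lemma multi_pow_null: "multi_pow T a (\<lambda>z. 0) = (\<lambda>z. 0)"
  using multi_pow_linear(2)[OF H_zero, of a 0] by simp

lemma multi_pow_plus: "f \<in> H \<Longrightarrow> multi_pow T (a + b) f = multi_pow T a (multi_pow T b f)"
  by (simp add: multi_pow_eq list_pow_plus)

lemma multi_pow_axis: "multi_pow T (axis j 1) f = T j f"
  unfolding multi_pow_eq by (subst list_pow_axis) auto

lemma multi_pow_zero: "multi_pow T 0 f = f"
  by (simp add: multi_pow_eq list_pow_zero)

lemma multi_pow_plus_axis:
  assumes "f \<in> H" shows "multi_pow T (a + axis j 1) f = T j (multi_pow T a f)"
  using multi_pow_plus[OF assms, of "axis j 1" a] by (simp add: multi_pow_axis add.commute)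

lemma multi_pow_lincomb:
  "(\<And>i. i \<in> I \<Longrightarrow> f i \<in> H) \<Longrightarrow> multi_pow T a (\<lambda>z. \<Sum>i\<in>I. s i * f i z) = (\<lambda>z. \<Sum>i\<in>I. s i * multi_pow T a (f i) z)"
proof (induction I rule: infinite_finite_induct)
  case (insert i I)
  then show ?case
    by (simp add: multi_pow_linear(1)[OF H_scale H_sum[OF H_scale]] multi_pow_linear(2))
qed (auto simp: multi_pow_null)

lemma multi_pow_eq_0:
  assumes f: "f \<in> H" "T j f = (\<lambda>z. 0)" and a: "a $ j \<noteq> 0"
  shows "multi_pow T a f = (\<lambda>z. 0)"
proof -
  have "a = (a - axis j 1) + axis j 1" using a by (auto simp: vec_eq_iff axis_def)
  then have "multi_pow T a f = multi_pow T (a - axis j 1) (multi_pow T (axis j 1) f)"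
    using multi_pow_plus[OF f(1), of "a - axis j 1" "axis j 1"] by simp
  then show ?thesis by (simp add: multi_pow_axis f(2) multi_pow_null)
qed

definition pact :: "'n dpoly \<Rightarrow> ('b \<Rightarrow> complex) \<Rightarrow> 'b \<Rightarrow> complex" where
  "pact p f = (\<lambda>z. \<Sum>u\<in>Poly_Mapping.keys p. Poly_Mapping.lookup p u * multi_pow T u f z)"

lemma pact_single: "pact (Poly_Mapping.single u a) f = (\<lambda>z. a * multi_pow T u f z)"
  by (cases "a = 0") (auto simp: pact_def)

lemma pact_add: "pact (p + q) f = (\<lambda>z. pact p f z + pact q f z)"
  unfolding pact_def
  by (intro ext setsum_keys_plus_distrib[where f = "\<lambda>u a. a * multi_pow T u f z" for z])
    (auto simp: algebra_simps)

lemma pact_null: "pact 0 f = (\<lambda>z. 0)"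
  by (simp add: pact_def)

lemma pact_uminus: "pact (- p) f = (\<lambda>z. - pact p f z)"
  by (simp add: pact_def sum_negf)

lemma pact_diff: "pact (p - q) f = (\<lambda>z. pact p f z - pact q f z)"
  using pact_add[of p "- q" f] by (simp add: pact_uminus)

lemma pact_sum: "pact (sum p I) f = (\<lambda>z. \<Sum>i\<in>I. pact (p i) f z)"
  by (induction I rule: infinite_finite_induct) (auto simp: pact_null pact_add)

lemma pact_H: "f \<in> H \<Longrightarrow> pact p f \<in> H"
  unfolding pact_def by (intro H_sum H_scale multi_pow_H)

lemma pact_linear:
  assumes "f \<in> H"
  shows "g \<in> H \<Longrightarrow> pact p (\<lambda>z. f z + g z) = (\<lambda>z. pact p f z + pact p g z)"
    and "pact p (\<lambda>z. s * f z) = (\<lambda>z. s * pact p f z)"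
  using assms
  by (auto simp: pact_def multi_pow_linear algebra_simps sum.distrib sum_distrib_left)

lemma pact_mult:
  assumes f: "f \<in> H" shows "pact (p * q) f = pact p (pact q f)"
proof (induction p rule: poly_mapping_single_add_induct)
  case (single u a)
  show ?case
  proof (induction q rule: poly_mapping_single_add_induct)
    case (single w b)
    show ?case
      by (simp add: mult_single pact_single multi_pow_plus[OF f] multi_pow_linear(2)[OF multi_pow_H[OF f]] mult.assoc)
  next
    case (add p q)
    then show ?case by (simp add: distrib_left pact_add pact_linear(1)[OF pact_H[OF f] pact_H[OF f]])
  qed
qed (simp add: distrib_right pact_add)

lemma pact_null_arg: "pact p (\<lambda>z. 0) = (\<lambda>z. 0)"
  by (simp add: pact_def multi_pow_null)

text \<open>The link from functions to the ideal arguments, which are applied to the annihilator of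
  a single function.\<close>

lemma ideal_set_annihilator:
  assumes "f \<in> H" shows "ideal_set {p. pact p f = (\<lambda>z. 0)}"
  unfolding ideal_set_def
  using assms by (auto simp: pact_null pact_add pact_mult pact_null_arg)

lemma pact_1: "pact 1 f = f"
  using pact_single[of 0 1 f] by (simp add: multi_pow_zero)

lemma pact_const: "pact (Poly_Mapping.single 0 a) f = (\<lambda>z. a * f z)"
  by (simp add: pact_single multi_pow_zero)

lemma pact_X: "pact (dmonom (axis j 1)) f = T j f"
  by (simp add: pact_single multi_pow_axis)

lemma pact_eigen:
  assumes f: "f \<in> H" and eig: "\<And>j. T j f = (\<lambda>z. v $ j * f z)"
  shows "pact p f = (\<lambda>z. dpoly_eval p v * f z)"
proof -
  have pow: "(T j ^^ n) f = (\<lambda>z. v $ j ^ n * f z)" for j n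
    by (induction n) (simp_all add: T_scale[OF f] eig power_Suc2 mult.assoc del: power_Suc)
  have list: "list_pow xs u f = (\<lambda>z. prod_list (map (\<lambda>i. v $ i ^ u $ i) xs) * f z)" for xs u
    by (induction xs) (auto simp: list_pow_simps pow list_pow_linear(2)[OF f] mult.assoc)
  have "multi_pow T u f = (\<lambda>z. (\<Prod>i\<in>UNIV. v $ i ^ u $ i) * f z)" for u
    unfolding multi_pow_eq list
    by (simp add: prod.distinct_set_conv_list[symmetric])
  then show ?thesis
    by (simp add: pact_def dpoly_eval_def sum_distrib_right mult.assoc)
qed

end

lemma nat_vec_induct [case_names zero plus_axis]:
  fixes a :: "nat^'n::finite"
  assumes "P 0" "\<And>a j. P a \<Longrightarrow> P (a + axis j 1)"
  shows "P a"
proof (induction "\<Sum>i\<in>UNIV. a $ i" arbitrary: a)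
  case 0
  then have "a = 0" by (simp add: vec_eq_iff)
  then show ?case using assms(1) by simp
next
  case (Suc n)
  then obtain j where j: "a $ j \<noteq> 0" by (metis sum.neutral nat.distinct(1))
  define b where "b = a - axis j 1"
  have ab: "a = b + axis j 1" using j by (auto simp: b_def vec_eq_iff axis_def)
  have "(\<Sum>i\<in>UNIV. a $ i) = (\<Sum>i\<in>UNIV. b $ i) + 1"
    by (simp add: ab sum.distrib axis_def)
  then have "P b" using Suc by simp
  then show ?case unfolding ab by (rule assms(2))
qed

lemma weyl_act_single:
  "weyl_act X D (Poly_Mapping.single u s) f = (\<lambda>z. s * multi_pow X (fst u) (multi_pow D (snd u) f) z)"
  by (cases "s = 0") (auto simp: weyl_act_def case_prod_unfold)

lemma weyl_act_add: "weyl_act X D (P + Q) f = (\<lambda>z. weyl_act X D P f z + weyl_act X D Q f z)"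
proof
  fix z
  show "weyl_act X D (P + Q) f z = weyl_act X D P f z + weyl_act X D Q f z"
    unfolding weyl_act_def case_prod_unfold prod.collapse
    by (rule setsum_keys_plus_distrib[where
          f = "\<lambda>u s. s * multi_pow X (fst u) (multi_pow D (snd u) f) z"])
      (auto simp: algebra_simps)
qed

lemma weyl_act_zero: "weyl_act X D 0 f = (\<lambda>z. 0)"
  by (simp add: weyl_act_def)

lemma weyl_act_uminus: "weyl_act X D (- P) f = (\<lambda>z. - weyl_act X D P f z)"
  by (simp add: weyl_act_def case_prod_unfold sum_negf)

lemma weyl_act_sum: "weyl_act X D (sum P I) f = (\<lambda>z. \<Sum>i\<in>I. weyl_act X D (P i) f z)"
  by (induction I rule: infinite_finite_induct) (auto simp: weyl_act_zero weyl_act_add)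

lemma weyl_act_scale: "weyl_act X D (Poly_Mapping.map ((*) s) P) f = (\<lambda>z. s * weyl_act X D P f z)"
proof -
  have "Poly_Mapping.map ((*) s) P = (\<Sum>(a, b)\<in>Poly_Mapping.keys P. Poly_Mapping.single (a, b) (s * Poly_Mapping.lookup P (a, b)))"
    by (rule poly_mapping_eqI)
      (auto simp: lookup_sum lookup_single map.rep_eq when_def case_prod_unfold sum.delta in_keys_iff)
  then show ?thesis
    by (simp add: weyl_act_sum weyl_act_single case_prod_unfold)
      (simp add: weyl_act_def case_prod_unfold sum_distrib_left mult.assoc)
qed

section \<open>The action of the Weyl algebra and the operators \<theta>\<close>

locale weyl_module = x: comm_ops H X + d: comm_ops H D
  for H :: "('b \<Rightarrow> complex) set" and X D :: "'n::{finite,linorder} \<Rightarrow> ('b \<Rightarrow> complex) \<Rightarrow> 'b \<Rightarrow> complex" +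
  assumes leibniz: "f \<in> H \<Longrightarrow> D j (X k f) = (\<lambda>z. X k (D j f) z + (if j = k then f z else 0))"
begin

text \<open>The commutator of \<open>\<partial>_j\<close> with \<open>x^a\<close>. For
  \<open>a $ j = 0\<close> the truncated subtraction does no harm, because its coefficient is
  0.\<close>

lemma D_multi_pow_X:
  assumes f: "f \<in> H"
  shows "D j (multi_pow X a f) =
    (\<lambda>z. multi_pow X a (D j f) z + of_nat (a $ j) * multi_pow X (a - axis j 1) f z)"
proof (induction a rule: nat_vec_induct)
  case zero
  show ?case by (simp add: x.multi_pow_zero)
next
  case (plus_axis a k)
  have *: "of_nat (a $ j) * X k (multi_pow X (a - axis j 1) f) z + (if j = k then multi_pow X a f z else 0)
      = of_nat ((a + axis k 1) $ j) * multi_pow X (a + axis k 1 - axis j 1) f z" for z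
  proof (cases "j = k")
    case True
    have "a + axis k 1 - axis j 1 = a" using True by (simp add: vec_eq_iff)
    moreover have "of_nat (a $ j) * X k (multi_pow X (a - axis j 1) f) z = of_nat (a $ j) * multi_pow X a f z"
    proof (cases "a $ j = 0")
      case False
      then have "a - axis j 1 + axis j 1 = a" by (auto simp: vec_eq_iff axis_def)
      then show ?thesis using x.multi_pow_plus_axis[OF f, of "a - axis j 1" j] True by simp
    qed simp
    ultimately show ?thesis using True by (simp add: axis_def algebra_simps)
  next
    case False
    then have "a - axis j 1 + axis k 1 = a + axis k 1 - axis j 1" by (auto simp: vec_eq_iff axis_def)
    then show ?thesis
      using x.multi_pow_plus_axis[OF f, of "a - axis j 1" k] False by (simp add: axis_def)
  qed
  have "D j (multi_pow X (a + axis k 1) f) = (\<lambda>z. X k (D j (multi_pow X a f)) z + (if j = k then multi_pow X a f z else 0))"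
    unfolding x.multi_pow_plus_axis[OF f] by (rule leibniz[OF x.multi_pow_H[OF f]])
  also have "X k (D j (multi_pow X a f)) = (\<lambda>z. X k (multi_pow X a (D j f)) z + of_nat (a $ j) * X k (multi_pow X (a - axis j 1) f) z)"
    unfolding plus_axis.IH
    by (simp add: x.T_add x.T_scale x.H_scale x.multi_pow_H f d.T_H)
  finally show ?case
    unfolding x.multi_pow_plus_axis[OF d.T_H[OF f]] *[symmetric] add.assoc .
qed

lemma weyl_act_x_mult:
  assumes f: "f \<in> H"
  shows "weyl_act X D (weyl_x_mult j P) f = X j (weyl_act X D P f)"
proof -
  have "X j (weyl_act X D P f) = (\<lambda>z. \<Sum>u\<in>Poly_Mapping.keys P.
      X j (\<lambda>z. Poly_Mapping.lookup P u * multi_pow X (fst u) (multi_pow D (snd u) f) z) z)"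
    unfolding weyl_act_def case_prod_unfold prod.collapse
    by (rule x.T_sum) (intro x.H_scale x.multi_pow_H d.multi_pow_H f)
  then show ?thesis
    by (simp add: weyl_x_mult_def weyl_act_sum weyl_act_single case_prod_unfold
        x.multi_pow_plus_axis x.T_scale x.multi_pow_H d.multi_pow_H f)
qed

lemma weyl_act_d_mult:
  assumes f: "f \<in> H"
  shows "weyl_act X D (weyl_d_mult j P) f = D j (weyl_act X D P f)"
proof -
  have "D j (weyl_act X D P f) = (\<lambda>z. \<Sum>u\<in>Poly_Mapping.keys P.
      D j (\<lambda>z. Poly_Mapping.lookup P u * multi_pow X (fst u) (multi_pow D (snd u) f) z) z)"
    unfolding weyl_act_def case_prod_unfold prod.collapse
    by (rule d.T_sum) (intro x.H_scale x.multi_pow_H d.multi_pow_H f)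
  then show ?thesis
    by (simp add: weyl_d_mult_def weyl_act_sum weyl_act_add weyl_act_single case_prod_unfold
        d.multi_pow_plus_axis d.T_scale x.multi_pow_H d.multi_pow_H f D_multi_pow_X algebra_simps)
qed

lemma weyl_act_lincomb:
  assumes "\<And>i. i \<in> I \<Longrightarrow> f i \<in> H"
  shows "weyl_act X D P (\<lambda>z. \<Sum>i\<in>I. s i * f i z) = (\<lambda>z. \<Sum>i\<in>I. s i * weyl_act X D P (f i) z)"
proof -
  have "multi_pow X a (multi_pow D b (\<lambda>z. \<Sum>i\<in>I. s i * f i z))
    = (\<lambda>z. \<Sum>i\<in>I. s i * multi_pow X a (multi_pow D b (f i)) z)" for a b
    using assms by (simp add: d.multi_pow_lincomb x.multi_pow_lincomb d.multi_pow_H)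
  then show ?thesis
    unfolding weyl_act_def case_prod_unfold
    by (simp add: sum_distrib_left mult.left_commute, subst sum.swap, simp)
qed

lemma weyl_left_ideal_annihilates:
  assumes f: "f \<in> H" and G: "\<And>P. P \<in> G \<Longrightarrow> weyl_act X D P f = (\<lambda>z. 0)" and P: "P \<in> weyl_left_ideal G"
  shows "weyl_act X D P f = (\<lambda>z. 0)"
  using P
  by induction
    (auto simp: G weyl_act_zero weyl_act_add weyl_act_scale weyl_act_x_mult[OF f] weyl_act_d_mult[OF f] x.T_zero d.T_zero)

lemma weyl_act_of_dpoly: "weyl_act X D (weyl_of_dpoly p) f = d.pact p f"
  by (simp add: weyl_of_dpoly_def weyl_act_sum weyl_act_single x.multi_pow_zero d.pact_def)

lemma weyl_act_euler_op:
  "weyl_act X D (euler_op A \<gamma> i) f = (\<lambda>z. (\<Sum>j\<in>UNIV. of_int (A $ i $ j) * X j (D j f) z) - \<gamma> $ i * f z)"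
  unfolding euler_op_def diff_conv_add_uminus weyl_act_add weyl_act_uminus weyl_act_sum weyl_act_single fst_conv snd_conv
  by (simp add: x.multi_pow_axis d.multi_pow_axis x.multi_pow_zero d.multi_pow_zero)

definition theta :: "'n \<Rightarrow> ('b \<Rightarrow> complex) \<Rightarrow> 'b \<Rightarrow> complex" where
  "theta j f = X j (D j f)"

sublocale th: comm_ops H theta
proof
  fix f j k assume f: "f \<in> H"
  \<comment> \<open>This normal form is symmetric in \<open>j\<close> and \<open>k\<close>, since
    the multiplications commute among themselves and so do the derivations.\<close>
  have *: "theta j (theta k f) = (\<lambda>z. X j (X k (D j (D k f))) z + (if j = k then X j (D k f) z else 0))" for j k
  proof -
    have "theta j (theta k f) = X j (\<lambda>z. X k (D j (D k f)) z + (if j = k then 1 else 0) * D k f z)"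
      unfolding theta_def by (subst leibniz) (auto simp: d.T_H f intro!: arg_cong[of _ _ "X j"])
    then show ?thesis
      by (simp add: x.T_add x.H_scale x.T_scale x.T_H d.T_H f)
  qed
  show "theta j (theta k f) = theta k (theta j f)"
    unfolding * by (subst x.T_comm) (auto simp: d.T_H f d.T_comm[of f j k])
qed (auto simp: theta_def x.H_zero x.H_add x.H_scale x.T_H d.T_H x.T_add d.T_add x.T_scale d.T_scale)

lemma ffact_plus_axis:
  "dp.ffact (b + axis j 1) = (dmonom (axis j 1) - Poly_Mapping.single 0 (of_nat (b $ j))) * dp.ffact (b :: (nat, 'n) vec)"
proof -
  have "Sigma UNIV (\<lambda>i. {..<(b + axis j 1) $ i}) = insert (j, b $ j) (Sigma UNIV (\<lambda>i. {..<b $ i}))"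
    by (auto simp: axis_def split: if_splits)
  then show ?thesis unfolding dp.ffact_def by simp
qed

text \<open>Induction on \<open>b\<close> by \<open>x^(b + e_j) \<partial>^(b + e_j) = (\<theta>_j -
  b_j) x^b \<partial>^b\<close>, which restates the commutator formula
  \<open>D_multi_pow_X\<close>.\<close>

lemma ffact_theta:
  assumes f: "f \<in> H"
  shows "th.pact (dp.ffact b) f = multi_pow X b (multi_pow D b f)"
proof (induction b rule: nat_vec_induct)
  case zero
  have "dp.ffact (0 :: (nat, 'n) vec) = 1" by (simp add: dp.ffact_def)
  then show ?case by (simp add: th.pact_1 x.multi_pow_zero d.multi_pow_zero)
next
  case (plus_axis b j)
  let ?g = "multi_pow D b f"
  have g: "?g \<in> H" by (rule d.multi_pow_H[OF f])
  have xg: "of_nat (b $ j) * X j (multi_pow X (b - axis j 1) ?g) z = of_nat (b $ j) * multi_pow X b ?g z" for z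
  proof (cases "b $ j = 0")
    case False
    then have "b - axis j 1 + axis j 1 = b" by (auto simp: vec_eq_iff axis_def)
    then show ?thesis using x.multi_pow_plus_axis[OF g, of "b - axis j 1" j] by simp
  qed simp
  have "th.pact (dp.ffact (b + axis j 1)) f
    = (\<lambda>z. theta j (multi_pow X b ?g) z - of_nat (b $ j) * multi_pow X b ?g z)"
    unfolding ffact_plus_axis th.pact_mult[OF f] th.pact_diff th.pact_X th.pact_const plus_axis.IH ..
  also have "theta j (multi_pow X b ?g) = (\<lambda>z. X j (multi_pow X b (D j ?g)) z + of_nat (b $ j) * X j (multi_pow X (b - axis j 1) ?g) z)"
    unfolding theta_def D_multi_pow_X[OF g]
    by (simp add: x.T_add x.T_scale x.H_scale x.multi_pow_H g d.T_H)
  finally show ?case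
    by (simp add: xg x.multi_pow_plus_axis d.multi_pow_plus_axis f g d.T_H)
qed

end

section \<open>Partial derivatives of holomorphic functions\<close>

lemma axis_plus: "axis j (s + t) = axis j s + axis j (t :: complex)"
  by (simp add: vec_eq_iff axis_def)

lemma norm_axis: "norm (axis j t :: complex^'n::finite) = norm t"
proof -
  have "(\<Sum>i\<in>UNIV. (norm ((axis j t :: complex^'n) $ i))\<^sup>2) = (\<Sum>i\<in>UNIV. if i = j then (norm t)\<^sup>2 else 0)"
    by (rule sum.cong) (auto simp: axis_def)
  then show ?thesis by (simp add: norm_vec_def L2_set_def)
qed

lemma bounded_linear_axis: "bounded_linear (axis j :: complex \<Rightarrow> complex^'n::finite)"
proof (rule bounded_linear_intro[where K = 1])
  show "axis j (r *\<^sub>R t) = r *\<^sub>R (axis j t :: complex^'n)" for r t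
    by (simp add: vec_eq_iff axis_def)
qed (simp_all add: axis_plus norm_axis)

lemma continuous_on_axis [continuous_intros]:
  "continuous_on S g \<Longrightarrow> continuous_on S (\<lambda>x. axis j (g x :: complex) :: complex^'n::finite)"
  by (rule bounded_linear.continuous_on[OF bounded_linear_axis])

lemma axis_zero: "axis j (0 :: complex) = 0"
  by (simp add: vec_eq_iff axis_def)

text \<open>
  By Osgood's lemma these are exactly the holomorphic functions; unlike differentiability, joint
  continuity passes to partial derivatives directly through Cauchy's formula.
\<close>

definition osgood :: "(complex^'n::finite) set \<Rightarrow> (complex^'n \<Rightarrow> complex) set" where
  "osgood U = {f. continuous_on U f \<and>
     (\<forall>z\<in>U. \<forall>j. (\<lambda>t. f (z + axis j t)) field_differentiable at 0) \<and> (\<forall>z. z \<notin> U \<longrightarrow> f z = 0)}"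

lemma d_fn_eqI:
  "z \<in> U \<Longrightarrow> ((\<lambda>t. f (z + axis j t)) has_field_derivative y) (at 0) \<Longrightarrow> d_fn U j f z = y"
  unfolding d_fn_def by (simp add: DERIV_imp_deriv)

lemma slice_deriv_0:
  "f \<in> osgood U \<Longrightarrow> z \<in> U \<Longrightarrow> ((\<lambda>t. f (z + axis j t)) has_field_derivative d_fn U j f z) (at 0)"
  unfolding osgood_def d_fn_def by (auto simp: DERIV_deriv_iff_field_differentiable)

lemma slice_deriv:
  assumes "f \<in> osgood U" "z + axis j t \<in> U"
  shows "((\<lambda>s. f (z + axis j s)) has_field_derivative d_fn U j f (z + axis j t)) (at t)"
proof -
  have "((\<lambda>s. f (z + axis j (s + t))) has_field_derivative d_fn U j f (z + axis j t)) (at 0)"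
    using slice_deriv_0[OF assms, of j] by (simp add: axis_plus add_ac)
  then show ?thesis using DERIV_shift[of "\<lambda>s. f (z + axis j s)" _ 0 t] by simp
qed

lemma open_slice: "open U \<Longrightarrow> open {t. z + axis j t \<in> (U :: (complex^'n::finite) set)}"
proof -
  assume "open U"
  moreover have "continuous_on UNIV (\<lambda>t. z + axis j t)" by (intro continuous_intros)
  ultimately have "open ((\<lambda>t. z + axis j t) -` U)" by (rule open_vimage)
  then show ?thesis by (simp add: vimage_def)
qed

section \<open>Cauchy's formula with parameters\<close>

definition circ :: "real \<Rightarrow> real \<Rightarrow> complex" where
  "circ r t = of_real r * exp (2 * of_real pi * \<i> * of_real t)"

lemma norm_circ: "0 < r \<Longrightarrow> norm (circ r t) = r"
  by (simp add: circ_def norm_mult)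

lemma circ_nonzero: "0 < r \<Longrightarrow> circ r t \<noteq> 0"
  by (simp add: circ_def)

lemma continuous_on_circ [continuous_intros]: "continuous_on S g \<Longrightarrow> continuous_on S (\<lambda>x. circ r (g x))"
  unfolding circ_def by (intro continuous_intros)

text \<open>Cauchy's formula with \<open>u = circ r t\<close> and \<open>du = 2 pi i u dt\<close>.
  In this form the derivative is an integral over a fixed interval, to which the theorems on
  parameter integrals apply.\<close>

lemma deriv_circle_mean:
  assumes "g holomorphic_on V" "open V" "cball 0 r \<subseteq> V" "0 < r"
  shows "deriv g 0 = integral (cbox 0 1) (\<lambda>t. g (circ r t) / circ r t)"
proof -
  have "(2 * pi * \<i>) * deriv g 0 = contour_integral (circlepath 0 r) (\<lambda>u. g u / (u - 0)\<^sup>2)"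
  proof (rule Cauchy_contour_integral_circlepath_2[symmetric])
    have "g holomorphic_on cball 0 r" using assms(1,3) by (rule holomorphic_on_subset)
    then show "continuous_on (cball 0 r) g" "g holomorphic_on ball 0 r"
      using ball_subset_cball by (auto intro: holomorphic_on_imp_continuous_on holomorphic_on_subset)
  qed (use assms(4) in auto)
  also have "\<dots> = integral (cbox 0 1) (\<lambda>t. (2 * pi * \<i>) * (g (circ r t) / circ r t))"
    unfolding contour_integral_integral cbox_interval vector_derivative_circlepath
    using assms(4) by (intro integral_cong)
      (simp add: circlepath circ_def field_simps power2_eq_square)
  also have "\<dots> = (2 * pi * \<i>) * integral (cbox 0 1) (\<lambda>t. g (circ r t) / circ r t)"
    by (rule integral_mult_right)
  finally show ?thesis by simp
qed

text \<open>The factor 2 leaves room for the circle of radius \<open>r\<close> about every centre in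
  the ball of radius \<open>r\<close>, so that the centre can vary.\<close>

context
  fixes U :: "(complex^'n::finite) set" and z0 :: "complex^'n" and r :: real
  assumes r: "0 < r" and ball: "ball z0 (2 * r) \<subseteq> U"
begin

lemma translate_mem: "z \<in> ball z0 r \<Longrightarrow> norm t \<le> r \<Longrightarrow> z + axis j t \<in> U"
proof -
  assume *: "z \<in> ball z0 r" "norm t \<le> r"
  have "dist z0 (z + axis j t) \<le> dist z0 z + dist z (z + axis j t)" by (rule dist_triangle)
  also have "\<dots> < r + r" using * by (intro add_less_le_mono) (auto simp: dist_norm norm_axis)
  finally show ?thesis using ball by auto
qed

lemma continuous_on_circle_integrand:
  assumes "continuous_on U f"
  shows "continuous_on (ball z0 r \<times> cbox 0 1) (\<lambda>(z, t). f (z + axis j (circ r t)) / circ r t)"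
  unfolding case_prod_unfold
  using r by (intro continuous_intros continuous_on_compose2[OF assms])
    (auto simp: circ_nonzero norm_circ intro!: translate_mem)

lemma d_fn_circle_mean:
  assumes U: "open U" and f: "f \<in> osgood U" and z: "z \<in> ball z0 r"
  shows "d_fn U j f z = integral (cbox 0 1) (\<lambda>t. f (z + axis j (circ r t)) / circ r t)"
proof -
  let ?V = "{t. z + axis j t \<in> U}"
  have "z \<in> U" using translate_mem[OF z, of 0] r by (simp add: axis_zero)
  have "(\<lambda>t. f (z + axis j t)) holomorphic_on ?V"
    using slice_deriv[OF f] by (auto simp: holomorphic_on_open[OF open_slice[OF U]])
  then have "deriv (\<lambda>t. f (z + axis j t)) 0 = integral (cbox 0 1) (\<lambda>t. f (z + axis j (circ r t)) / circ r t)"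
    using r by (intro deriv_circle_mean[where V = ?V] open_slice U) (auto intro!: translate_mem[OF z])
  then show ?thesis using \<open>z \<in> U\<close> by (simp add: d_fn_def)
qed

end

lemma open_double_ball:
  fixes U :: "(complex^'n::finite) set"
  assumes "open U" "z0 \<in> U" obtains r where "0 < r" "ball z0 (2 * r) \<subseteq> U"
proof -
  obtain e where "e > 0" "ball z0 e \<subseteq> U" using assms openE by blast
  then show thesis using that[of "e / 2"] by auto
qed

lemma continuous_on_d_fn:
  assumes U: "open U" and f: "f \<in> osgood U" shows "continuous_on U (d_fn U j f)"
  unfolding continuous_on_eq_continuous_at[OF U]
proof
  fix z0 assume "z0 \<in> U"
  then obtain r where r: "0 < r" "ball z0 (2 * r) \<subseteq> U" using open_double_ball[OF U] by metis
  have "continuous_on U f" using f by (simp add: osgood_def)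
  from integral_continuous_on_param[OF continuous_on_circle_integrand[OF r this]]
  have "continuous_on (ball z0 r) (\<lambda>z. integral (cbox 0 1) (\<lambda>t. f (z + axis j (circ r t)) / circ r t))" .
  then have "continuous_on (ball z0 r) (d_fn U j f)"
    by (rule continuous_on_eq) (simp add: d_fn_circle_mean[OF r U f])
  then show "isCont (d_fn U j f) z0" using r(1) by (simp add: continuous_on_eq_continuous_at)
qed

text \<open>Cauchy's integral is differentiated under the integral sign, using the continuity of
  \<open>d_fn U k f\<close>. This gives the mixed derivative, and reading the result as Cauchy's
  formula for \<open>d_fn U k f\<close> gives its symmetry.\<close>

lemma d_fn_slice_deriv:
  assumes U: "open U" and f: "f \<in> osgood U" and r: "0 < r" "ball z0 (2 * r) \<subseteq> U"
  shows "((\<lambda>s. d_fn U j f (z0 + axis k s)) has_field_derivative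
    integral (cbox 0 1) (\<lambda>t. d_fn U k f (z0 + axis j (circ r t)) / circ r t)) (at 0)"
proof -
  let ?F = "\<lambda>s t. f (z0 + axis k s + axis j (circ r t)) / circ r t"
  let ?G = "\<lambda>s t. d_fn U k f (z0 + axis k s + axis j (circ r t)) / circ r t"
  have mem: "z0 + axis k s \<in> ball z0 r" if "s \<in> ball 0 r" for s
    using that by (simp add: dist_norm norm_axis)
  have sub: "continuous_on (ball 0 r \<times> cbox 0 1) (\<lambda>(s, t). g (z0 + axis k s + axis j (circ r t)) / circ r t)"
    if "continuous_on U g" for g
  proof -
    have "continuous_on (ball 0 r \<times> cbox 0 1) (\<lambda>x. (z0 + axis k (fst x), snd x))"
      by (intro continuous_intros)
    moreover have "(\<lambda>x. (z0 + axis k (fst x), snd x)) ` (ball 0 r \<times> cbox 0 1) \<subseteq> ball z0 r \<times> cbox (0::real) 1"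
      using mem by auto
    ultimately have "continuous_on (ball 0 r \<times> cbox 0 1)
        (\<lambda>x. (\<lambda>(z, t). g (z + axis j (circ r t)) / circ r t) (z0 + axis k (fst x), snd x))"
      by (rule continuous_on_compose2[OF continuous_on_circle_integrand[OF r that, of j]])
    then show ?thesis by (simp only: case_prod_unfold fst_conv snd_conv)
  qed
  have "((\<lambda>s. integral (cbox 0 1) (?F s)) has_field_derivative integral (cbox 0 1) (?G 0)) (at 0 within ball 0 r)"
  proof (rule leibniz_rule_field_derivative)
    fix s :: complex and t :: real assume s: "s \<in> ball 0 r"
    have "z0 + axis j (circ r t) + axis k s \<in> U"
      using translate_mem[OF r mem[OF s], of "circ r t" j] r(1) by (simp add: norm_circ add_ac)
    from slice_deriv[OF f this]
    have "((\<lambda>s. f (z0 + axis k s + axis j (circ r t))) has_field_derivative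
        d_fn U k f (z0 + axis k s + axis j (circ r t))) (at s)"
      by (simp add: add_ac)
    then show "((\<lambda>s. ?F s t) has_field_derivative ?G s t) (at s within ball 0 r)"
      by (rule DERIV_cdivide[OF has_field_derivative_at_within])
  next
    fix s :: complex assume s: "s \<in> ball 0 r"
    have c: "continuous_on U f" using f by (simp add: osgood_def)
    have "continuous_on (cbox 0 1) (\<lambda>t. (\<lambda>(s, t). ?F s t) (s, t))"
      by (rule continuous_on_compose2[OF sub[OF c]]) (use s in \<open>auto intro!: continuous_intros\<close>)
    then show "?F s integrable_on cbox 0 1" by (intro integrable_continuous) simp
  next
    show "continuous_on (ball 0 r \<times> cbox 0 1) (\<lambda>(s, t). ?G s t)"
      by (rule sub[OF continuous_on_d_fn[OF U f]])
  qed (use r in auto)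
  moreover have "at 0 within ball 0 r = at (0 :: complex)" using r(1) by (intro at_within_open) auto
  ultimately have "((\<lambda>s. integral (cbox 0 1) (?F s)) has_field_derivative integral (cbox 0 1) (?G 0)) (at 0)"
    by (simp only:)
  then have "((\<lambda>s. d_fn U j f (z0 + axis k s)) has_field_derivative integral (cbox 0 1) (?G 0)) (at 0)"
    by (rule has_field_derivative_transform_within_open[of _ _ _ "ball 0 r"])
      (simp_all only: d_fn_circle_mean[OF r U f mem] open_ball, simp add: r(1))
  then show ?thesis by (simp only: axis_zero add_0_right)
qed

lemma d_fn_osgood:
  assumes U: "open U" and f: "f \<in> osgood U" shows "d_fn U j f \<in> osgood U"
proof -
  have "(\<lambda>t. d_fn U j f (z + axis k t)) field_differentiable at 0" if z: "z \<in> U" for z k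
  proof -
    obtain r where r: "0 < r" "ball z (2 * r) \<subseteq> U" using open_double_ball[OF U z] by metis
    from d_fn_slice_deriv[OF U f r] show ?thesis by (auto simp: field_differentiable_def)
  qed
  then show ?thesis using continuous_on_d_fn[OF U f] by (auto simp: osgood_def d_fn_def)
qed

lemma d_fn_commute:
  assumes U: "open U" and f: "f \<in> osgood U" shows "d_fn U k (d_fn U j f) = d_fn U j (d_fn U k f)"
proof
  fix z
  show "d_fn U k (d_fn U j f) z = d_fn U j (d_fn U k f) z"
  proof (cases "z \<in> U")
    case True
    obtain r where r: "0 < r" "ball z (2 * r) \<subseteq> U" using open_double_ball[OF U True] by metis
    have "d_fn U k (d_fn U j f) z = integral (cbox 0 1) (\<lambda>t. d_fn U k f (z + axis j (circ r t)) / circ r t)"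
      by (rule d_fn_eqI[OF True d_fn_slice_deriv[OF U f r]])
    also have "\<dots> = d_fn U j (d_fn U k f) z"
      using r(1) by (intro d_fn_circle_mean[OF r U d_fn_osgood[OF U f], symmetric]) simp
    finally show ?thesis .
  qed (simp add: d_fn_def)
qed

lemma has_derivative_slice:
  fixes f :: "complex^'n::finite \<Rightarrow> complex"
  assumes f': "(f has_derivative f') (at z)" "\<And>c v. f' (c *s v) = c * f' v"
  shows "((\<lambda>t. f (z + axis j t)) has_field_derivative f' (axis j 1)) (at 0)"
proof -
  have "((\<lambda>t. z + axis j t) has_derivative (\<lambda>t. axis j t)) (at 0)"
    by (auto intro!: derivative_eq_intros bounded_linear.has_derivative[OF bounded_linear_axis])
  then have "((\<lambda>t. f (z + axis j t)) has_derivative (\<lambda>t. f' (axis j t))) (at 0)"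
    using has_derivative_compose[of "\<lambda>t. z + axis j t" "axis j" 0 UNIV f f'] f'(1)
    by (simp add: axis_zero)
  moreover have "(\<lambda>t. f' (axis j t)) = (*) (f' (axis j 1))"
  proof
    fix t
    have "axis j t = t *s (axis j 1 :: complex^'n)" by (simp add: vec_eq_iff axis_def)
    then have "f' (axis j t) = t * f' (axis j 1)" by (simp only: f'(2))
    then show "f' (axis j t) = f' (axis j 1) * t" by (simp only: mult.commute)
  qed
  ultimately show ?thesis unfolding has_field_derivative_def by (simp only:)
qed

lemma holomorphic_fns_osgood:
  assumes f: "f \<in> holomorphic_fns U" shows "f \<in> osgood U"
proof -
  have "(\<lambda>t. f (z + axis j t)) field_differentiable at 0" if "z \<in> U" for z j
    using f that has_derivative_slice[of f] unfolding holomorphic_fns_def field_differentiable_def by blast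
  moreover have "continuous_on U f"
    using f unfolding holomorphic_fns_def
    by (blast intro: continuous_at_imp_continuous_on has_derivative_continuous)
  ultimately show ?thesis using f by (auto simp: osgood_def holomorphic_fns_def)
qed

lemma slice_coordinate_deriv:
  "((\<lambda>t. (z + axis j t) $ k) has_field_derivative (if j = k then 1 else 0)) (at (0 :: complex))"
  by (auto simp: axis_def intro!: derivative_eq_intros)

lemma osgood_x_fn:
  fixes f :: "complex^'n::finite \<Rightarrow> complex"
  assumes f: "f \<in> osgood U"
  shows "x_fn k f \<in> osgood U"
    and "d_fn U j (x_fn k f) = (\<lambda>z. x_fn k (d_fn U j f) z + (if j = k then f z else 0))"
proof -
  have der: "((\<lambda>t. x_fn k f (z + axis j t)) has_field_derivative
      x_fn k (d_fn U j f) z + (if j = k then f z else 0)) (at 0)" if "z \<in> U" for z j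
    unfolding x_fn_def
    by (rule DERIV_cong[OF DERIV_mult[OF slice_coordinate_deriv slice_deriv_0[OF f that]]])
      (simp add: axis_zero)
  then show "x_fn k f \<in> osgood U"
    using f by (auto simp: osgood_def x_fn_def field_differentiable_def intro!: continuous_intros)
  show "d_fn U j (x_fn k f) = (\<lambda>z. x_fn k (d_fn U j f) z + (if j = k then f z else 0))"
  proof
    fix z
    show "d_fn U j (x_fn k f) z = x_fn k (d_fn U j f) z + (if j = k then f z else 0)"
      using d_fn_eqI[of z U, OF _ der[of z j]] f by (cases "z \<in> U") (auto simp: d_fn_def x_fn_def osgood_def)
  qed
qed

lemma osgood_add:
  assumes f: "f \<in> osgood U" and g: "g \<in> osgood U"
  shows "(\<lambda>z. f z + g z) \<in> osgood U" "d_fn U j (\<lambda>z. f z + g z) = (\<lambda>z. d_fn U j f z + d_fn U j g z)"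
proof -
  have der: "((\<lambda>t. f (z + axis j t) + g (z + axis j t)) has_field_derivative d_fn U j f z + d_fn U j g z) (at 0)"
    if "z \<in> U" for z j
    by (intro DERIV_add slice_deriv_0 f g that)
  then show "(\<lambda>z. f z + g z) \<in> osgood U"
    using f g by (auto simp: osgood_def field_differentiable_def intro!: continuous_intros)
  show "d_fn U j (\<lambda>z. f z + g z) = (\<lambda>z. d_fn U j f z + d_fn U j g z)"
  proof
    fix z show "d_fn U j (\<lambda>z. f z + g z) z = d_fn U j f z + d_fn U j g z"
      using d_fn_eqI[of z U, OF _ der[of z j]] by (cases "z \<in> U") (auto simp: d_fn_def)
  qed
qed

lemma osgood_scale:
  assumes f: "f \<in> osgood U"
  shows "(\<lambda>z. a * f z) \<in> osgood U" "d_fn U j (\<lambda>z. a * f z) = (\<lambda>z. a * d_fn U j f z)"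
proof -
  have der: "((\<lambda>t. a * f (z + axis j t)) has_field_derivative a * d_fn U j f z) (at 0)"
    if "z \<in> U" for z j
    by (intro DERIV_cmult slice_deriv_0 f that)
  then show "(\<lambda>z. a * f z) \<in> osgood U"
    using f by (auto simp: osgood_def field_differentiable_def intro!: continuous_intros)
  show "d_fn U j (\<lambda>z. a * f z) = (\<lambda>z. a * d_fn U j f z)"
  proof
    fix z show "d_fn U j (\<lambda>z. a * f z) z = a * d_fn U j f z"
      using d_fn_eqI[of z U, OF _ der[of z j]] by (cases "z \<in> U") (auto simp: d_fn_def)
  qed
qed

lemma weyl_module_osgood:
  fixes U :: "(complex^'n::{finite,linorder}) set"
  assumes U: "open U"
  shows "weyl_module (osgood U) x_fn (d_fn U)"
proof unfold_locales
  show "(\<lambda>z. 0) \<in> osgood U"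
    by (auto simp: osgood_def field_differentiable_def intro: DERIV_const)
qed (simp_all add: osgood_add osgood_scale osgood_x_fn d_fn_osgood[OF U] d_fn_commute[OF U],
     simp_all add: x_fn_def algebra_simps)

section \<open>Power functions\<close>

lemma log_branch_nonzero: "log_branch_domain U \<L> \<Longrightarrow> z \<in> U \<Longrightarrow> z $ j \<noteq> 0"
  unfolding log_branch_domain_def by (metis exp_not_eq_zero)

text \<open>Only continuity of the branch is given. Its difference from the principal branch centred
  at \<open>z0\<close> is continuous, vanishes at \<open>z0\<close> and is an integer multiple of
  \<open>2 pi i\<close>, so it is 0 wherever its norm is below 1.\<close>

lemma log_branch_local:
  fixes U :: "(complex^'n::finite) set"
  assumes L: "log_branch_domain U \<L>" and z0: "z0 \<in> U"
  shows "\<forall>\<^sub>F z in nhds z0. \<L> z $ k = \<L> z0 $ k + Ln (z $ k / z0 $ k)"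
proof -
  have U: "open U" and cont: "continuous_on U \<L>" and ex: "\<And>z j. z \<in> U \<Longrightarrow> exp (\<L> z $ j) = z $ j"
    using L by (auto simp: log_branch_domain_def)
  have nz: "z0 $ k \<noteq> 0" by (rule log_branch_nonzero[OF L z0])
  let ?h = "\<lambda>z. \<L> z $ k - \<L> z0 $ k - Ln (z $ k / z0 $ k)"
  have "isCont \<L> z0" using cont U z0 by (simp add: continuous_on_eq_continuous_at)
  then have "isCont ?h z0"
    using nz by (intro continuous_intros isCont_Ln') auto
  then have "(?h \<longlongrightarrow> ?h z0) (nhds z0)"
    unfolding continuous_at by (rule tendsto_at_iff_tendsto_nhds[THEN iffD1])
  then have "(?h \<longlongrightarrow> 0) (nhds z0)" using nz by simp
  then have "\<forall>\<^sub>F z in nhds z0. norm (?h z) < 1"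
    using tendstoD[of ?h 0 "nhds z0" 1] by simp
  moreover have "\<forall>\<^sub>F z in nhds z0. z \<in> U" using U z0 by (rule eventually_nhds_in_open)
  ultimately show ?thesis
  proof eventually_elim
    case (elim z)
    have "z $ k \<noteq> 0" by (rule log_branch_nonzero[OF L elim(2)])
    then have "exp (?h z) = 1"
      using nz by (simp add: exp_diff ex[OF elim(2)] ex[OF z0])
    then obtain n :: int where n: "Re (?h z) = 0" "Im (?h z) = of_int (2 * n) * pi"
      unfolding exp_eq_1 by auto
    have "\<bar>of_int (2 * n) * pi\<bar> < 1" using elim(1) abs_Im_le_cmod[of "?h z"] n(2) by linarith
    then have "\<bar>2 * real_of_int n * pi\<bar> < 1" by simp
    have "n = 0"
    proof (rule ccontr)
      assume "n \<noteq> 0"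
      then have "1 \<le> \<bar>real_of_int n\<bar>" by linarith
      then have "1 * pi \<le> \<bar>real_of_int n\<bar> * pi" by (intro mult_right_mono) auto
      moreover have "2 * (\<bar>real_of_int n\<bar> * pi) < 1" using \<open>\<bar>2 * real_of_int n * pi\<bar> < 1\<close> by (simp add: abs_mult)
      ultimately show False using pi_gt3 by linarith
    qed
    then have "?h z = 0" using n by (simp add: complex_eq_iff)
    then show ?case by (simp add: algebra_simps)
  qed
qed

lemma xpow_has_derivative:
  fixes U :: "(complex^'n::finite) set"
  assumes L: "log_branch_domain U \<L>" and z0: "z0 \<in> U"
  shows "(xpow_on U \<L> u has_derivative (\<lambda>h. xpow \<L> u z0 * (\<Sum>k\<in>UNIV. u $ k * (h $ k / z0 $ k)))) (at z0)"
proof -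
  have nz: "z0 $ k \<noteq> 0" for k by (rule log_branch_nonzero[OF L z0])
  let ?G = "\<lambda>z. \<Sum>k\<in>UNIV. u $ k * (\<L> z0 $ k + Ln (z $ k / z0 $ k))"
  have "((\<lambda>z. Ln (z $ k / z0 $ k)) has_derivative (\<lambda>h. h $ k / z0 $ k)) (at z0)" for k
  proof -
    have "((\<lambda>w. Ln (w / z0 $ k)) has_field_derivative 1 / z0 $ k) (at (z0 $ k))"
      using nz by (auto intro!: derivative_eq_intros)
    then have "((\<lambda>w. Ln (w / z0 $ k)) has_derivative (*) (1 / z0 $ k)) (at (z0 $ k))"
      by (simp only: has_field_derivative_def)
    from has_derivative_compose[OF bounded_linear.has_derivative[OF bounded_linear_vec_nth has_derivative_ident] this]
    show ?thesis by simp
  qed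
  then have "(?G has_derivative (\<lambda>h. \<Sum>k\<in>UNIV. u $ k * (h $ k / z0 $ k))) (at z0)"
    by (auto intro!: derivative_eq_intros simp: nz)
  moreover have "(exp has_derivative (*) (exp (?G z0))) (at (?G z0))"
    using DERIV_exp[of "?G z0"] by (simp only: has_field_derivative_def)
  ultimately have der: "((\<lambda>z. exp (?G z)) has_derivative (\<lambda>h. exp (?G z0) * (\<Sum>k\<in>UNIV. u $ k * (h $ k / z0 $ k)))) (at z0)"
    by (rule has_derivative_compose)
  have ev: "\<forall>\<^sub>F z in nhds z0. exp (?G z) = xpow_on U \<L> u z"
  proof -
    have "\<forall>\<^sub>F z in nhds z0. \<forall>k. \<L> z $ k = \<L> z0 $ k + Ln (z $ k / z0 $ k)"
      by (rule eventually_all_finite) (rule log_branch_local[OF L z0])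
    moreover have "\<forall>\<^sub>F z in nhds z0. z \<in> U"
      using L z0 by (auto simp: log_branch_domain_def intro: eventually_nhds_in_open)
    ultimately show ?thesis
      by eventually_elim (simp add: xpow_on_def xpow_def)
  qed
  then have "\<forall>\<^sub>F z in at z0. exp (?G z) = xpow_on U \<L> u z"
    unfolding eventually_at_filter by (rule eventually_mono) simp
  from has_derivative_transform_eventually[OF der this eventually_nhds_x_imp_x[OF ev]]
  have "(xpow_on U \<L> u has_derivative (\<lambda>h. exp (?G z0) * (\<Sum>k\<in>UNIV. u $ k * (h $ k / z0 $ k)))) (at z0)"
    by simp
  moreover have "exp (?G z0) = xpow \<L> u z0" by (simp add: xpow_def nz)
  ultimately show ?thesis by (simp only:)
qed

lemma xpow_holomorphic:
  fixes U :: "(complex^'n::finite) set"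
  assumes L: "log_branch_domain U \<L>"
  shows "xpow_on U \<L> u \<in> holomorphic_fns U"
proof -
  have "\<exists>f'. (xpow_on U \<L> u has_derivative f') (at z) \<and> (\<forall>c v. f' (c *s v) = c * f' v)" if z: "z \<in> U" for z
    using xpow_has_derivative[OF L z, of u]
    by (intro exI[of _ "\<lambda>h. xpow \<L> u z * (\<Sum>k\<in>UNIV. u $ k * (h $ k / z $ k))"])
      (auto simp: sum_distrib_left mult_ac)
  then show ?thesis by (auto simp: holomorphic_fns_def xpow_on_def)
qed

lemma xpow_slice_deriv:
  fixes U :: "(complex^'n::finite) set"
  assumes L: "log_branch_domain U \<L>" and z: "z \<in> U"
  shows "((\<lambda>t. xpow_on U \<L> u (z + axis j t)) has_field_derivative u $ j / z $ j * xpow_on U \<L> u z) (at 0)"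
proof -
  have "(\<Sum>k\<in>UNIV. u $ k * ((axis j 1 :: complex^'n) $ k / z $ k)) = (\<Sum>k\<in>UNIV. if k = j then u $ j / z $ j else 0)"
    by (rule sum.cong) (auto simp: axis_def)
  then have *: "xpow \<L> u z * (\<Sum>k\<in>UNIV. u $ k * ((axis j 1 :: complex^'n) $ k / z $ k)) = u $ j / z $ j * xpow_on U \<L> u z"
    using z by (simp add: xpow_on_def)
  have "((\<lambda>t. xpow_on U \<L> u (z + axis j t)) has_field_derivative
      xpow \<L> u z * (\<Sum>k\<in>UNIV. u $ k * ((axis j 1 :: complex^'n) $ k / z $ k))) (at 0)"
    by (rule has_derivative_slice[OF xpow_has_derivative[OF L z]]) (simp add: sum_distrib_left mult_ac)
  then show ?thesis unfolding * .
qed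

lemma x_d_xpow:
  assumes L: "log_branch_domain U \<L>"
  shows "x_fn j (d_fn U j (xpow_on U \<L> u)) = (\<lambda>z. u $ j * xpow_on U \<L> u z)"
proof
  fix z
  show "x_fn j (d_fn U j (xpow_on U \<L> u)) z = u $ j * xpow_on U \<L> u z"
    using d_fn_eqI[OF _ xpow_slice_deriv[OF L]] log_branch_nonzero[OF L, of z j]
    by (cases "z \<in> U") (auto simp: x_fn_def, auto simp: d_fn_def xpow_on_def)
qed

section \<open>Joint eigenfunctions of the operators \<theta>\<close>

text \<open>Only derivatives along the axes are known, so inside a polydisc around \<open>z0\<close>
  the coordinates are changed one at a time. Connectedness turns local constancy into global
  constancy.\<close>

lemma constant_if_slices_constant:
  fixes U :: "(complex^'n::finite) set" and g :: "complex^'n \<Rightarrow> complex"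
  assumes U: "open U" "connected U"
    and der: "\<And>z j. z \<in> U \<Longrightarrow> ((\<lambda>t. g (z + axis j t)) has_field_derivative 0) (at 0)"
    and "a \<in> U" "b \<in> U"
  shows "g a = g b"
proof (rule connected_local_const[OF U(2) \<open>a \<in> U\<close> \<open>b \<in> U\<close>], intro ballI)
  fix z0 assume z0: "z0 \<in> U"
  obtain S where S: "\<And>i. open (S i)" "\<And>i. z0 $ i \<in> S i" "\<And>y. (\<And>i. y $ i \<in> S i) \<Longrightarrow> y \<in> U"
    using U(1) z0 unfolding open_vec_def by metis
  have "\<forall>i. \<exists>e>0. ball (z0 $ i) e \<subseteq> S i" using S(1,2) openE by metis
  then obtain e where e: "\<And>i. e i > 0" "\<And>i. ball (z0 $ i) (e i) \<subseteq> S i" by metis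
  have const: "g z0 = g z" if z: "\<And>i. z $ i \<in> ball (z0 $ i) (e i)" for z
  proof -
    have "g (\<chi> i. if i \<in> I then z $ i else z0 $ i) = g z0" if "finite I" for I
      using that
    proof induction
      case (insert j I)
      let ?p = "\<chi> i. if i \<in> I then z $ i else z0 $ i"
      have inU: "?p + axis j s \<in> U" if "s \<in> ball 0 (e j)" for s
      proof (rule S(3))
        fix i show "(?p + axis j s) $ i \<in> S i"
          using that z[of i] S(2)[of i] insert.hyps(2) e(2)[of i] by (auto simp: axis_def dist_norm subset_eq)
      qed
      have "((\<lambda>s. g (?p + axis j s)) has_field_derivative 0) (at s within ball 0 (e j))" if "s \<in> ball 0 (e j)" for s
      proof -
        have "((\<lambda>t. g (?p + axis j (t + s))) has_field_derivative 0) (at 0)"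
          using der[OF inU[OF that], of j] by (simp add: axis_plus add_ac)
        then have "((\<lambda>s. g (?p + axis j s)) has_field_derivative 0) (at s)"
          using DERIV_shift[of "\<lambda>s. g (?p + axis j s)" 0 0 s] by simp
        then show ?thesis by (rule has_field_derivative_at_within)
      qed
      then obtain c where c: "\<And>s. s \<in> ball 0 (e j) \<Longrightarrow> g (?p + axis j s) = c"
        using has_field_derivative_zero_constant[of "ball 0 (e j)" "\<lambda>s. g (?p + axis j s)"] by auto
      have "(\<chi> i. if i \<in> insert j I then z $ i else z0 $ i) = ?p + axis j (z $ j - z0 $ j)"
        using insert.hyps(2) by (auto simp: vec_eq_iff axis_def)
      moreover have "z $ j - z0 $ j \<in> ball 0 (e j)" using z[of j] by (simp add: dist_norm norm_minus_commute)
      ultimately have "g (\<chi> i. if i \<in> insert j I then z $ i else z0 $ i) = g (?p + axis j 0)"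
        using c c[of 0] e(1)[of j] by simp
      then show ?case using insert.IH by (simp add: axis_zero)
    qed simp
    from this[of UNIV] show ?thesis by simp
  qed
  have "\<forall>\<^sub>F z in nhds z0. \<forall>i. z $ i \<in> ball (z0 $ i) (e i)"
  proof (rule eventually_all_finite)
    fix i
    have "((\<lambda>z. z $ i) \<longlongrightarrow> z0 $ i) (nhds z0)" by (intro tendsto_vec_nth filterlim_ident)
    then show "\<forall>\<^sub>F z in nhds z0. z $ i \<in> ball (z0 $ i) (e i)"
      by (rule topological_tendstoD) (use e(1) in auto)
  qed
  then show "\<forall>\<^sub>F z in at z0 within U. g z0 = g z"
    unfolding eventually_at_filter by (rule eventually_mono) (use const in auto)
qed

text \<open>Multiplied by the power function with exponent \<open>- v\<close>, which has no zeros on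
  \<open>U\<close>, \<open>f\<close> has derivative 0 along every axis and is therefore constant on
  \<open>U\<close>.\<close>

lemma euler_eigenfunction:
  fixes U :: "(complex^'n::finite) set"
  assumes L: "log_branch_domain U \<L>" and f: "f \<in> osgood U"
    and eig: "\<And>j. x_fn j (d_fn U j f) = (\<lambda>z. v $ j * f z)"
  shows "\<exists>c. f = (\<lambda>z. c * xpow_on U \<L> v z)"
proof -
  have U: "open U" "connected U" "U \<noteq> {}"
    using L by (auto simp: log_branch_domain_def intro: simply_connected_imp_connected)
  obtain z0 where z0: "z0 \<in> U" using U(3) by auto
  let ?g = "\<lambda>z. f z * xpow_on U \<L> (- v) z"
  have "((\<lambda>t. ?g (z + axis j t)) has_field_derivative 0) (at 0)" if z: "z \<in> U" for z j
  proof (rule DERIV_cong[OF DERIV_mult[OF slice_deriv_0[OF f z] xpow_slice_deriv[OF L z]]])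
    have nz: "z $ j \<noteq> 0" by (rule log_branch_nonzero[OF L z])
    have "z $ j * d_fn U j f z = v $ j * f z" using eig[of j] by (simp add: x_fn_def fun_eq_iff)
    then have "d_fn U j f z = v $ j * f z / z $ j" using nz by (simp add: field_simps)
    then show "d_fn U j f z * xpow_on U \<L> (- v) (z + axis j 0)
        + (- v) $ j / z $ j * xpow_on U \<L> (- v) z * f (z + axis j 0) = 0"
      by (simp add: axis_zero)
  qed
  then have g: "?g z = ?g z0" if "z \<in> U" for z
    by (intro constant_if_slices_constant[OF U(1,2) _ that z0])
  have "f z = ?g z0 * xpow_on U \<L> v z" for z
  proof (cases "z \<in> U")
    case True
    have "xpow \<L> (- v) z * xpow \<L> v z = 1"
      by (simp add: xpow_def sum_negf flip: exp_add)
    then have "?g z * xpow_on U \<L> v z = f z" using True by (simp add: xpow_on_def mult.assoc)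
    then show ?thesis unfolding g[OF True] by (rule sym)
  next
    case False
    then show ?thesis using f by (simp add: osgood_def xpow_on_def)
  qed
  then show ?thesis by (intro exI[of _ "?g z0"]) (rule ext)
qed

lemma holomorphic_fns_lincomb:
  assumes "finite S" "S \<subseteq> holomorphic_fns U"
  shows "(\<lambda>z. \<Sum>f\<in>S. c f * f z) \<in> holomorphic_fns U"
proof -
  have "\<exists>F'. ((\<lambda>z. \<Sum>f\<in>S. c f * f z) has_derivative F') (at z) \<and> (\<forall>a v. F' (a *s v) = a * F' v)"
    if z: "z \<in> U" for z
  proof -
    have "\<forall>f\<in>S. \<exists>f'. (f has_derivative f') (at z) \<and> (\<forall>a v. f' (a *s v) = a * f' v)"
      using assms(2) z by (auto simp: holomorphic_fns_def)
    then obtain D where D: "\<And>f. f \<in> S \<Longrightarrow> (f has_derivative D f) (at z)"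
      "\<And>f a v. f \<in> S \<Longrightarrow> D f (a *s v) = a * D f v" by metis
    have "((\<lambda>z. \<Sum>f\<in>S. c f * f z) has_derivative (\<lambda>h. \<Sum>f\<in>S. c f * D f h)) (at z)"
      by (intro has_derivative_sum has_derivative_mult_right D)
    moreover have "(\<Sum>f\<in>S. c f * D f (a *s v)) = a * (\<Sum>f\<in>S. c f * D f v)" for a v
      by (simp add: D(2) sum_distrib_left mult_ac)
    ultimately show ?thesis by (intro exI[of _ "\<lambda>h. \<Sum>f\<in>S. c f * D f h"]) auto
  qed
  moreover have "(\<Sum>f\<in>S. c f * f z) = 0" if "z \<notin> U" for z
    using assms(2) that by (intro sum.neutral) (auto simp: holomorphic_fns_def)
  ultimately show ?thesis by (auto simp: holomorphic_fns_def)
qed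

text \<open>Coefficients in \<open>cspan\<close> are indexed by functions, so those of all
  \<open>v\<close> with the same \<open>g v\<close> are first added up.\<close>

lemma lincomb_in_cspan:
  assumes V: "finite V" "V \<subseteq> E"
  shows "(\<lambda>z. \<Sum>v\<in>V. a v * g v z) \<in> cspan (g ` E)"
proof -
  have "(\<Sum>v\<in>V. a v * g v z) = (\<Sum>f\<in>g ` V. (\<Sum>v\<in>{v\<in>V. g v = f}. a v) * f z)" for z
    by (subst sum.image_gen[OF V(1), of _ g]) (auto simp: sum_distrib_right intro!: sum.cong)
  then show ?thesis
    unfolding cspan_def using V by (intro CollectI exI[of _ "g ` V"] exI conjI) auto
qed

section \<open>The kernel of the derivation\<close>

lemma hypergeometric_annihilates_iff:
  fixes A :: "int^'n::{finite,linorder}^'d" and U :: "(complex^'n::{finite,linorder}) set"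
  assumes U: "open U" and f: "f \<in> osgood U"
  shows "(\<forall>P\<in>hypergeometric_ideal A \<gamma>. weyl_act x_fn (d_fn U) P f = (\<lambda>z. 0)) \<longleftrightarrow>
    (\<forall>p\<in>toric_ideal A. comm_ops.pact (d_fn U) p f = (\<lambda>z. 0)) \<and>
    (\<forall>i. (\<lambda>z. (\<Sum>j\<in>UNIV. of_int (A $ i $ j) * x_fn j (d_fn U j f) z) - \<gamma> $ i * f z) = (\<lambda>z. 0))"
proof -
  interpret weyl_module "osgood U" x_fn "d_fn U" by (rule weyl_module_osgood[OF U])
  let ?G = "weyl_of_dpoly ` toric_ideal A \<union> range (euler_op A \<gamma>)"
  have "(\<forall>P\<in>hypergeometric_ideal A \<gamma>. weyl_act x_fn (d_fn U) P f = (\<lambda>z. 0)) \<longleftrightarrow>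
    (\<forall>P\<in>?G. weyl_act x_fn (d_fn U) P f = (\<lambda>z. 0))"
    unfolding hypergeometric_ideal_def
    using weyl_left_ideal.gen[of _ ?G] weyl_left_ideal_annihilates[OF f, of ?G] by blast
  then show ?thesis by (simp add: ball_Un weyl_act_of_dpoly weyl_act_euler_op)
qed

locale toric_log_domain = generic_toric A p1
  for A :: "int^'n::{finite,linorder}^'d::finite" and p1 :: "'n::{finite,linorder}" +
  fixes U :: "(complex^'n::{finite,linorder}) set"
    and \<L> :: "complex^'n::{finite,linorder} \<Rightarrow> complex^'n::{finite,linorder}"
  assumes branch: "log_branch_domain U \<L>"
begin

sublocale tc: toric_coordinate_ring A p1 "\<lambda>j. dmonom (axis j 1)" "Poly_Mapping.single 0"
  by unfold_locales

lemma open_U: "open U"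
  using branch by (simp add: log_branch_domain_def)

sublocale w: weyl_module "osgood U" x_fn "d_fn U"
  by (rule weyl_module_osgood[OF open_U])

lemma xpow_osgood: "xpow_on U \<L> v \<in> osgood U"
  by (rule holomorphic_fns_osgood[OF xpow_holomorphic[OF branch]])

lemma theta_xpow: "w.theta j (xpow_on U \<L> v) = (\<lambda>z. v $ j * xpow_on U \<L> v z)"
  unfolding w.theta_def by (rule x_d_xpow[OF branch])

lemma multi_pow_x_zero_cancel:
  assumes h: "h \<in> osgood U" "multi_pow x_fn a h = (\<lambda>z. 0)"
  shows "h = (\<lambda>z. 0)"
proof
  fix z
  have "h z = 0" if "z \<in> U" "multi_pow x_fn a h z = 0"
    using that(2)
  proof (induction a rule: nat_vec_induct)
    case zero then show ?case by (simp add: w.x.multi_pow_zero)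
  next
    case (plus_axis a j)
    have "multi_pow x_fn (a + axis j 1) h z = z $ j * multi_pow x_fn a h z"
      by (simp only: w.x.multi_pow_plus_axis[OF h(1)] x_fn_def[of j "multi_pow x_fn a h"])
    then show ?case using plus_axis log_branch_nonzero[OF branch that(1), of j] by simp
  qed
  then show "h z = 0" using h by (cases "z \<in> U") (auto simp: osgood_def)
qed

lemma d_xpow_zero:
  assumes v: "v $ p1 = 0" shows "d_fn U p1 (xpow_on U \<L> v) = (\<lambda>z. 0)"
proof (rule multi_pow_x_zero_cancel[of _ "axis p1 1"])
  show "d_fn U p1 (xpow_on U \<L> v) \<in> osgood U" by (rule w.d.T_H[OF xpow_osgood])
  show "multi_pow x_fn (axis p1 1) (d_fn U p1 (xpow_on U \<L> v)) = (\<lambda>z. 0)"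
    using x_d_xpow[OF branch, of p1 v] by (simp add: w.x.multi_pow_axis v)
qed

text \<open>If \<open>b\<close> involves \<open>p1\<close>, already \<partial>_1 kills the function.
  Otherwise \<open>x^b \<partial>^b\<close> acts as multiplication by the value of
  \<open>ffact b\<close> at \<open>v\<close>, which is 0, and \<open>x^b\<close> has no zeros on
  \<open>U\<close>.\<close>

lemma monomial_xpow_zero:
  assumes v: "v \<in> tc.exponents \<gamma>" and b: "b $ p1 \<noteq> 0 \<or> b \<in> N"
  shows "multi_pow (d_fn U) b (xpow_on U \<L> v) = (\<lambda>z. 0)"
proof (cases "b $ p1 = 0")
  case False
  then show ?thesis
    using v by (intro w.d.multi_pow_eq_0[OF xpow_osgood d_xpow_zero]) (auto simp: tc.exponents_def)
next
  case True
  then obtain i n where i: "v $ i = of_nat n" "n < b $ i" using v b by (auto simp: tc.exponents_def)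
  have ev: "dpoly_eval (dmonom (axis j 1) - Poly_Mapping.single 0 s) v = v $ j - s" for j s
  proof -
    have "dpoly_eval (dmonom (axis j 1) - Poly_Mapping.single 0 s) v + dpoly_eval (Poly_Mapping.single 0 s) v = v $ j"
      by (simp only: dpoly_eval_add[symmetric] diff_add_cancel dpoly_eval_X)
    then show ?thesis by (simp add: dpoly_eval_single algebra_simps)
  qed
  have "\<exists>x\<in>Sigma UNIV (\<lambda>i. {..<b $ i}).
      dpoly_eval (case x of (i, k) \<Rightarrow> dmonom (axis i 1) - Poly_Mapping.single 0 (of_nat k)) v = 0"
    by (rule bexI[of _ "(i, n)"]) (simp only: prod.case ev i(1) diff_self, use i(2) in simp)
  then have "dpoly_eval (dp.ffact b) v = 0"
    unfolding dp.ffact_def dpoly_eval_prod by (intro prod_zero) simp_all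
  then have "w.th.pact (dp.ffact b) (xpow_on U \<L> v) = (\<lambda>z. 0)"
    by (simp add: w.th.pact_eigen[OF xpow_osgood theta_xpow])
  then show ?thesis
    unfolding w.ffact_theta[OF xpow_osgood]
    by (rule multi_pow_x_zero_cancel[OF w.d.multi_pow_H[OF xpow_osgood]])
qed

text \<open>A term of a nonzero binomial that avoids \<open>p1\<close> has a second point in its
  fiber and so lies in \<open>N\<close>. Hence both terms of each generator kill the function, and
  annihilators are ideals.\<close>

lemma toric_ideal_xpow:
  assumes v: "v \<in> tc.exponents \<gamma>" and p: "p \<in> toric_ideal A"
  shows "w.d.pact p (xpow_on U \<L> v) = (\<lambda>z. 0)"
proof -
  obtain G where G: "G \<subseteq> toric_binomials A" "genideal dring G = toric_ideal A" "\<And>g. g \<in> G \<Longrightarrow> dvars g = UNIV"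
    using generic unfolding generic_toric_ideal_def by auto
  have "w.d.pact g (xpow_on U \<L> v) = (\<lambda>z. 0)" if g: "g \<in> G" for g
  proof -
    obtain a b where ab: "g = dmonom a - dmonom b" "A *v nat_ivec a = A *v nat_ivec b"
      using g G(1) by (auto simp: toric_binomials_def)
    show ?thesis
    proof (cases "a = b")
      case True then show ?thesis by (simp add: ab w.d.pact_null)
    next
      case False
      have "a $ p1 \<noteq> 0 \<or> a \<in> N" "b $ p1 \<noteq> 0 \<or> b \<in> N"
        using nontrivial_fiber[OF _ False ab(2)] nontrivial_fiber[OF _ False[symmetric] ab(2)[symmetric]] by auto
      then show ?thesis by (simp add: ab w.d.pact_diff w.d.pact_single monomial_xpow_zero[OF v])
    qed
  qed
  then have "genideal dring G \<subseteq> {p. w.d.pact p (xpow_on U \<L> v) = (\<lambda>z. 0)}"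
    by (intro genideal_dring_least w.d.ideal_set_annihilator xpow_osgood) auto
  then show ?thesis using p G(2) by auto
qed

lemma xpow_in_Sol:
  assumes v: "v \<in> tc.exponents \<gamma>" shows "xpow_on U \<L> v \<in> Sol A U \<gamma>"
proof -
  have "(\<Sum>j\<in>UNIV. of_int (A $ i $ j) * x_fn j (d_fn U j (xpow_on U \<L> v)) z) = \<gamma> $ i * xpow_on U \<L> v z" for i z
  proof -
    have "\<gamma> $ i = (\<Sum>j\<in>UNIV. of_int (A $ i $ j) * v $ j)"
      using v by (auto simp: tc.exponents_def matrix_vector_mult_def map_matrix_def)
    then show ?thesis by (simp add: x_d_xpow[OF branch] sum_distrib_right mult.assoc)
  qed
  then show ?thesis
    unfolding Sol_def using xpow_holomorphic[OF branch] toric_ideal_xpow[OF v]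
    by (simp add: hypergeometric_annihilates_iff[OF open_U xpow_osgood])
qed

lemma cspan_xpow_subset_kernel:
  "cspan (xpow_on U \<L> ` tc.exponents \<gamma>) \<subseteq> {\<phi> \<in> Sol A U \<gamma>. d_fn U p1 \<phi> = (\<lambda>z. 0)}"
proof
  fix \<phi> assume "\<phi> \<in> cspan (xpow_on U \<L> ` tc.exponents \<gamma>)"
  then obtain S c where \<phi>: "\<phi> = (\<lambda>z. \<Sum>f\<in>S. c f * f z)" "finite S" "S \<subseteq> xpow_on U \<L> ` tc.exponents \<gamma>"
    by (auto simp: cspan_def)
  have S: "f \<in> Sol A U \<gamma>" "d_fn U p1 f = (\<lambda>z. 0)" if "f \<in> S" for f
    using \<phi>(3) that xpow_in_Sol d_xpow_zero by (auto simp: tc.exponents_def)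
  then have hol: "S \<subseteq> holomorphic_fns U" by (auto simp: Sol_def)
  then have os: "f \<in> osgood U" if "f \<in> S" for f using that holomorphic_fns_osgood by auto
  have "weyl_act x_fn (d_fn U) P \<phi> = (\<lambda>z. 0)" if "P \<in> hypergeometric_ideal A \<gamma>" for P
  proof -
    have "weyl_act x_fn (d_fn U) P \<phi> = (\<lambda>z. \<Sum>f\<in>S. c f * weyl_act x_fn (d_fn U) P f z)"
      unfolding \<phi>(1) by (rule w.weyl_act_lincomb[of S "\<lambda>f. f" P c, OF os])
    then show ?thesis using S(1) that by (simp add: Sol_def)
  qed
  moreover have "\<phi> \<in> holomorphic_fns U" unfolding \<phi>(1) by (rule holomorphic_fns_lincomb[OF \<phi>(2) hol])
  moreover have "d_fn U p1 \<phi> = (\<lambda>z. 0)"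
    using w.d.multi_pow_lincomb[of S "\<lambda>f. f" "axis p1 1" c, OF os] S(2)
    by (simp add: w.d.multi_pow_axis \<phi>(1))
  ultimately show "\<phi> \<in> {\<phi> \<in> Sol A U \<gamma>. d_fn U p1 \<phi> = (\<lambda>z. 0)}" by (simp add: Sol_def)
qed

lemma kernel_init_form:
  assumes \<phi>: "\<phi> \<in> osgood U" "d_fn U p1 \<phi> = (\<lambda>z. 0)" and p: "w.d.pact p \<phi> = (\<lambda>z. 0)"
  shows "w.d.pact (init_form (- axis p1 1) p) \<phi> = (\<lambda>z. 0)"
proof -
  let ?w = "- axis p1 1 :: real^'n::{finite,linorder}"
  let ?S = "{u \<in> Poly_Mapping.keys p. \<forall>v\<in>Poly_Mapping.keys p. weight ?w v \<le> weight ?w u}"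
  let ?t = "\<lambda>z u. Poly_Mapping.lookup p u * multi_pow (d_fn U) u \<phi> z"
  have w: "weight ?w u = - real (u $ p1)" for u
    by (simp add: weight_def axis_def if_distrib[of "\<lambda>x. x * _"] if_distrib[of uminus] cong: if_cong)
  have zero: "?t z u = 0" if "u $ p1 \<noteq> 0" for u z
    using w.d.multi_pow_eq_0[OF \<phi> that] by simp
  have "(\<Sum>u\<in>?S. ?t z u) = 0" for z
  \<comment> \<open>In the first case the initial form is the part free of \<partial>_1, and the
    omitted terms kill the function one by one; in the second case every term does.\<close>
  proof (cases "\<exists>k\<in>Poly_Mapping.keys p. k $ p1 = 0")
    case True
    have "u $ p1 \<noteq> 0" if "u \<in> Poly_Mapping.keys p - ?S" for u using that by (auto simp: w)
    then have "(\<Sum>u\<in>?S. ?t z u) = (\<Sum>u\<in>Poly_Mapping.keys p. ?t z u)"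
      by (intro sum.mono_neutral_left ballI zero) auto
    also have "\<dots> = 0" using p by (simp add: w.d.pact_def fun_eq_iff)
    finally show ?thesis .
  next
    case False
    then show ?thesis by (intro sum.neutral ballI zero) auto
  qed
  then show ?thesis
    unfolding init_form_def by (simp add: w.d.pact_sum w.d.pact_single)
qed

lemma kernel_subset_cspan_xpow:
  assumes T: "p1 \<notin> T" "CARD('d) < card T + 3"
    and above: "\<And>v \<mu> C. v \<in> tc.exponents \<gamma> \<Longrightarrow> standard_pair M \<mu> C \<Longrightarrow>
      (\<And>i. i \<notin> C \<Longrightarrow> v $ i = of_nat (\<mu> $ i)) \<Longrightarrow> T \<subseteq> C"
  shows "{\<phi> \<in> Sol A U \<gamma>. d_fn U p1 \<phi> = (\<lambda>z. 0)} \<subseteq> cspan (xpow_on U \<L> ` tc.exponents \<gamma>)"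
proof
  fix \<phi> assume "\<phi> \<in> {\<phi> \<in> Sol A U \<gamma>. d_fn U p1 \<phi> = (\<lambda>z. 0)}"
  then have sol: "\<phi> \<in> Sol A U \<gamma>" and d0: "d_fn U p1 \<phi> = (\<lambda>z. 0)" by auto
  have \<phi>: "\<phi> \<in> osgood U" using sol holomorphic_fns_osgood by (auto simp: Sol_def)
  have toric: "\<And>p. p \<in> toric_ideal A \<Longrightarrow> w.d.pact p \<phi> = (\<lambda>z. 0)"
    and euler: "\<And>i. (\<lambda>z. (\<Sum>j\<in>UNIV. of_int (A $ i $ j) * x_fn j (d_fn U j \<phi>) z) - \<gamma> $ i * \<phi> z) = (\<lambda>z. 0)"
    using sol hypergeometric_annihilates_iff[OF open_U \<phi>, of A \<gamma>] by (auto simp: Sol_def)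
  have "M \<subseteq> {p. w.d.pact p \<phi> = (\<lambda>z. 0)}"
    unfolding M_def init_ideal_def
    using kernel_init_form[OF \<phi> d0 toric] by (intro genideal_dring_least w.d.ideal_set_annihilator \<phi>) auto
  then have N0: "multi_pow (d_fn U) b \<phi> = (\<lambda>z. 0)" if "b \<in> N" for b
    using that by (auto simp: monomial_exps_def w.d.pact_single)
  \<comment> \<open>Here the variables act as the \<open>\<theta>\<^sub>j\<close>, whereas the
    members of \<open>M\<close> above act through the derivations.\<close>
  let ?J = "{p. w.th.pact p \<phi> = (\<lambda>z. 0)}"
  have ri: "tc.restricted_indicial \<gamma> ?J"
    unfolding tc.restricted_indicial_def
  proof (intro conjI allI ballI)
    show "ideal_set ?J" by (rule w.th.ideal_set_annihilator[OF \<phi>])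
    show "dmonom (axis p1 1) \<in> ?J"
      by (simp add: w.th.pact_X w.theta_def d0 w.x.T_zero)
    show "(\<Sum>j\<in>UNIV. Poly_Mapping.single 0 (of_int (A $ r $ j)) * dmonom (axis j 1)) - Poly_Mapping.single 0 (\<gamma> $ r) \<in> ?J" for r
      using euler[of r]
      by (simp only: mem_Collect_eq w.th.pact_diff w.th.pact_sum w.th.pact_mult[OF \<phi>] w.th.pact_X w.th.pact_const
          w.theta_def)
    show "dp.ffact b \<in> ?J" if "b \<in> N" for b
      by (simp add: w.ffact_theta[OF \<phi>] N0[OF that] w.x.multi_pow_null)
  qed
  obtain V e where V: "finite V" "V \<subseteq> tc.exponents \<gamma>" "(\<Sum>v\<in>V. e v) - 1 \<in> ?J"
    "\<And>v j. v \<in> V \<Longrightarrow> (dmonom (axis j 1) - Poly_Mapping.single 0 (v $ j)) * e v \<in> ?J"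
  proof (rule tc.indicial_partition_of_unity[OF ri T])
    show "T \<subseteq> C" if v: "v \<in> tc.exponents \<gamma>" and sp: "standard_pair M \<mu> C"
      and \<mu>: "\<And>i. i \<notin> C \<Longrightarrow> v $ i = of_nat (\<mu> $ i)" for v \<mu> C
      by (rule above[OF v sp \<mu>])
  qed (rule that)
  have "\<exists>c. w.th.pact (e v) \<phi> = (\<lambda>z. c * xpow_on U \<L> v z)" if v: "v \<in> V" for v
  proof (rule euler_eigenfunction[OF branch w.th.pact_H[OF \<phi>]])
    fix j
    have "(\<lambda>z. w.theta j (w.th.pact (e v) \<phi>) z - v $ j * w.th.pact (e v) \<phi> z) = (\<lambda>z. 0)"
      using V(4)[OF v, of j]
      by (simp only: mem_Collect_eq w.th.pact_mult[OF \<phi>] w.th.pact_diff w.th.pact_X w.th.pact_const)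
    then show "x_fn j (d_fn U j (w.th.pact (e v) \<phi>)) = (\<lambda>z. v $ j * w.th.pact (e v) \<phi> z)"
      by (simp add: fun_eq_iff w.theta_def)
  qed
  then have "\<exists>a. \<forall>v\<in>V. w.th.pact (e v) \<phi> = (\<lambda>z. a v * xpow_on U \<L> v z)" by metis
  then obtain a where a: "\<And>v. v \<in> V \<Longrightarrow> w.th.pact (e v) \<phi> = (\<lambda>z. a v * xpow_on U \<L> v z)" by blast
  have "\<phi> = (\<lambda>z. \<Sum>v\<in>V. w.th.pact (e v) \<phi> z)"
    using V(3) by (simp add: w.th.pact_diff w.th.pact_sum w.th.pact_1 fun_eq_iff)
  also have "\<dots> = (\<lambda>z. \<Sum>v\<in>V. a v * xpow_on U \<L> v z)"
    using a by (intro ext sum.cong) auto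
  also have "\<dots> \<in> cspan (xpow_on U \<L> ` tc.exponents \<gamma>)"
    by (rule lincomb_in_cspan[OF V(1,2)])
  finally show "\<phi> \<in> cspan (xpow_on U \<L> ` tc.exponents \<gamma>)" .
qed

lemma exponents_eq:
  "{u \<in> {u \<in> fake_exponents A \<gamma> (- axis p1 1). minimal_nsupp A u}. u $ p1 = 0} = tc.exponents \<gamma>"
  using fake_minimal_nsupp by (auto simp: fake_exponents_iff tc.exponents_def)

end

section \<open>The size of \<tau> and the choice of \<alpha>\<close>

lemma inj_on_ix: "inj_on (ix :: nat \<Rightarrow> 'n::{finite,linorder}) {1..CARD('n)}"
proof (rule inj_onI)
  fix i j assume *: "i \<in> {1..CARD('n)}" "j \<in> {1..CARD('n)}" "ix i = (ix j :: 'n)"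
  have "i - 1 = j - 1"
    using *(3) unfolding ix_def
    by (subst (asm) nth_eq_iff_index_eq) (use *(1,2) in auto)
  then show "i = j" using * by auto
qed

theorem theorem5p2:
  fixes A :: "int^'n::{finite,linorder}^'d::{finite,linorder}"
    and B :: "int^'m::finite^'n::{finite,linorder}"
    and \<eta> :: "nat^'n::{finite,linorder}"
  defines "m \<equiv> CARD('m)"
    and "w \<equiv> (- axis (ix 1) 1 :: real^'n::{finite,linorder})"
    and "\<tau> \<equiv> (ix ` {CARD('m) + 3..CARD('n)} :: 'n set)"
  assumes card: "CARD('n) = CARD('d) + m"
    and columns_distinct: "inj (\<lambda>j. column j A)"
    and first_row: "\<And>j. A $ ix 1 $ j = 1"
    and columns_generate: "surj (\<lambda>u. A *v u)"
    and generic: "generic_toric_ideal A"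
    and not_CM: "\<not> cohen_macaulay (dring Quot toric_ideal A)"
    and B_basis: "inj (\<lambda>y. B *v y)" "range (\<lambda>y. B *v y) = {u. A *v u = 0}"
    and embedded: "embedded_standard_pair (init_ideal w (toric_ideal A)) \<eta> (insert (ix 1) \<tau>)"
    and cond_i:
      "bounded {y :: real^'m.
           (\<forall>j\<in>{2..m+2}. (map_matrix of_int B *v y) $ ix j \<le> of_nat (\<eta> $ ix j)) \<and>
           (map_matrix of_int B *v y) $ ix 1 \<ge> 0}
       \<or> (\<exists>r\<in>{2..m+2}. {y :: real^'m. (map_matrix of_int B *v y) $ ix r = 0}
                      = {y :: real^'m. (map_matrix of_int B *v y) $ ix 1 = 0})"
    and cond_ii:
      "\<And>\<mu> (y :: complex^'m) (k :: int).
         standard_pair (init_ideal w (toric_ideal A)) \<mu> (insert (ix 1) \<tau>) \<Longrightarrow>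
         (\<forall>i\<in>{2..m+2}. of_nat (\<mu> $ ix i)
             = of_nat (\<eta> $ ix i) - (map_matrix of_int B *v y) $ ix i) \<Longrightarrow>
         (map_matrix of_int B *v y) $ ix 1 = of_int k \<Longrightarrow> k \<le> 0"
  shows "holds_generically \<tau> (\<lambda>\<alpha>.
    \<forall>U \<L>.
      let \<gamma> = map_matrix of_int A *v (nat_cvec \<eta> + \<alpha>);
          \<beta> = map_matrix of_int A *v (nat_cvec \<eta> + \<alpha> - axis (ix 1) 1);
          F = {u \<in> fake_exponents A \<gamma> w. minimal_nsupp A u};
          K = {u \<in> F. u $ ix 1 = 0}
      in log_branch_domain U \<L> \<and>
         canonical_series_converge A \<gamma> w U \<L> \<and>
         canonical_series_converge A \<beta> w U \<L> \<longrightarrow>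
         {\<phi> \<in> Sol A U \<gamma>. d_fn U (ix 1) \<phi> = (\<lambda>z. 0)} = cspan (xpow_on U \<L> ` K))"
proof -
  interpret generic_toric A "ix 1 :: 'n" by standard (rule generic)
  have "inj_on (ix :: nat \<Rightarrow> 'n) {CARD('m) + 3..CARD('n)}"
    by (rule inj_on_subset[OF inj_on_ix]) auto
  then have "card \<tau> = CARD('n) - (CARD('m) + 2)" by (simp add: \<tau>_def card_image)
  \<comment> \<open>As n = d + m, the cardinality is d - 2 in truncated subtraction, so the strict
    bound also holds for small d.\<close>
  then have card\<tau>: "CARD('d) < card \<tau> + 3" using card by (simp add: m_def)
  have ix1: "ix 1 \<notin> \<tau>"
  proof
    assume "ix 1 \<in> \<tau>"
    then obtain j where "j \<in> {CARD('m) + 3..CARD('n)}" "(ix 1 :: 'n) = ix j" by (auto simp: \<tau>_def)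
    then show False using inj_onD[OF inj_on_ix[where 'n = 'n], of 1 j] by auto
  qed
  show ?thesis
  proof (rule holds_generically_mono[OF generic_standard_pairs_above[OF ix1]], intro allI)
    fix \<alpha> :: "complex^'n::{finite,linorder}"
      and U :: "(complex^'n::{finite,linorder}) set"
      and \<L> :: "complex^'n::{finite,linorder} \<Rightarrow> complex^'n::{finite,linorder}"
    let ?\<gamma> = "map_matrix of_int A *v (nat_cvec \<eta> + \<alpha>)"
    assume above: "\<forall>v \<mu> C. map_matrix of_int A *v v = ?\<gamma> \<longrightarrow> v $ ix 1 = 0 \<longrightarrow>
      standard_pair M \<mu> C \<longrightarrow> (\<forall>i. i \<notin> C \<longrightarrow> v $ i = of_nat (\<mu> $ i)) \<longrightarrow> \<tau> \<subseteq> C"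
    have "{\<phi> \<in> Sol A U ?\<gamma>. d_fn U (ix 1) \<phi> = (\<lambda>z. 0)} =
        cspan (xpow_on U \<L> ` {u \<in> {u \<in> fake_exponents A ?\<gamma> w. minimal_nsupp A u}. u $ ix 1 = 0})"
      if "log_branch_domain U \<L>"
    proof -
      interpret toric_log_domain A "ix 1" U \<L> by standard (rule that)
      show ?thesis
        unfolding w_def exponents_eq
        using above
        by (intro equalityI cspan_xpow_subset_kernel kernel_subset_cspan_xpow[OF ix1 card\<tau>])
          (auto simp: tc.exponents_def)
    qed
    then show "let \<gamma> = map_matrix of_int A *v (nat_cvec \<eta> + \<alpha>);
          \<beta> = map_matrix of_int A *v (nat_cvec \<eta> + \<alpha> - axis (ix 1) 1);
          F = {u \<in> fake_exponents A \<gamma> w. minimal_nsupp A u};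
          K = {u \<in> F. u $ ix 1 = 0}
      in log_branch_domain U \<L> \<and>
         canonical_series_converge A \<gamma> w U \<L> \<and>
         canonical_series_converge A \<beta> w U \<L> \<longrightarrow>
         {\<phi> \<in> Sol A U \<gamma>. d_fn U (ix 1) \<phi> = (\<lambda>z. 0)} = cspan (xpow_on U \<L> ` K)"
      unfolding Let_def by blast
  qed
qed

end
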